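(* Let $1\le m<n$ be integers, $K:\mathcal{X}^m\to[-1,1]$ a measurable, permutation-symmetric kernel on a measurable space $\mathcal{X}$, $\mathbf{X}=(X_1,\dots,X_n)\sim\mu^n$ an i.i.d. vector with values in $\mathcal{X}^n$, and $\theta=\mathbb{E}[K(X_1,\dots,X_m)]$. Let $\mathbf{W}=(W_1,\dots,W_M)$ be a fixed design, i.e. a sequence of $M\ge 1$ subsets of $\{1,\dots,n\}$ each of cardinality $m$. With $U_{\mathbf{W}}$, $A=A(\mathbf{W})$, $B=B(\mathbf{W})$, $C=C(\mathbf{W})$, $\alpha=\alpha(K)$, $\beta=\beta(K)$, $\gamma=\gamma(K)$ and $\sigma_1^2$ as defined in the context, for every $t>0$ $$\Pr\left\{U_{\mathbf{W}}(\mathbf{X})-\theta>t\right\}\le\exp\left(\frac{-t^2}{2A\sigma_1^2+B\beta/2+\left(\sqrt{B\gamma}+4C/3\right)t}\right),$$ and for every $0<\delta\le 1/e$, with probability at least $1-\delta$, $$U_{\mathbf{W}}(\mathbf{X})-\theta\le\sqrt{2A\sigma_1^2\ln(1/\delta)}+\left(\alpha\sqrt{B}+4C/3\right)\ln(1/\delta).$$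
   Context: Incomplete U-statistic: $U_{\mathbf{W}}(\mathbf{X})=\frac1M\sum_{i=1}^M K(\mathbf{X}^{W_i})$, where for $W=\{i_1,\dots,i_m\}\subset\{1,\dots,n\}$ we put $K(\mathbf{X}^W)=K(X_{i_1},\dots,X_{i_m})$ (the enumeration of $W$ is irrelevant by symmetry of $K$). Design quantities: for $k\ne l$ in $\{1,\dots,n\}$, $R_k=|\{i:k\in W_i\}|$, $R_{k,l}=|\{i:k,l\in W_i\}|$, and $$A(\mathbf{W})=\sum_{k=1}^n\frac{R_k^2}{M^2},\qquad B(\mathbf{W})=\sum_{k,l:k\ne l}\frac{R_{k,l}^2}{M^2},\qquad C(\mathbf{W})=\max_k\frac{R_k}{M},$$ where the sum in $B$ is over ordered pairs. Difference operators: for $f:\mathcal{X}^N\to\mathbb{R}$, $k\in\{1,\dots,N\}$, $y,y'\in\mathcal{X}$, $D^k_{y,y'}f(\mathbf{x})=f(S_y^k\mathbf{x})-f(S_{y'}^k\mathbf{x})$, where $S_y^k\mathbf{x}$ is $\mathbf{x}$ with its $k$-th coordinate replaced by $y$. Kernel quantities: with $X_1,\dots,X_m,X_1',X_2'$ i.i.d. $\sim\mu$, $$\beta(K)=\mathbb{E}\left[\left(D^1_{X_1,X_1'}D^2_{X_2,X_2'}K(X_1,\dots,X_m)\right)^2\right],$$ $$\gamma(K)=\sup_{\mathbf{x}\in\mathcal{X}^m,\,y,y'\in\mathcal{X}}\mathbb{E}\left[\left(D^1_{y,y'}D^2_{X_2,X_2'}K(x_1,\dots,x_m)\right)^2\right],$$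 $$\alpha(K)=\sqrt{\beta(K)/2}+\sqrt{\gamma(K)}.$$ For $m=1$ these are taken to be $0$ (there is no second argument). Finally $\sigma_1^2=\mathrm{Var}\left[\mathbb{E}[K(X_1,\dots,X_m)\mid X_1]\right]$. *)

theory Defs
  imports "HOL-Probability.Probability"
begin

text \<open>
  A point of \<open>\<X>\<^sup>m\<close> is a function in \<open>space (\<Pi>\<^sub>M j\<in>{1..m}. \<mu>)\<close>, i.e. an extensional function on
  \<open>{1..m}\<close>; a kernel is only constrained on such functions.  A design \<open>(W\<^sub>1, \<dots>, W\<^sub>M)\<close> is a
  function \<open>W :: nat \<Rightarrow> nat set\<close> of which only the values at \<open>1, \<dots>, M\<close> matter.
\<close>

abbreviation power_measure :: "nat \<Rightarrow> 'a measure \<Rightarrow> (nat \<Rightarrow> 'a) measure" where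
  "power_measure m \<mu> \<equiv> PiM {1..m} (\<lambda>_. \<mu>)"

definition symmetric_kernel :: "nat \<Rightarrow> 'a measure \<Rightarrow> ((nat \<Rightarrow> 'a) \<Rightarrow> real) \<Rightarrow> bool" where
  "symmetric_kernel m \<mu> K \<longleftrightarrow>
     (\<forall>\<pi>. \<pi> permutes {1..m} \<longrightarrow> (\<forall>x\<in>space (power_measure m \<mu>). K (x \<circ> \<pi>) = K x))"

text \<open>The elements of \<open>W\<close> are enumerated increasingly; \<open>sorted_list_of_set W\<close> is indexed from 0.\<close>

definition kernel_at :: "nat \<Rightarrow> ((nat \<Rightarrow> 'a) \<Rightarrow> real) \<Rightarrow> (nat \<Rightarrow> 'a) \<Rightarrow> nat set \<Rightarrow> real" where
  "kernel_at m K x W = K (\<lambda>j\<in>{1..m}. x (sorted_list_of_set W ! (j - 1)))"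

definition incomplete_U ::
    "nat \<Rightarrow> ((nat \<Rightarrow> 'a) \<Rightarrow> real) \<Rightarrow> nat \<Rightarrow> (nat \<Rightarrow> nat set) \<Rightarrow> (nat \<Rightarrow> 'a) \<Rightarrow> real" where
  "incomplete_U m K M W x = 1 / real M * (\<Sum>i=1..M. kernel_at m K x (W i))"

definition design_R :: "nat \<Rightarrow> (nat \<Rightarrow> nat set) \<Rightarrow> nat \<Rightarrow> nat" where
  "design_R M W k = card {i\<in>{1..M}. k \<in> W i}"

definition design_R2 :: "nat \<Rightarrow> (nat \<Rightarrow> nat set) \<Rightarrow> nat \<Rightarrow> nat \<Rightarrow> nat" where
  "design_R2 M W k l = card {i\<in>{1..M}. k \<in> W i \<and> l \<in> W i}"

definition design_A :: "nat \<Rightarrow> nat \<Rightarrow> (nat \<Rightarrow> nat set) \<Rightarrow> real" where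
  "design_A n M W = (\<Sum>k=1..n. (real (design_R M W k))\<^sup>2 / (real M)\<^sup>2)"

definition design_B :: "nat \<Rightarrow> nat \<Rightarrow> (nat \<Rightarrow> nat set) \<Rightarrow> real" where
  "design_B n M W =
     (\<Sum>k=1..n. \<Sum>l\<in>{1..n} - {k}. (real (design_R2 M W k l))\<^sup>2 / (real M)\<^sup>2)"

definition design_C :: "nat \<Rightarrow> nat \<Rightarrow> (nat \<Rightarrow> nat set) \<Rightarrow> real" where
  "design_C n M W = Max ((\<lambda>k. real (design_R M W k) / real M) ` {1..n})"

definition diff_op ::
    "nat \<Rightarrow> 'a \<Rightarrow> 'a \<Rightarrow> ((nat \<Rightarrow> 'a) \<Rightarrow> real) \<Rightarrow> (nat \<Rightarrow> 'a) \<Rightarrow> real" where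
  "diff_op k y y' f x = f (x(k := y)) - f (x(k := y'))"

text \<open>
  In \<open>kernel_beta\<close> the triple \<open>(x, x\<^sub>1', x\<^sub>2')\<close> plays the role of \<open>((X\<^sub>1, \<dots>, X\<^sub>m), X\<^sub>1', X\<^sub>2')\<close>; in
  \<open>kernel_gamma\<close> the pair \<open>(z, z')\<close> plays the role of \<open>(X\<^sub>2, X\<^sub>2')\<close>.  For a kernel bounded by 1
  the integrals in \<open>kernel_gamma\<close> lie in \<open>[0, 16]\<close>, so the real-valued supremum is the actual one.
\<close>

definition kernel_beta :: "nat \<Rightarrow> 'a measure \<Rightarrow> ((nat \<Rightarrow> 'a) \<Rightarrow> real) \<Rightarrow> real" where
  "kernel_beta m \<mu> K =
     (if m < 2 then 0
      else \<integral>(x, x1', x2'). (diff_op 1 (x 1) x1' (diff_op 2 (x 2) x2' K) x)\<^sup>2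
             \<partial>(power_measure m \<mu> \<Otimes>\<^sub>M (\<mu> \<Otimes>\<^sub>M \<mu>)))"

definition kernel_gamma :: "nat \<Rightarrow> 'a measure \<Rightarrow> ((nat \<Rightarrow> 'a) \<Rightarrow> real) \<Rightarrow> real" where
  "kernel_gamma m \<mu> K =
     (if m < 2 then 0
      else SUP (x, y, y') \<in> space (power_measure m \<mu>) \<times> space \<mu> \<times> space \<mu>.
             \<integral>(z, z'). (diff_op 1 y y' (diff_op 2 z z' K) x)\<^sup>2 \<partial>(\<mu> \<Otimes>\<^sub>M \<mu>))"

definition kernel_alpha :: "nat \<Rightarrow> 'a measure \<Rightarrow> ((nat \<Rightarrow> 'a) \<Rightarrow> real) \<Rightarrow> real" where
  "kernel_alpha m \<mu> K = sqrt (kernel_beta m \<mu> K / 2) + sqrt (kernel_gamma m \<mu> K)"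

text \<open>
  The variance of \<open>\<E>[K(X\<^sub>1, \<dots>, X\<^sub>m) | X\<^sub>1]\<close>, computed on the canonical space \<open>\<mu>\<^sup>m\<close>, where \<open>X\<^sub>1\<close> is
  the first coordinate and \<open>vimage_algebra\<close> gives the sigma-algebra it generates.
\<close>

definition kernel_sigma1_sq :: "nat \<Rightarrow> 'a measure \<Rightarrow> ((nat \<Rightarrow> 'a) \<Rightarrow> real) \<Rightarrow> real" where
  "kernel_sigma1_sq m \<mu> K =
     prob_space.variance (power_measure m \<mu>)
       (real_cond_exp (power_measure m \<mu>)
          (vimage_algebra (space (power_measure m \<mu>)) (\<lambda>x. x 1) \<mu>) K)"

end

theory Submission
  imports Defs
begin

text \<open>
  The proof is the entropy method, applied twice: once to the statistic and once to its local variance.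

  Let \<open>f\<close> be a bounded function of independent coordinates and let \<open>g\<close> be the sum over the
  coordinates \<open>k\<close> of the conditional variance of \<open>f\<close> in its \<open>k\<close>-th argument (\<open>sum_cond_var\<close>).
  Entropy is subadditive over independent coordinates (\<open>phi_entropy_tensorization\<close>), and on one
  coordinate a variable at most \<open>b\<close> above its mean satisfies a Bennett-type bound
  (\<open>ent_exp_le_var\<close>).  Together they give
  \<open>Ent(e\<^bsup>sf\<^esup>) \<le> (s\<^sup>2/2) / (1 - bs/3)\<^sup>2 * E[g e\<^bsup>sf\<^esup>]\<close>.
  The difficulty is that \<open>g\<close> is averaged under the tilted measure.  The Donsker-Varadhan inequality
  \<open>E[\<theta>g e\<^bsup>sf\<^esup>] \<le> Ent(e\<^bsup>sf\<^esup>) + E[e\<^bsup>sf\<^esup>] ln E[e\<^bsup>\<theta>g\<^esup>]\<close> decouples the two factors, at the price of the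
  exponential moment of \<open>g\<close>.

  That moment is controlled because \<open>g\<close> is self-bounding.  The square root of \<open>g\<close> is the Euclidean
  norm of the vector of conditional standard deviations, so moving coordinate \<open>k\<close> changes it by at
  most \<open>\<surd>q\<^sub>k\<close>, where \<open>q\<^sub>k\<close> bounds the sum, over the other coordinates, of the conditional variances of
  a first difference of \<open>f\<close> in coordinate \<open>k\<close>.  Hence \<open>(g - g')\<^sup>2 \<le> 2 q\<^sub>k (g + g')\<close>, which says that
  under every measure on coordinate \<open>k\<close> the variance of \<open>g\<close> is at most \<open>2 q\<^sub>k\<close> times its mean.
  Integrating this along the exponential tilt gives \<open>ln E[e\<^bsup>\<theta>g\<^esup>] \<le> \<theta> E[g] / (1 - Q\<theta>)\<close> with
  \<open>Q = \<Sum>q\<^sub>k\<close> (\<open>mgf_self_bounded\<close>).  The variance under the tilt matters here: bounding the increase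
  of \<open>g\<close> over its infimum in coordinate \<open>k\<close> would replace \<open>Q\<close> by \<open>2Q\<close>, and the constant of the
  theorem would be lost.  With the best \<open>\<theta>\<close> and Herbst's argument, \<open>f\<close> has a sub-gamma moment
  generating function with variance factor
  \<open>E[g]\<close> and scale \<open>b/3 + \<surd>(2Q)/2\<close> (\<open>log_mgf_bounded_interaction\<close>), and Chernoff's bound gives
  \<open>bernstein_bounded_interaction\<close>.

  For the incomplete U-statistic \<open>b = 2C\<close> and \<open>Q = B\<gamma>/2\<close>: the second difference of \<open>U\<close> in
  coordinates \<open>k\<close> and \<open>l\<close> only involves the \<open>R\<^sub>k\<^sub>l\<close> sets containing both, and by the symmetry of the
  kernel each of its terms is a second difference in the first two arguments.  For the same reason
  the Efron-Stein inequality, applied to the first difference of \<open>U\<close> in coordinate \<open>k\<close> as a function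
  of the other coordinates, gives \<open>E[g] \<le> A\<sigma>\<^sub>1\<^sup>2 + B\<beta>/4\<close> (\<open>mean_sum_cond_var_le\<close>).  The confidence
  bound is the tail bound at the deviation \<open>\<surd>(VL) + sL\<close>, where \<open>L = ln (1/\<delta>)\<close> and
  \<open>t\<^sup>2 / (V + st)\<close> is the exponent.
\<close>

section \<open>Bounded measurable functions\<close>

text \<open>
  On a probability space every such function is integrable, and the class is closed under
  arithmetic, composition and partial integration; all Fubini arguments below take place in it.
\<close>

definition bounded_measurable :: "'a measure \<Rightarrow> ('a \<Rightarrow> real) \<Rightarrow> bool" where
  "bounded_measurable M f \<longleftrightarrow> f \<in> borel_measurable M \<and> (\<exists>B. \<forall>x\<in>space M. \<bar>f x\<bar> \<le> B)"

lemma bmI: "f \<in> borel_measurable M \<Longrightarrow> (\<And>x. x \<in> space M \<Longrightarrow> \<bar>f x\<bar> \<le> B) \<Longrightarrow> bounded_measurable M f"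
  by (auto simp: bounded_measurable_def)

lemma bm_measurable: "bounded_measurable M f \<Longrightarrow> f \<in> borel_measurable M"
  by (auto simp: bounded_measurable_def)

lemma bmE:
  assumes "bounded_measurable M f"
  obtains B :: real where "B > 0" "\<And>x. x \<in> space M \<Longrightarrow> \<bar>f x\<bar> \<le> B"
proof -
  obtain B where "\<And>x. x \<in> space M \<Longrightarrow> \<bar>f x\<bar> \<le> B" using assms by (auto simp: bounded_measurable_def)
  then show ?thesis by (intro that[of "max B 1"]) (auto simp: le_max_iff_disj)
qed

lemma bm_const: "bounded_measurable M (\<lambda>_. c)"
  by (intro bmI[of _ _ "\<bar>c\<bar>"]) auto

lemma bm_add:
  assumes "bounded_measurable M f" "bounded_measurable M g"
  shows "bounded_measurable M (\<lambda>x. f x + g x)"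
proof -
  obtain A where A: "\<And>x. x \<in> space M \<Longrightarrow> \<bar>f x\<bar> \<le> A" using assms(1) by (rule bmE) auto
  obtain B where B: "\<And>x. x \<in> space M \<Longrightarrow> \<bar>g x\<bar> \<le> B" using assms(2) by (rule bmE) auto
  have "\<bar>f x + g x\<bar> \<le> A + B" if "x \<in> space M" for x
    using A[OF that] B[OF that] by linarith
  then show ?thesis using assms[THEN bm_measurable]
    by (intro bmI[of _ _ "A + B"]) auto
qed

lemma bm_mult:
  assumes "bounded_measurable M f" "bounded_measurable M g"
  shows "bounded_measurable M (\<lambda>x. f x * g x)"
proof -
  obtain A where A: "A > 0" "\<And>x. x \<in> space M \<Longrightarrow> \<bar>f x\<bar> \<le> A" using assms(1) by (rule bmE) auto
  obtain B where B: "\<And>x. x \<in> space M \<Longrightarrow> \<bar>g x\<bar> \<le> B" using assms(2) by (rule bmE) auto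
  with A show ?thesis using assms[THEN bm_measurable]
    by (intro bmI[of _ _ "A * B"]) (auto simp: abs_mult intro!: mult_mono)
qed

lemma bm_uminus: "bounded_measurable M f \<Longrightarrow> bounded_measurable M (\<lambda>x. - f x)"
  by (auto simp: bounded_measurable_def)

lemma bm_diff:
  "bounded_measurable M f \<Longrightarrow> bounded_measurable M g \<Longrightarrow> bounded_measurable M (\<lambda>x. f x - g x)"
  using bm_add[of M f "\<lambda>x. - g x"] by (simp add: bm_uminus)

lemma bm_power: "bounded_measurable M f \<Longrightarrow> bounded_measurable M (\<lambda>x. f x ^ k)"
  by (induction k) (simp_all add: bm_const bm_mult)

lemma bm_divide: "bounded_measurable M f \<Longrightarrow> bounded_measurable M (\<lambda>x. f x / c)"
  using bm_mult[of M f "\<lambda>_. 1 / c"] by (simp add: bm_const)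

lemma bm_sum: "(\<And>i. i \<in> I \<Longrightarrow> bounded_measurable M (f i)) \<Longrightarrow> bounded_measurable M (\<lambda>x. \<Sum>i\<in>I. f i x)"
  by (induction I rule: infinite_finite_induct) (simp_all add: bm_const bm_add)

lemma bm_compose:
  "bounded_measurable M f \<Longrightarrow> g \<in> measurable N M \<Longrightarrow> bounded_measurable N (\<lambda>x. f (g x))"
  unfolding bounded_measurable_def
  by (auto intro: measurable_compose dest: measurable_space)

lemma bm_comp_real:
  assumes "bounded_measurable M f" "\<phi> \<in> borel_measurable borel"
    "\<And>x. x \<in> space M \<Longrightarrow> f x \<in> S" "bounded (\<phi> ` S)"
  shows "bounded_measurable M (\<lambda>x. \<phi> (f x))"
proof -
  obtain B where "\<And>s. s \<in> S \<Longrightarrow> \<bar>\<phi> s\<bar> \<le> B"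
    using assms(4) by (auto simp: bounded_iff)
  with assms(1-3) show ?thesis
    by (intro bmI[of _ _ B]) (auto intro: measurable_compose[OF bm_measurable])
qed

lemma bm_exp:
  assumes "bounded_measurable M f" shows "bounded_measurable M (\<lambda>x. exp (f x))"
proof -
  obtain B where B: "\<And>x. x \<in> space M \<Longrightarrow> \<bar>f x\<bar> \<le> B" using assms by (rule bmE) auto
  show ?thesis
    by (intro bmI[of _ _ "exp B"])
      (use bm_measurable[OF assms] B in \<open>auto simp: abs_le_iff\<close>)
qed

lemma bm_integrable:
  assumes "prob_space M" "bounded_measurable M f" shows "integrable M f"
proof -
  obtain B where B: "\<And>x. x \<in> space M \<Longrightarrow> \<bar>f x\<bar> \<le> B" using assms(2) by (rule bmE) auto
  show ?thesis
    using B bm_measurable[OF assms(2)] prob_space.finite_measure[OF assms(1)]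
    by (intro finite_measure.integrable_const_bound[where B = B]) auto
qed

lemma bm_integral:
  assumes "prob_space N" "bounded_measurable (M \<Otimes>\<^sub>M N) (\<lambda>p. f (fst p) (snd p))"
  shows "bounded_measurable M (\<lambda>x. \<integral>y. f x y \<partial>N)"
proof -
  interpret N: prob_space N by fact
  obtain B where B: "B > 0" "\<And>p. p \<in> space (M \<Otimes>\<^sub>M N) \<Longrightarrow> \<bar>f (fst p) (snd p)\<bar> \<le> B"
    using assms(2) by (rule bmE) auto
  have m: "case_prod f \<in> borel_measurable (M \<Otimes>\<^sub>M N)"
    using bm_measurable[OF assms(2)] by (simp add: case_prod_unfold)
  have "\<bar>\<integral>y. f x y \<partial>N\<bar> \<le> B" if "x \<in> space M" for x
  proof -
    have "\<bar>\<integral>y. f x y \<partial>N\<bar> \<le> (\<integral>y. \<bar>f x y\<bar> \<partial>N)" by (rule integral_abs_bound)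
    also have "\<dots> \<le> (\<integral>y. B \<partial>N)"
      using B that by (intro Bochner_Integration.integral_mono' ) (auto simp: space_pair_measure)
    finally show ?thesis by (simp add: N.prob_space)
  qed
  then show ?thesis
    by (intro bmI[of _ _ B] N.borel_measurable_lebesgue_integral m)
qed

lemma bm_pair_section:
  "bounded_measurable (M \<Otimes>\<^sub>M N) (\<lambda>p. f (fst p) (snd p)) \<Longrightarrow> x \<in> space M \<Longrightarrow> bounded_measurable N (f x)"
  using bm_compose[of "M \<Otimes>\<^sub>M N" "\<lambda>p. f (fst p) (snd p)" "Pair x" N] by simp

lemma bm_pair_section2:
  "bounded_measurable (M \<Otimes>\<^sub>M N) (\<lambda>p. f (fst p) (snd p)) \<Longrightarrow> y \<in> space N
     \<Longrightarrow> bounded_measurable M (\<lambda>x. f x y)"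
  using bm_compose[of "M \<Otimes>\<^sub>M N" "\<lambda>p. f (fst p) (snd p)" "\<lambda>x. (x, y)" M] by simp

lemma bm_fubini:
  assumes "prob_space M" "prob_space N" "bounded_measurable (M \<Otimes>\<^sub>M N) (\<lambda>p. f (fst p) (snd p))"
  shows "(\<integral>x. \<integral>y. f x y \<partial>N \<partial>M) = (\<integral>y. \<integral>x. f x y \<partial>M \<partial>N)"
proof -
  interpret M: prob_space M by fact
  interpret N: prob_space N by fact
  interpret pair_prob_space M N ..
  have "integrable (M \<Otimes>\<^sub>M N) (\<lambda>p. f (fst p) (snd p))"
    by (rule bm_integrable[OF _ assms(3)]) unfold_locales
  then show ?thesis
    by (intro Fubini_integral[symmetric]) (simp add: case_prod_unfold)
qed

lemma bm_integral_mono: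
  assumes "prob_space M" "bounded_measurable M f" "bounded_measurable M g"
    "\<And>x. x \<in> space M \<Longrightarrow> f x \<le> g x"
  shows "(\<integral>x. f x \<partial>M) \<le> (\<integral>x. g x \<partial>M)"
  using assms by (intro integral_mono bm_integrable)

lemma bm_integral_range:
  fixes f :: "'a \<Rightarrow> real"
  assumes "prob_space M" "bounded_measurable M f" "\<And>x. x \<in> space M \<Longrightarrow> f x \<in> {lo..hi}"
  shows "(\<integral>x. f x \<partial>M) \<in> {lo..hi}"
proof -
  interpret prob_space M by fact
  have "(\<integral>x. lo \<partial>M) \<le> (\<integral>x. f x \<partial>M)" "(\<integral>x. f x \<partial>M) \<le> (\<integral>x. hi \<partial>M)"
    by (intro bm_integral_mono assms(1,2) bm_const; use assms(3) in auto)+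
  then show ?thesis by (simp add: prob_space)
qed

lemmas bm_intros = bm_const bm_add bm_mult bm_uminus bm_diff bm_power bm_divide bm_sum bm_exp

section \<open>Functionals with a jointly convex Bregman divergence\<close>

text \<open>
  The gap in Jensen's inequality.  It is the variance for \<open>\<Phi> x = x\<^sup>2\<close> and the entropy functional
  for \<open>\<Phi> x = x ln x\<close>; both are needed.
\<close>

definition phi_entropy :: "(real \<Rightarrow> real) \<Rightarrow> 'a measure \<Rightarrow> ('a \<Rightarrow> real) \<Rightarrow> real" where
  "phi_entropy \<Phi> M f = (\<integral>x. \<Phi> (f x) \<partial>M) - \<Phi> (\<integral>x. f x \<partial>M)"

text \<open>
  The expression \<open>\<Phi> x - \<Phi> t - \<Phi>' t * (x - t)\<close> is the Bregman divergence of \<open>\<Phi>\<close>.  The assumption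
  \<open>support\<close> says that it lies above its tangent plane at \<open>(x0, t0)\<close>, which is joint convexity in
  first-order form.
\<close>

locale jointly_convex_bregman =
  fixes \<Phi> \<Phi>' \<Phi>'' :: "real \<Rightarrow> real" and lo hi :: real
  assumes measurable: "\<Phi> \<in> borel_measurable borel" "\<Phi>' \<in> borel_measurable borel"
    and bounded: "bounded (\<Phi> ` {lo..hi})" "bounded (\<Phi>' ` {lo..hi})"
    and support: "\<lbrakk>x \<in> {lo..hi}; t \<in> {lo..hi}; x0 \<in> {lo..hi}; t0 \<in> {lo..hi}\<rbrakk> \<Longrightarrow>
       \<Phi> x0 - \<Phi> t0 - \<Phi>' t0 * (x0 - t0)
         + ((\<Phi>' x0 - \<Phi>' t0) * (x - x0) - \<Phi>'' t0 * (x0 - t0) * (t - t0))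
       \<le> \<Phi> x - \<Phi> t - \<Phi>' t * (x - t)"
begin

lemma bm_phi:
  assumes "bounded_measurable M f" "\<And>x. x \<in> space M \<Longrightarrow> f x \<in> {lo..hi}"
  shows "bounded_measurable M (\<lambda>x. \<Phi> (f x))" "bounded_measurable M (\<lambda>x. \<Phi>' (f x))"
  by (rule bm_comp_real[OF assms(1) measurable(1) assms(2) bounded(1)], assumption)
     (rule bm_comp_real[OF assms(1) measurable(2) assms(2) bounded(2)], assumption)

text \<open>
  The functional is the mean divergence of \<open>f\<close> from its own mean, so joint convexity of the
  divergence makes it convex in \<open>f\<close>.  In the proof the tangent plane is taken at \<open>(G x, t0)\<close>, the
  value and the mean of the mixture; its linear part integrates to zero.
\<close>

lemma phi_entropy_mixture_le:
  assumes M: "prob_space M" and N: "prob_space N"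
    and F: "bounded_measurable (M \<Otimes>\<^sub>M N) (\<lambda>p. F (fst p) (snd p))"
    and range: "\<And>x y. x \<in> space M \<Longrightarrow> y \<in> space N \<Longrightarrow> F x y \<in> {lo..hi}"
  shows "phi_entropy \<Phi> M (\<lambda>x. \<integral>y. F x y \<partial>N) \<le> (\<integral>y. phi_entropy \<Phi> M (\<lambda>x. F x y) \<partial>N)"
proof -
  interpret M: prob_space M by fact
  interpret N: prob_space N by fact
  have F': "bounded_measurable (N \<Otimes>\<^sub>M M) (\<lambda>p. F (snd p) (fst p))"
    using bm_compose[OF F measurable_pair_swap'] by (simp add: case_prod_unfold)
  define T where "T y = (\<integral>x. F x y \<partial>M)" for y
  define G where "G x = (\<integral>y. F x y \<partial>N)" for x
  define t0 where "t0 = (\<integral>x. G x \<partial>M)"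
  have t0': "t0 = (\<integral>y. T y \<partial>N)"
    unfolding t0_def G_def T_def by (rule bm_fubini[OF M N F])
  have [simp, intro]: "bounded_measurable N T" "bounded_measurable M G"
    unfolding T_def G_def by (rule bm_integral[OF M F'], rule bm_integral[OF N F])
  have sec: "x \<in> space M \<Longrightarrow> bounded_measurable N (F x)" 
     "y \<in> space N \<Longrightarrow> bounded_measurable M (\<lambda>x. F x y)" for x y
    using bm_pair_section[OF F] bm_pair_section2[OF F] by auto
  have Tr: "y \<in> space N \<Longrightarrow> T y \<in> {lo..hi}" for y
    unfolding T_def by (rule bm_integral_range[OF M sec(2)]) (auto simp: range[simplified])
  have Gr: "x \<in> space M \<Longrightarrow> G x \<in> {lo..hi}" for x
    unfolding G_def by (rule bm_integral_range[OF N sec(1)]) (auto simp: range[simplified])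
  have t0r: "t0 \<in> {lo..hi}"
    unfolding t0_def by (rule bm_integral_range[OF M]) (use Gr in auto)
  have [simp, intro]: "bounded_measurable N (\<lambda>y. \<Phi> (T y))" "bounded_measurable N (\<lambda>y. \<Phi>' (T y))"
    "bounded_measurable M (\<lambda>y. \<Phi> (G y))" "bounded_measurable M (\<lambda>y. \<Phi>' (G y))"
    using Tr Gr by (auto intro!: bm_phi)
  define L where "L x y = \<Phi> (F x y) - \<Phi> (T y) - \<Phi>' (T y) * (F x y - T y)" for x y
  define R where "R x y = \<Phi> (G x) - \<Phi> t0 - \<Phi>' t0 * (G x - t0)
         + ((\<Phi>' (G x) - \<Phi>' t0) * (F x y - G x) - \<Phi>'' t0 * (G x - t0) * (T y - t0))" for x y
  have le: "R x y \<le> L x y" if "x \<in> space M" "y \<in> space N" for x y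
    unfolding L_def R_def using that by (intro support range Tr Gr t0r)
  have pM: "bounded_measurable M f \<Longrightarrow> bounded_measurable (M \<Otimes>\<^sub>M N) (\<lambda>p. f (fst p))" for f
    by (rule bm_compose) auto
  have pN: "bounded_measurable N f \<Longrightarrow> bounded_measurable (M \<Otimes>\<^sub>M N) (\<lambda>p. f (snd p))" for f
    by (rule bm_compose) auto
  have phiF: "bounded_measurable (M \<Otimes>\<^sub>M N) (\<lambda>p. \<Phi> (F (fst p) (snd p)))"
    using F range by (intro bm_phi) (auto simp: space_pair_measure)
  have bL: "bounded_measurable (M \<Otimes>\<^sub>M N) (\<lambda>p. L (fst p) (snd p))"
    unfolding L_def by (intro bm_intros phiF F pM pN) auto
  have bR: "bounded_measurable (M \<Otimes>\<^sub>M N) (\<lambda>p. R (fst p) (snd p))"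
    unfolding R_def by (intro bm_intros phiF F pM pN) auto
  have bL': "bounded_measurable N (\<lambda>y. \<integral>x. L x y \<partial>M)"
    using bm_compose[OF bL measurable_pair_swap'] by (intro bm_integral M) (simp add: case_prod_unfold)
  have bR': "bounded_measurable N (\<lambda>y. \<integral>x. R x y \<partial>M)"
    using bm_compose[OF bR measurable_pair_swap'] by (intro bm_integral M) (simp add: case_prod_unfold)
  have phisec: "y \<in> space N \<Longrightarrow> bounded_measurable M (\<lambda>x. \<Phi> (F x y))" for y
    using bm_pair_section2[OF phiF] by auto
  have inL: "(\<integral>x. L x y \<partial>M) = phi_entropy \<Phi> M (\<lambda>x. F x y)" if y: "y \<in> space N" for y
    unfolding L_def phi_entropy_def using sec(2)[OF y] phisec[OF y] M.prob_space
    by (simp add: bm_integrable[OF M] bm_intros T_def[symmetric])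
  have inR: "(\<integral>y. R x y \<partial>N) = \<Phi> (G x) - \<Phi> t0 - \<Phi>' t0 * (G x - t0)" if x: "x \<in> space M" for x
    unfolding R_def using sec(1)[OF x] N.prob_space
    by (simp add: bm_integrable[OF N] bm_intros G_def[symmetric] t0'[symmetric])
  have "phi_entropy \<Phi> M G = (\<integral>x. \<Phi> (G x) - \<Phi> t0 - \<Phi>' t0 * (G x - t0) \<partial>M)"
    unfolding phi_entropy_def using M.prob_space
    by (simp add: bm_integrable[OF M] bm_intros t0_def[symmetric])
  also have "\<dots> = (\<integral>x. \<integral>y. R x y \<partial>N \<partial>M)"
    by (intro Bochner_Integration.integral_cong) (simp_all add: inR)
  also have "\<dots> = (\<integral>y. \<integral>x. R x y \<partial>M \<partial>N)"
    by (rule bm_fubini[OF M N bR])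
  also have "\<dots> \<le> (\<integral>y. \<integral>x. L x y \<partial>M \<partial>N)"
    by (intro bm_integral_mono M N bL' bR' le bm_pair_section2[OF bL] bm_pair_section2[OF bR])
  also have "\<dots> = (\<integral>y. phi_entropy \<Phi> M (\<lambda>x. F x y) \<partial>N)"
    by (intro Bochner_Integration.integral_cong) (simp_all add: inL)
  finally show ?thesis unfolding G_def .
qed

end

section \<open>Independent coordinates and tensorization\<close>

abbreviation iid_measure :: "'i set \<Rightarrow> 'a measure \<Rightarrow> ('i \<Rightarrow> 'a) measure" where
  "iid_measure I \<mu> \<equiv> PiM I (\<lambda>_. \<mu>)"

lemma prob_space_iid: "prob_space \<mu> \<Longrightarrow> prob_space (iid_measure I \<mu>)"
  by (rule prob_space_PiM)

lemma iid_measure_space_update: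
  "x \<in> space (iid_measure I \<mu>) \<Longrightarrow> y \<in> space \<mu> \<Longrightarrow> x(k := y) \<in> space (iid_measure (insert k I) \<mu>)"
  by (auto simp: space_PiM PiE_def Pi_def extensional_def)

lemma space_update:
  "x \<in> space (iid_measure I \<mu>) \<Longrightarrow> y \<in> space \<mu> \<Longrightarrow> k \<in> I \<Longrightarrow> x(k := y) \<in> space (iid_measure I \<mu>)"
  using iid_measure_space_update[of x I \<mu> y k] by (simp add: insert_absorb)

lemma measurable_update:
  "k \<in> I \<Longrightarrow> (\<lambda>p. (fst p)(k := snd p)) \<in> measurable (iid_measure I \<mu> \<Otimes>\<^sub>M \<mu>) (iid_measure I \<mu>)"
  by (rule measurable_fun_upd[where J = I]) auto

lemma measurable_update_insert:
  "(\<lambda>p. (fst p)(k := snd p)) \<in> measurable (iid_measure I \<mu> \<Otimes>\<^sub>M \<mu>) (iid_measure (insert k I) \<mu>)"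
  by (rule measurable_fun_upd[where J = I]) auto

lemma measurable_section_update:
  "x \<in> space (iid_measure I \<mu>) \<Longrightarrow> (\<lambda>y. x(k := y)) \<in> measurable \<mu> (iid_measure (insert k I) \<mu>)"
  by (rule measurable_fun_upd[where J = I]) auto

lemma bm_update:
  assumes "bounded_measurable (iid_measure I \<mu>) f" "k \<in> I"
  shows "bounded_measurable (iid_measure I \<mu> \<Otimes>\<^sub>M \<mu>) (\<lambda>p. f ((fst p)(k := snd p)))"
  by (rule bm_compose[OF assms(1) measurable_update[OF assms(2)]])

lemma bm_section:
  assumes "bounded_measurable (iid_measure I \<mu>) f" "k \<in> I" "x \<in> space (iid_measure I \<mu>)"
  shows "bounded_measurable \<mu> (\<lambda>y. f (x(k := y)))"
  using bm_compose[OF assms(1), OF measurable_section_update[OF assms(3), of k, unfolded insert_absorb[OF assms(2)]]] .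

lemma bm_section_mean:
  assumes "prob_space \<mu>" "bounded_measurable (iid_measure I \<mu>) f" "k \<in> I"
  shows "bounded_measurable (iid_measure I \<mu>) (\<lambda>x. \<integral>y. f (x(k := y)) \<partial>\<mu>)"
  using bm_update[OF assms(2,3)] by (intro bm_integral assms(1))

lemma integral_iid_insert:
  assumes "prob_space \<mu>" "finite I" "i \<notin> I" "bounded_measurable (iid_measure (insert i I) \<mu>) f"
  shows "(\<integral>x. f x \<partial>iid_measure (insert i I) \<mu>) = (\<integral>x. \<integral>y. f (x(i := y)) \<partial>\<mu> \<partial>iid_measure I \<mu>)"
proof -
  interpret prob_space \<mu> by fact
  interpret product_prob_space "\<lambda>_. \<mu>" by unfold_locales
  show ?thesis
    using assms by (intro product_integral_insert bm_integrable prob_space_iid)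
qed

text \<open>
  Overwriting one coordinate by an independent copy does not change the law of the vector.
\<close>

lemma integral_resample:
  assumes "prob_space \<mu>" "finite I" "k \<in> I" "bounded_measurable (iid_measure I \<mu>) f"
  shows "(\<integral>x. f x \<partial>iid_measure I \<mu>) = (\<integral>x. \<integral>y. f (x(k := y)) \<partial>\<mu> \<partial>iid_measure I \<mu>)"
proof -
  interpret prob_space \<mu> by fact
  define J where "J = I - {k}"
  have I: "I = insert k J" "k \<notin> J" "finite J" using assms by (auto simp: J_def)
  have "(\<integral>x. \<integral>y. f (x(k := y)) \<partial>\<mu> \<partial>iid_measure I \<mu>)
      = (\<integral>x. \<integral>z. \<integral>y. f (x(k := z, k := y)) \<partial>\<mu> \<partial>\<mu> \<partial>iid_measure J \<mu>)"
    using bm_section_mean[OF assms(1,4,3)] assms(1) I by (simp add: integral_iid_insert)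
  also have "\<dots> = (\<integral>x. f x \<partial>iid_measure I \<mu>)"
    using I assms by (simp add: prob_space integral_iid_insert)
  finally show ?thesis by simp
qed

context jointly_convex_bregman
begin

lemma bm_phi_entropy_section:
  assumes \<mu>: "prob_space \<mu>" and "k \<in> I" and Z: "bounded_measurable (iid_measure I \<mu>) Z"
    and range: "\<And>x. x \<in> space (iid_measure I \<mu>) \<Longrightarrow> Z x \<in> {lo..hi}"
  shows "bounded_measurable (iid_measure I \<mu>) (\<lambda>x. phi_entropy \<Phi> \<mu> (\<lambda>y. Z (x(k := y))))"
  unfolding phi_entropy_def
proof (intro bm_diff bm_phi)
  show "bounded_measurable (iid_measure I \<mu>) (\<lambda>x. \<integral>y. \<Phi> (Z (x(k := y))) \<partial>\<mu>)"
    by (intro bm_section_mean \<mu> assms bm_phi Z range)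
  show "bounded_measurable (iid_measure I \<mu>) (\<lambda>x. \<integral>y. Z (x(k := y)) \<partial>\<mu>)"
    by (intro bm_section_mean \<mu> assms Z)
  fix x assume "x \<in> space (iid_measure I \<mu>)"
  then show "(\<integral>y. Z (x(k := y)) \<partial>\<mu>) \<in> {lo..hi}"
    using assms by (intro bm_integral_range \<mu> bm_section[OF Z] range space_update)
qed

text \<open>
  Adding a coordinate \<open>i\<close> splits the functional into its mean over coordinate \<open>i\<close> and the functional
  of the partial mean \<open>G\<close> over the old coordinates.  The induction hypothesis bounds the latter by
  terms for \<open>G\<close>, and convexity replaces \<open>G\<close> by the original function in each of them.
\<close>

theorem phi_entropy_tensorization:
  assumes \<mu>: "prob_space \<mu>" and "finite I" and "bounded_measurable (iid_measure I \<mu>) Z"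
    and "\<And>x. x \<in> space (iid_measure I \<mu>) \<Longrightarrow> Z x \<in> {lo..hi}"
  shows "phi_entropy \<Phi> (iid_measure I \<mu>) Z
      \<le> (\<Sum>k\<in>I. \<integral>x. phi_entropy \<Phi> \<mu> (\<lambda>y. Z (x(k := y))) \<partial>iid_measure I \<mu>)"
  using assms(2-4)
proof (induction I arbitrary: Z rule: finite_induct)
  case empty
  then show ?case
    by (simp add: phi_entropy_def PiM_empty lebesgue_integral_count_space_finite)
next
  case (insert i I Z)
  interpret \<mu>: prob_space \<mu> by fact
  let ?P = "iid_measure I \<mu>" and ?Q = "iid_measure (insert i I) \<mu>"
  note Z = insert.prems(1) and range = insert.prems(2)
  have P: "prob_space ?P" by (rule prob_space_iid[OF \<mu>])
  note ins = integral_iid_insert[OF \<mu> insert.hyps]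
  note upd = iid_measure_space_update[of _ I \<mu> _ i]
  define G where "G x = (\<integral>y. Z (x(i := y)) \<partial>\<mu>)" for x
  have Zu: "bounded_measurable (?P \<Otimes>\<^sub>M \<mu>) (\<lambda>p. Z ((fst p)(i := snd p)))"
    by (rule bm_compose[OF Z measurable_update_insert])
  have G: "bounded_measurable ?P G"
    unfolding G_def by (rule bm_integral[OF \<mu> Zu])
  have Zs: "bounded_measurable \<mu> (\<lambda>y. Z (x(i := y)))" if "x \<in> space ?P" for x
    using bm_pair_section[OF Zu that] .
  have Grange: "G x \<in> {lo..hi}" if "x \<in> space ?P" for x
    unfolding G_def using that by (intro bm_integral_range \<mu> Zs range upd)
  have bPhiZ: "bounded_measurable ?Q (\<lambda>x. \<Phi> (Z x))" by (intro bm_phi Z range)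
  have bPhiZi: "bounded_measurable ?P (\<lambda>x. \<integral>y. \<Phi> (Z (x(i := y))) \<partial>\<mu>)"
    using bm_compose[OF bPhiZ measurable_update_insert] by (intro bm_integral \<mu>)
  have bPhiG: "bounded_measurable ?P (\<lambda>x. \<Phi> (G x))" by (intro bm_phi G Grange)
  have bent: "bounded_measurable ?Q (\<lambda>x. phi_entropy \<Phi> \<mu> (\<lambda>y. Z (x(k := y))))" if "k \<in> insert i I" for k
    using that by (intro bm_phi_entropy_section \<mu> Z range)
  have first: "(\<integral>x. phi_entropy \<Phi> \<mu> (\<lambda>y. Z (x(i := y))) \<partial>?P)
      = (\<integral>x. phi_entropy \<Phi> \<mu> (\<lambda>y. Z (x(i := y))) \<partial>?Q)"
    using \<mu>.prob_space by (subst ins[OF bent]) simp_all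
  have second: "(\<integral>x. phi_entropy \<Phi> \<mu> (\<lambda>y. G (x(k := y))) \<partial>?P)
      \<le> (\<integral>x. phi_entropy \<Phi> \<mu> (\<lambda>y. Z (x(k := y))) \<partial>?Q)" if k: "k \<in> I" for k
  proof -
    have ki: "k \<noteq> i" using k insert.hyps by auto
    have "(\<integral>x. phi_entropy \<Phi> \<mu> (\<lambda>y. G (x(k := y))) \<partial>?P)
       \<le> (\<integral>x. \<integral>z. phi_entropy \<Phi> \<mu> (\<lambda>y. Z (x(k := y, i := z))) \<partial>\<mu> \<partial>?P)"
    proof (rule bm_integral_mono[OF P])
      show "bounded_measurable ?P (\<lambda>x. phi_entropy \<Phi> \<mu> (\<lambda>y. G (x(k := y))))"
        using k by (intro bm_phi_entropy_section \<mu> G Grange)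
      show "bounded_measurable ?P (\<lambda>x. \<integral>z. phi_entropy \<Phi> \<mu> (\<lambda>y. Z (x(k := y, i := z))) \<partial>\<mu>)"
        using bm_compose[OF bent measurable_update_insert] k ki
        by (intro bm_integral \<mu>) (simp add: fun_upd_twist[OF ki])
      fix x assume x: "x \<in> space ?P"
      have "(\<lambda>p. x(k := fst p, i := snd p)) \<in> measurable (\<mu> \<Otimes>\<^sub>M \<mu>) ?Q"
        using x k by (intro measurable_fun_upd[where J = I] measurable_fun_upd[where I = I and J = I]) auto
      then have F: "bounded_measurable (\<mu> \<Otimes>\<^sub>M \<mu>) (\<lambda>p. Z (x(k := fst p, i := snd p)))"
        by (rule bm_compose[OF Z])
      show "phi_entropy \<Phi> \<mu> (\<lambda>y. G (x(k := y)))
          \<le> (\<integral>z. phi_entropy \<Phi> \<mu> (\<lambda>y. Z (x(k := y, i := z))) \<partial>\<mu>)"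
        unfolding G_def using x k
        by (intro phi_entropy_mixture_le \<mu> F range upd space_update)
    qed
    also have "\<dots> = (\<integral>x. phi_entropy \<Phi> \<mu> (\<lambda>y. Z (x(k := y))) \<partial>?Q)"
      using k ki by (subst ins[OF bent]) (simp_all add: fun_upd_twist[OF ki])
    finally show ?thesis .
  qed
  have "phi_entropy \<Phi> ?Q Z = (\<integral>x. phi_entropy \<Phi> \<mu> (\<lambda>y. Z (x(i := y))) \<partial>?P) + phi_entropy \<Phi> ?P G"
    unfolding phi_entropy_def G_def[symmetric] ins[OF Z] ins[OF bPhiZ]
    using bm_integrable[OF P bPhiZi] bm_integrable[OF P bPhiG] by simp
  also have "phi_entropy \<Phi> ?P G \<le> (\<Sum>k\<in>I. \<integral>x. phi_entropy \<Phi> \<mu> (\<lambda>y. G (x(k := y))) \<partial>?P)"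
    by (rule insert.IH[OF G Grange])
  also have "\<dots> \<le> (\<Sum>k\<in>I. \<integral>x. phi_entropy \<Phi> \<mu> (\<lambda>y. Z (x(k := y))) \<partial>?Q)"
    by (intro sum_mono second)
  finally show ?case
    by (simp only: first sum.insert[OF insert.hyps])
qed

end

lemma entropy_integrand_nonneg:
  fixes x r :: real
  assumes "x > 0" "r > 0"
  shows "0 \<le> x * ln x - x * ln r - x + r"
proof -
  have "x * ln (r / x) \<le> x * (r / x - 1)"
    using assms by (intro mult_left_mono ln_le_minus_one) auto
  moreover have "x * (r / x - 1) = r - x" using assms by (simp add: field_simps)
  ultimately show ?thesis using assms by (simp add: ln_div algebra_simps)
qed

lemma jointly_convex_bregman_xlnx:
  assumes "0 < lo"
  shows "jointly_convex_bregman (\<lambda>x. x * ln x) (\<lambda>x. ln x + 1) (\<lambda>x. 1 / x) lo hi"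
proof
  have "compact ((\<lambda>x. x * ln x) ` {lo..hi})" "compact ((\<lambda>x. ln x + 1) ` {lo..hi})"
    using assms by (auto intro!: compact_continuous_image continuous_intros)
  then show "bounded ((\<lambda>x. x * ln x) ` {lo..hi})" "bounded ((\<lambda>x. ln x + 1) ` {lo..hi})"
    by (auto intro: compact_imp_bounded)
  fix x t x0 t0 assume *: "x \<in> {lo..hi}" "t \<in> {lo..hi}" "x0 \<in> {lo..hi}" "t0 \<in> {lo..hi}"
  have pos: "x > 0" "t > 0" "x0 > 0" "t0 > 0" using * assms by auto
  have "0 \<le> x * ln x - x * ln (t * x0 / t0) - x + t * x0 / t0"
    using pos by (intro entropy_integrand_nonneg) auto
  then have "0 \<le> x * ln x - x * ln t - x * ln x0 + x * ln t0 - x + t * x0 / t0"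
    using pos by (simp add: ln_div ln_mult algebra_simps)
  then show "x0 * ln x0 - t0 * ln t0 - (ln t0 + 1) * (x0 - t0) +
       ((ln x0 + 1 - (ln t0 + 1)) * (x - x0) - 1 / t0 * (x0 - t0) * (t - t0))
       \<le> x * ln x - t * ln t - (ln t + 1) * (x - t)"
    using pos by (simp add: field_simps)
qed auto

lemma jointly_convex_bregman_square:
  "jointly_convex_bregman (\<lambda>x. x\<^sup>2) (\<lambda>x. 2 * x) (\<lambda>_. 2) lo hi"
proof
  have "compact ((\<lambda>x. x\<^sup>2) ` {lo..hi})" "compact ((\<lambda>x. 2 * x) ` {lo..hi})"
    by (auto intro!: compact_continuous_image continuous_intros)
  then show "bounded ((\<lambda>x. x\<^sup>2) ` {lo..hi})" "bounded ((\<lambda>x. 2 * x) ` {lo..hi})"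
    by (auto intro: compact_imp_bounded)
  fix x t x0 t0 :: real
  have "0 \<le> ((x - t) - (x0 - t0))\<^sup>2" by simp
  then show "x0\<^sup>2 - t0\<^sup>2 - 2 * t0 * (x0 - t0) + ((2 * x0 - 2 * t0) * (x - x0) - 2 * (x0 - t0) * (t - t0))
     \<le> x\<^sup>2 - t\<^sup>2 - 2 * t * (x - t)"
    by (simp add: power2_eq_square algebra_simps)
qed auto

abbreviation ent :: "'a measure \<Rightarrow> ('a \<Rightarrow> real) \<Rightarrow> real" where
  "ent \<equiv> phi_entropy (\<lambda>x. x * ln x)"

abbreviation var :: "'a measure \<Rightarrow> ('a \<Rightarrow> real) \<Rightarrow> real" where
  "var \<equiv> phi_entropy (\<lambda>x. x\<^sup>2)"

lemma bm_range:
  assumes "bounded_measurable M f"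
  obtains B :: real where "B > 0" "\<And>x. x \<in> space M \<Longrightarrow> f x \<in> {- B..B}"
    "\<And>x. x \<in> space M \<Longrightarrow> exp (f x) \<in> {exp (- B)..exp B}"
  using assms by (rule bmE) (force simp: abs_le_iff)

lemma bm_ent_section:
  assumes "prob_space \<mu>" "k \<in> I" and f: "bounded_measurable (iid_measure I \<mu>) f"
  shows "bounded_measurable (iid_measure I \<mu>) (\<lambda>x. ent \<mu> (\<lambda>y. exp (f (x(k := y)))))"
proof -
  obtain B where "\<And>x. x \<in> space (iid_measure I \<mu>) \<Longrightarrow> exp (f x) \<in> {exp (- B)..exp B}"
    using f by (rule bm_range) blast
  from jointly_convex_bregman.bm_phi_entropy_section[OF jointly_convex_bregman_xlnx assms(1,2) bm_exp[OF f] this]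
  show ?thesis by simp
qed

lemma entropy_subadditive:
  assumes "prob_space \<mu>" "finite I" and f: "bounded_measurable (iid_measure I \<mu>) f"
  shows "ent (iid_measure I \<mu>) (\<lambda>x. exp (f x))
     \<le> (\<Sum>k\<in>I. \<integral>x. ent \<mu> (\<lambda>y. exp (f (x(k := y)))) \<partial>iid_measure I \<mu>)"
proof -
  obtain B where "\<And>x. x \<in> space (iid_measure I \<mu>) \<Longrightarrow> exp (f x) \<in> {exp (- B)..exp B}"
    using f by (rule bm_range) blast
  from jointly_convex_bregman.phi_entropy_tensorization[OF jointly_convex_bregman_xlnx assms(1,2) bm_exp[OF f] this]
  show ?thesis by simp
qed

lemma bm_var_section:
  assumes "prob_space \<mu>" "k \<in> I" and f: "bounded_measurable (iid_measure I \<mu>) f"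
  shows "bounded_measurable (iid_measure I \<mu>) (\<lambda>x. var \<mu> (\<lambda>y. f (x(k := y))))"
proof -
  obtain B where "\<And>x. x \<in> space (iid_measure I \<mu>) \<Longrightarrow> f x \<in> {- B..B}"
    using f by (rule bm_range) blast
  from jointly_convex_bregman.bm_phi_entropy_section[OF jointly_convex_bregman_square assms(1,2) f this]
  show ?thesis by simp
qed

theorem efron_stein:
  assumes "prob_space \<mu>" "finite I" and f: "bounded_measurable (iid_measure I \<mu>) f"
  shows "var (iid_measure I \<mu>) f \<le> (\<Sum>k\<in>I. \<integral>x. var \<mu> (\<lambda>y. f (x(k := y))) \<partial>iid_measure I \<mu>)"
proof -
  obtain B where "\<And>x. x \<in> space (iid_measure I \<mu>) \<Longrightarrow> f x \<in> {- B..B}"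
    using f by (rule bm_range) blast
  from jointly_convex_bregman.phi_entropy_tensorization[OF jointly_convex_bregman_square assms(1,2) f this]
  show ?thesis by simp
qed

section \<open>Entropy of exponentials on one probability space\<close>

lemma var_eq_centered:
  assumes "prob_space M" "bounded_measurable M h"
  shows "var M h = (\<integral>x. (h x - (\<integral>x. h x \<partial>M))\<^sup>2 \<partial>M)"
proof -
  interpret prob_space M by fact
  show ?thesis
    using assms by (simp add: phi_entropy_def power2_diff bm_integrable bm_intros prob_space)
      (simp add: power2_eq_square)
qed

lemma var_nonneg:
  "prob_space M \<Longrightarrow> bounded_measurable M h \<Longrightarrow> 0 \<le> var M h"
  by (simp add: var_eq_centered)

lemma var_eq_double_integral:
  assumes "prob_space M" "bounded_measurable M h"
  shows "var M h = 1 / 2 * (\<integral>x. \<integral>y. (h x - h y)\<^sup>2 \<partial>M \<partial>M)"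
proof -
  interpret prob_space M by fact
  show ?thesis
    using assms by (simp add: phi_entropy_def power2_diff bm_integrable bm_intros prob_space)
      (simp add: power2_eq_square)
qed

lemma ent_exp:
  "ent M (\<lambda>x. exp (h x)) = (\<integral>x. exp (h x) * h x \<partial>M) - (\<integral>x. exp (h x) \<partial>M) * ln (\<integral>x. exp (h x) \<partial>M)"
  by (simp add: phi_entropy_def)

lemma mgf_pos:
  assumes "prob_space M" "bounded_measurable M h"
  shows "0 < (\<integral>x. exp (h x) \<partial>M)"
proof -
  obtain B where B: "\<And>x. x \<in> space M \<Longrightarrow> exp (h x) \<in> {exp (- B)..exp B}"
    using assms(2) by (rule bm_range) blast
  have "exp (- B) \<le> (\<integral>x. exp (h x) \<partial>M)"
    using bm_integral_range[OF assms(1) bm_exp[OF assms(2)] B] by simp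
  then show ?thesis using exp_gt_zero[of "- B"] by linarith
qed

text \<open>
  On the positive side the two sides agree to second order at \<open>0\<close>, and the inequality between their
  derivatives, \<open>x e\<^sup>x \<le> x / (1 - x/3)\<^sup>3\<close>, is the cube of \<open>e\<^bsup>x/3\<^esup> \<le> 1 / (1 - x/3)\<close>.
\<close>

lemma bennett_integrand_le:
  fixes v w :: real
  assumes "v \<le> w" "0 \<le> w" "w < 3"
  shows "v * exp v - exp v + 1 \<le> v\<^sup>2 / 2 / (1 - w / 3)\<^sup>2"
proof (cases "v \<le> 0")
  case True
  have "v * exp v - exp v - v\<^sup>2 / 2 \<le> 0 * exp 0 - exp 0 - 0\<^sup>2 / 2"
  proof (rule DERIV_nonneg_imp_nondecreasing[OF True])
    fix x :: real
    have "((\<lambda>v. v * exp v - exp v - v\<^sup>2 / 2) has_real_derivative x * (exp x - 1)) (at x)"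
      by (auto intro!: derivative_eq_intros simp: algebra_simps)
    moreover have "0 \<le> x * (exp x - 1)" by (auto simp: zero_le_mult_iff)
    ultimately show "\<exists>y. ((\<lambda>v. v * exp v - exp v - v\<^sup>2 / 2) has_real_derivative y) (at x) \<and> 0 \<le> y"
      by blast
  qed
  then have "v * exp v - exp v + 1 \<le> v\<^sup>2 / 2 / 1" by simp
  also have "\<dots> \<le> v\<^sup>2 / 2 / (1 - w / 3)\<^sup>2"
    using assms by (intro divide_left_mono) (auto simp: power_le_one_iff)
  finally show ?thesis .
next
  case False
  then have v: "0 \<le> v" "v < 3" using assms by auto
  let ?d = "\<lambda>v::real. v\<^sup>2 / 2 / (1 - v / 3)\<^sup>2 - (v * exp v - exp v)"
  have "?d 0 \<le> ?d v"
  proof (rule DERIV_nonneg_imp_nondecreasing[OF v(1)])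
    fix x :: real assume x: "0 \<le> x" "x \<le> v"
    then have x3: "1 - x / 3 > 0" using v by simp
    define q where "q = 1 - x / 3"
    have q: "q > 0" "q\<^sup>2 \<noteq> 0" using x3 by (auto simp: q_def)
    have "((\<lambda>v. v\<^sup>2 / 2) has_real_derivative x) (at x)"
      "((\<lambda>v. (1 - v / 3)\<^sup>2) has_real_derivative - (2 * q / 3)) (at x)"
      "((\<lambda>v. v * exp v - exp v) has_real_derivative x * exp x) (at x)"
      by (auto intro!: derivative_eq_intros simp: q_def)
    from DERIV_diff[OF DERIV_divide[OF this(1,2)] this(3)]
    have "(?d has_real_derivative (x * q\<^sup>2 - x\<^sup>2 / 2 * - (2 * q / 3)) / (q\<^sup>2 * q\<^sup>2) - x * exp x) (at x)"
      using q unfolding q_def by simp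
    also have "x * q\<^sup>2 - x\<^sup>2 / 2 * - (2 * q / 3) = x * q"
      by (simp add: q_def power2_eq_square field_simps)
    also have "x * q / (q\<^sup>2 * q\<^sup>2) = x / q ^ 3"
      using q by (simp add: power2_eq_square power3_eq_cube)
    finally have "(?d has_real_derivative x / (1 - x / 3) ^ 3 - x * exp x) (at x)"
      unfolding q_def .
    moreover have "exp (x / 3) \<le> 1 / (1 - x / 3)"
      using exp_ge_add_one_self[of "- (x / 3)"] x3 by (simp add: exp_minus field_simps)
    then have "exp (x / 3) ^ 3 \<le> (1 / (1 - x / 3)) ^ 3" by (intro power_mono) auto
    then have "exp x \<le> 1 / (1 - x / 3) ^ 3"
      by (simp add: exp_of_nat_mult[symmetric] power_one_over)
    then have "x * exp x \<le> x * (1 / (1 - x / 3) ^ 3)" using x by (intro mult_left_mono) auto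
    ultimately show "\<exists>y. (?d has_real_derivative y) (at x) \<and> 0 \<le> y"
      by (intro exI[of _ "x / (1 - x / 3) ^ 3 - x * exp x"]) auto
  qed
  then have "v * exp v - exp v + 1 \<le> v\<^sup>2 / 2 / (1 - v / 3)\<^sup>2" by simp
  also have "\<dots> \<le> v\<^sup>2 / 2 / (1 - w / 3)\<^sup>2"
    using assms v by (intro divide_left_mono power_mono mult_pos_pos zero_less_power) auto
  finally show ?thesis .
qed

text \<open>
  The entropy functional of \<open>Z\<close> is the minimum over \<open>c > 0\<close> of \<open>E[Z ln (Z/c) - Z + c]\<close>.  The choice
  \<open>c = e\<^bsup>E h\<^esup>\<close> gives \<open>c\<close> times the mean of \<open>v e\<^sup>v - e\<^sup>v + 1\<close> at \<open>v = h - E h\<close>, and \<open>c \<le> E e\<^sup>h\<close> by Jensen.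
\<close>

lemma ent_exp_le_var:
  assumes M: "prob_space M" and h: "bounded_measurable M h"
    and up: "\<And>x. x \<in> space M \<Longrightarrow> h x - (\<integral>x. h x \<partial>M) \<le> w" and w: "0 \<le> w" "w < 3"
  shows "ent M (\<lambda>x. exp (h x)) \<le> var M h / 2 / (1 - w / 3)\<^sup>2 * (\<integral>x. exp (h x) \<partial>M)"
proof -
  interpret prob_space M by fact
  define m where "m = (\<integral>x. h x \<partial>M)"
  define Z where "Z = (\<integral>x. exp (h x) \<partial>M)"
  have Z: "Z > 0" unfolding Z_def by (rule mgf_pos[OF M h])
  have [simp]: "integrable M h" "integrable M (\<lambda>x. exp (h x))" "integrable M (\<lambda>x. exp (h x) * h x)"
    using h by (auto intro!: bm_integrable M bm_intros)
  have "0 \<le> Z * ln Z - Z * ln (exp m) - Z + exp m"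
    using Z by (intro entropy_integrand_nonneg) auto
  then have "ent M (\<lambda>x. exp (h x)) \<le> (\<integral>x. exp (h x) * h x \<partial>M) - m * Z - Z + exp m"
    unfolding ent_exp Z_def[symmetric] by (simp add: algebra_simps)
  also have "\<dots> = (\<integral>x. exp m * ((h x - m) * exp (h x - m) - exp (h x - m) + 1) \<partial>M)"
  proof -
    have "exp m * ((h x - m) * exp (h x - m) - exp (h x - m) + 1)
       = exp (h x) * h x - m * exp (h x) - exp (h x) + exp m" for x
      by (simp add: exp_diff field_simps)
    then show ?thesis by (simp add: Z_def prob_space)
  qed
  also have "\<dots> \<le> (\<integral>x. exp m * ((h x - m)\<^sup>2 / 2 / (1 - w / 3)\<^sup>2) \<partial>M)"
    using up w by (intro bm_integral_mono M bm_intros h mult_left_mono bennett_integrand_le)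
      (auto simp: m_def)
  also have "\<dots> = exp m * (var M h / 2 / (1 - w / 3)\<^sup>2)"
    using M h by (simp add: var_eq_centered m_def)
  also have "\<dots> \<le> Z * (var M h / 2 / (1 - w / 3)\<^sup>2)"
  proof (rule mult_right_mono)
    have "exp m = (\<integral>x. exp m * (1 + (h x - m)) \<partial>M)"
      by (simp add: prob_space m_def)
    also have "\<dots> \<le> Z"
      unfolding Z_def
    proof (intro bm_integral_mono M bm_intros h)
      fix x show "exp m * (1 + (h x - m)) \<le> exp (h x)"
        using mult_left_mono[OF exp_ge_add_one_self[of "h x - m"], of "exp m"]
        by (simp add: exp_diff)
    qed
    finally show "exp m \<le> Z" .
  qed (use var_nonneg[OF M h] in simp)
  finally show ?thesis by (simp add: Z_def mult.commute)
qed

text \<open>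
  Relative to the tilted measure with density \<open>e\<^sup>h / E e\<^sup>h\<close> this is one half of the variational
  formula for the Kullback-Leibler divergence.
\<close>

lemma donsker_varadhan:
  assumes M: "prob_space M" and h: "bounded_measurable M h" and g: "bounded_measurable M g"
  shows "(\<integral>x. g x * exp (h x) \<partial>M)
     \<le> ent M (\<lambda>x. exp (h x)) + (\<integral>x. exp (h x) \<partial>M) * ln (\<integral>x. exp (g x) \<partial>M)"
proof -
  interpret prob_space M by fact
  define Z where "Z = (\<integral>x. exp (h x) \<partial>M)"
  define T where "T = (\<integral>x. exp (g x) \<partial>M)"
  have pos: "Z > 0" "T > 0" unfolding Z_def T_def using mgf_pos M h g by blast+
  have [simp]: "integrable M (\<lambda>x. exp (h x))" "integrable M (\<lambda>x. exp (g x))"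
     "integrable M (\<lambda>x. exp (h x) * h x)" "integrable M (\<lambda>x. g x * exp (h x))"
    using h g by (auto intro!: bm_integrable M bm_intros)
  let ?c = "ln (Z / T)"
  have "0 \<le> (\<integral>x. exp (h x) * h x - (g x * exp (h x) + ?c * exp (h x)) - exp (h x) + Z / T * exp (g x) \<partial>M)"
  proof (rule integral_nonneg_AE, rule AE_I2)
    fix x
    have "0 \<le> exp (h x) * ln (exp (h x)) - exp (h x) * ln (Z / T * exp (g x)) - exp (h x) + Z / T * exp (g x)"
      using pos by (intro entropy_integrand_nonneg) auto
    also have "ln (Z / T * exp (g x)) = ?c + g x"
      using pos by (subst ln_mult) auto
    finally show "0 \<le> exp (h x) * h x - (g x * exp (h x) + ?c * exp (h x)) - exp (h x) + Z / T * exp (g x)"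
      by (simp add: algebra_simps)
  qed
  also have "\<dots> = (\<integral>x. exp (h x) * h x \<partial>M) - (\<integral>x. g x * exp (h x) \<partial>M) - ?c * Z"
    using pos by (simp add: Z_def[symmetric] T_def[symmetric])
  finally show ?thesis
    using pos by (simp add: ent_exp ln_div Z_def[symmetric] T_def[symmetric] algebra_simps)
qed

lemma exp_taylor1_bound:
  fixes a :: real
  shows "\<bar>exp a - 1 - a\<bar> \<le> a\<^sup>2 * exp \<bar>a\<bar>"
proof -
  have 1: "exp a - 1 \<le> a * exp a"
    using mult_left_mono[OF exp_ge_add_one_self[of "- a"], of "exp a"]
    by (simp add: exp_minus algebra_simps)
  have 2: "\<bar>exp a - 1\<bar> \<le> \<bar>a\<bar> * exp \<bar>a\<bar>"
  proof (cases "a \<ge> 0")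
    case True then show ?thesis using 1 by simp
  next
    case False
    then have "exp a \<le> 1" by simp
    then have "\<bar>exp a - 1\<bar> \<le> \<bar>a\<bar> * 1" using exp_ge_add_one_self[of a] by linarith
    also have "\<dots> \<le> \<bar>a\<bar> * exp \<bar>a\<bar>" by (intro mult_left_mono) auto
    finally show ?thesis .
  qed
  have "\<bar>exp a - 1 - a\<bar> = exp a - 1 - a" using exp_ge_add_one_self[of a] by linarith
  also have "\<dots> \<le> a * (exp a - 1)" using 1 by (simp add: algebra_simps)
  also have "\<dots> \<le> \<bar>a\<bar> * \<bar>exp a - 1\<bar>" by (metis abs_ge_self abs_mult)
  also have "\<dots> \<le> \<bar>a\<bar> * (\<bar>a\<bar> * exp \<bar>a\<bar>)" by (intro mult_left_mono 2) auto
  finally show ?thesis by (simp add: power2_eq_square mult.assoc[symmetric])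
qed

text \<open>
  For bounded \<open>f\<close> the remainder \<open>e\<^bsup>hf\<^esup> - 1 - hf\<close> is of order \<open>h\<^sup>2\<close> uniformly, which
  gives differentiation under the integral directly.
\<close>

lemma has_derivative_tilted_integral:
  assumes M: "prob_space M" and f: "bounded_measurable M f" and u: "bounded_measurable M u"
  shows "((\<lambda>s. \<integral>x. u x * exp (s * f x) \<partial>M) has_real_derivative
           (\<integral>x. u x * f x * exp (s * f x) \<partial>M)) (at s)"
proof -
  interpret prob_space M by fact
  obtain B where B: "B > 0" "\<And>x. x \<in> space M \<Longrightarrow> \<bar>f x\<bar> \<le> B" using f by (rule bmE) auto
  obtain A where A: "A > 0" "\<And>x. x \<in> space M \<Longrightarrow> \<bar>u x\<bar> \<le> A" using u by (rule bmE) auto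
  define C where "C = A * exp (\<bar>s\<bar> * B) * (B\<^sup>2 * exp B)"
  have C: "C \<ge> 0" using A B by (simp add: C_def)
  define F where "F s = (\<integral>x. u x * exp (s * f x) \<partial>M)" for s
  define D where "D = (\<integral>x. u x * f x * exp (s * f x) \<partial>M)"
  have b: "bounded_measurable M (\<lambda>x. u x * exp (s * f x))"
    "bounded_measurable M (\<lambda>x. u x * f x * exp (s * f x))" for s
    by (intro bm_intros f u)+
  have [simp]: "integrable M (\<lambda>x. u x * exp (s * f x))"
    "integrable M (\<lambda>x. u x * f x * exp (s * f x))" for s
    using b by (auto intro!: bm_integrable M)
  have est: "\<bar>F (s + h) - F s - h * D\<bar> \<le> h\<^sup>2 * C" if h: "\<bar>h\<bar> \<le> 1" for h
  proof -
    have "\<bar>F (s + h) - F s - h * D\<bar>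
       = \<bar>\<integral>x. u x * exp ((s + h) * f x) - u x * exp (s * f x) - h * (u x * f x * exp (s * f x)) \<partial>M\<bar>"
      unfolding F_def D_def by simp
    also have "\<dots> \<le> (\<integral>x. \<bar>u x * exp ((s + h) * f x) - u x * exp (s * f x) - h * (u x * f x * exp (s * f x))\<bar> \<partial>M)"
      by (rule integral_abs_bound)
    also have "\<dots> \<le> (\<integral>x. h\<^sup>2 * C \<partial>M)"
    proof (rule integral_mono)
      fix x assume x: "x \<in> space M"
      have "u x * exp ((s + h) * f x) - u x * exp (s * f x) - h * (u x * f x * exp (s * f x))
         = u x * exp (s * f x) * (exp (h * f x) - 1 - h * f x)"
        by (simp add: ring_distribs exp_add)
      then have "\<bar>u x * exp ((s + h) * f x) - u x * exp (s * f x) - h * (u x * f x * exp (s * f x))\<bar>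
         = \<bar>u x\<bar> * exp (s * f x) * \<bar>exp (h * f x) - 1 - h * f x\<bar>"
        by (simp only: abs_mult abs_exp_cancel)
      also have "\<dots> \<le> A * exp (\<bar>s\<bar> * B) * (h\<^sup>2 * (B\<^sup>2 * exp B))"
      proof (intro mult_mono)
        show "exp (s * f x) \<le> exp (\<bar>s\<bar> * B)"
          using mult_mono[of "\<bar>s\<bar>" "\<bar>s\<bar>" "\<bar>f x\<bar>" B] B(1) B(2)[OF x] abs_ge_self[of "s * f x"]
          by (simp add: abs_mult)
        have "\<bar>h * f x\<bar> \<le> 1 * B"
          unfolding abs_mult using h B(2)[OF x] by (intro mult_mono) auto
        moreover have "(h * f x)\<^sup>2 \<le> h\<^sup>2 * B\<^sup>2"
          unfolding power_mult_distrib using B(2)[OF x] B(1)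
          by (intro mult_left_mono) (auto simp: abs_le_square_iff[symmetric])
        ultimately have "(h * f x)\<^sup>2 * exp \<bar>h * f x\<bar> \<le> (h\<^sup>2 * B\<^sup>2) * exp B"
          by (intro mult_mono) auto
        with exp_taylor1_bound[of "h * f x"]
        show "\<bar>exp (h * f x) - 1 - h * f x\<bar> \<le> h\<^sup>2 * (B\<^sup>2 * exp B)" by (simp add: mult.assoc)
      qed (use A(1) A(2)[OF x] in auto)
      finally show "\<bar>u x * exp ((s + h) * f x) - u x * exp (s * f x) - h * (u x * f x * exp (s * f x))\<bar> \<le> h\<^sup>2 * C"
        by (simp add: C_def mult_ac)
    qed auto
    finally show ?thesis by (simp add: prob_space)
  qed
  have "((\<lambda>h. (F (s + h) - F s) / h - D) \<longlongrightarrow> 0) (at 0)"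
  proof (rule Lim_null_comparison)
    have "eventually (\<lambda>h::real. \<bar>h\<bar> \<le> 1 \<and> h \<noteq> 0) (at 0)"
      by (auto simp: eventually_at intro!: exI[of _ 1])
    then show "eventually (\<lambda>h. norm ((F (s + h) - F s) / h - D) \<le> \<bar>h\<bar> * C) (at 0)"
    proof eventually_elim
      case (elim h)
      then have "(F (s + h) - F s) / h - D = (F (s + h) - F s - h * D) / h"
        by (simp add: field_simps)
      then have "\<bar>(F (s + h) - F s) / h - D\<bar> = \<bar>F (s + h) - F s - h * D\<bar> / \<bar>h\<bar>"
        by (simp only: abs_divide)
      also have "\<dots> \<le> h\<^sup>2 * C / \<bar>h\<bar>"
        using elim est[of h] by (simp add: divide_right_mono)
      also have "\<dots> = \<bar>h\<bar> * C"
        using elim by (simp add: power2_eq_square field_simps)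
      finally show ?case by simp
    qed
    show "((\<lambda>h. \<bar>h\<bar> * C) \<longlongrightarrow> 0) (at 0)"
      by (auto intro!: tendsto_eq_intros)
  qed
  then have "((\<lambda>h. (F (s + h) - F s) / h) \<longlongrightarrow> D) (at 0)"
    by (rule LIM_zero_cancel)
  then show ?thesis unfolding DERIV_def F_def D_def .
qed

text \<open>
  The derivative of \<open>ln (Z s) / s\<close>, with \<open>Z\<close> the moment generating function, is \<open>Ent(e\<^bsup>sf\<^esup>) / (s\<^sup>2 Z s)\<close>,
  so the hypothesis makes \<open>ln (Z s) / s - w s\<close> nonincreasing.  Its limit at \<open>0\<close> is the mean of \<open>f\<close>.
\<close>

lemma herbst:
  fixes w w' :: "real \<Rightarrow> real"
  assumes M: "prob_space M" and f: "bounded_measurable M f" and \<beta>: "0 < \<beta>"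
    and w: "\<And>s. 0 < s \<Longrightarrow> s \<le> \<beta> \<Longrightarrow> (w has_real_derivative w' s) (at s)"
    and w0: "(w \<longlongrightarrow> 0) (at_right 0)"
    and ent: "\<And>s. 0 < s \<Longrightarrow> s \<le> \<beta> \<Longrightarrow>
      ent M (\<lambda>x. exp (s * f x)) \<le> s\<^sup>2 * (\<integral>x. exp (s * f x) \<partial>M) * w' s"
  shows "ln (\<integral>x. exp (\<beta> * f x) \<partial>M) \<le> \<beta> * ((\<integral>x. f x \<partial>M) + w \<beta>)"
proof -
  interpret prob_space M by fact
  define Z where "Z s = (\<integral>x. exp (s * f x) \<partial>M)" for s
  define Z1 where "Z1 s = (\<integral>x. f x * exp (s * f x) \<partial>M)" for s
  have Zpos: "Z s > 0" for s
    unfolding Z_def by (intro mgf_pos M bm_intros f)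
  have dZ: "(Z has_real_derivative Z1 s) (at s)" for s
    using has_derivative_tilted_integral[OF M f bm_const[of M 1]] unfolding Z_def Z1_def by simp
  have dlnZ: "((\<lambda>s. ln (Z s)) has_real_derivative Z1 s / Z s) (at s)" for s
    using dZ Zpos by (auto intro!: derivative_eq_intros)
  have Z0: "Z 0 = 1" by (simp add: Z_def prob_space)
  define q where "q s = ln (Z s) / s - w s" for s
  have mono: "q \<beta> \<le> q s" if s: "0 < s" "s \<le> \<beta>" for s
  proof (rule DERIV_nonpos_imp_nonincreasing[OF s(2)])
    fix r assume r: "s \<le> r" "r \<le> \<beta>"
    then have r0: "0 < r" using s by simp
    have "((\<lambda>s. ln (Z s) / s) has_real_derivative (Z1 r / Z r * r - ln (Z r) * 1) / (r * r)) (at r)"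
      using r0 by (intro DERIV_divide dlnZ DERIV_ident) auto
    then have "(q has_real_derivative (Z1 r / Z r * r - ln (Z r) * 1) / (r * r) - w' r) (at r)"
      unfolding q_def by (rule DERIV_diff) (rule w[OF r0 r(2)])
    moreover have "(Z1 r / Z r * r - ln (Z r) * 1) / (r * r) \<le> w' r"
    proof -
      have "ent M (\<lambda>x. exp (r * f x)) = r * Z1 r - Z r * ln (Z r)"
        unfolding ent_exp Z_def Z1_def by (simp add: mult_ac)
      then have "r * Z1 r - Z r * ln (Z r) \<le> r\<^sup>2 * Z r * w' r"
        using ent[OF r0 r(2)] by (simp add: Z_def)
      then have "(r * Z1 r - Z r * ln (Z r)) / (r\<^sup>2 * Z r) \<le> w' r"
        using r0 Zpos[of r] by (simp add: pos_divide_le_eq mult_ac)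
      also have "(r * Z1 r - Z r * ln (Z r)) / (r\<^sup>2 * Z r) = (Z1 r / Z r * r - ln (Z r) * 1) / (r * r)"
        using r0 Zpos[of r] by (simp add: field_simps power2_eq_square)
      finally show ?thesis .
    qed
    ultimately show "\<exists>y. (q has_real_derivative y) (at r) \<and> y \<le> 0"
      by (intro exI[of _ "(Z1 r / Z r * r - ln (Z r) * 1) / (r * r) - w' r"]) auto
  qed
  have "((\<lambda>s. (ln (Z (0 + s)) - ln (Z 0)) / s) \<longlongrightarrow> Z1 0 / Z 0) (at 0)"
    using dlnZ[of 0] unfolding DERIV_def .
  then have "((\<lambda>s. ln (Z s) / s) \<longlongrightarrow> (\<integral>x. f x \<partial>M)) (at 0)"
    by (simp add: Z0 Z1_def)
  then have "((\<lambda>s. ln (Z s) / s) \<longlongrightarrow> (\<integral>x. f x \<partial>M)) (at_right 0)"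
    by (rule filterlim_mono[OF _ order_refl at_le]) simp
  then have lim: "(q \<longlongrightarrow> (\<integral>x. f x \<partial>M) - 0) (at_right 0)"
    unfolding q_def by (intro tendsto_diff w0)
  have "q \<beta> \<le> (\<integral>x. f x \<partial>M) - 0"
  proof (rule tendsto_lowerbound[OF lim])
    show "eventually (\<lambda>s. q \<beta> \<le> q s) (at_right 0)"
      using \<beta> by (auto simp: eventually_at_right_field intro!: exI[of _ \<beta>] mono)
  qed simp
  then have "ln (Z \<beta>) / \<beta> \<le> (\<integral>x. f x \<partial>M) + w \<beta>" by (simp add: q_def)
  then show ?thesis
    unfolding Z_def[symmetric] using \<beta> by (simp add: pos_divide_le_eq mult.commute)
qed

text \<open>
  Let \<open>\<rho> s\<close> and \<open>v s\<close> be the mean and variance of \<open>G\<close> under the tilted measure.  The normalised entropy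
  \<open>s * \<rho> s - ln (Z s)\<close> has derivative \<open>s * v s\<close>.  The hypothesis, integrated against two independent
  tilted copies of \<open>G\<close>, says \<open>v s \<le> 2 * d * \<rho> s\<close>, and \<open>\<rho>\<close> is nondecreasing; so the derivative is at
  most that of \<open>d * s\<^sup>2 * \<rho> s\<close>.
\<close>

lemma ent_exp_self_bounded:
  assumes M: "prob_space M" and G: "bounded_measurable M G" and s: "0 \<le> s" and d: "0 \<le> d"
    and self: "\<And>x y. x \<in> space M \<Longrightarrow> y \<in> space M \<Longrightarrow> (G x - G y)\<^sup>2 \<le> 2 * d * (G x + G y)"
  shows "ent M (\<lambda>x. exp (s * G x)) \<le> s\<^sup>2 * d * (\<integral>x. G x * exp (s * G x) \<partial>M)"
proof -
  interpret prob_space M by fact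
  define Z where "Z s = (\<integral>x. exp (s * G x) \<partial>M)" for s
  define Z1 where "Z1 s = (\<integral>x. G x * exp (s * G x) \<partial>M)" for s
  define Z2 where "Z2 s = (\<integral>x. G x * G x * exp (s * G x) \<partial>M)" for s
  have bm: "bounded_measurable M (\<lambda>x. exp (s * G x))" "bounded_measurable M (\<lambda>x. G x * exp (s * G x))"
     "bounded_measurable M (\<lambda>x. G x * G x * exp (s * G x))" for s
    by (intro bm_intros G)+
  have [simp]: "integrable M (\<lambda>x. exp (s * G x))" "integrable M (\<lambda>x. G x * exp (s * G x))"
     "integrable M (\<lambda>x. G x * G x * exp (s * G x))" for s
    using bm by (auto intro!: bm_integrable M)
  have Zpos: "Z s > 0" for s
    unfolding Z_def by (intro mgf_pos M bm_intros G)
  have dZ: "(Z has_real_derivative Z1 s) (at s)" for s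
    using has_derivative_tilted_integral[OF M G bm_const[of M 1]] unfolding Z_def Z1_def by simp
  have dZ1: "(Z1 has_real_derivative Z2 s) (at s)" for s
    using has_derivative_tilted_integral[OF M G G] unfolding Z1_def Z2_def .
  have tilted: "(\<integral>x. \<integral>y. (G x - G y)\<^sup>2 * exp (r * G y) * exp (r * G x) \<partial>M \<partial>M)
       = 2 * (Z2 r * Z r - (Z1 r)\<^sup>2)"
    "(\<integral>x. \<integral>y. (2 * d * (G x + G y)) * exp (r * G y) * exp (r * G x) \<partial>M \<partial>M)
       = 2 * (2 * d * Z1 r * Z r)" for r
  proof -
    have "(\<integral>y. (G x - G y)\<^sup>2 * exp (r * G y) * exp (r * G x) \<partial>M)
      = Z r * (G x * G x * exp (r * G x)) - 2 * Z1 r * (G x * exp (r * G x)) + Z2 r * exp (r * G x)" for x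
    proof -
      have "(G x - G y)\<^sup>2 * exp (r * G y) * exp (r * G x) =
         exp (r * G y) * (G x * G x * exp (r * G x)) - G y * exp (r * G y) * (2 * (G x * exp (r * G x)))
         + G y * G y * exp (r * G y) * exp (r * G x)" for y
        by (simp add: power2_eq_square algebra_simps)
      then show ?thesis by (simp add: Z_def Z1_def Z2_def)
    qed
    then show "(\<integral>x. \<integral>y. (G x - G y)\<^sup>2 * exp (r * G y) * exp (r * G x) \<partial>M \<partial>M)
       = 2 * (Z2 r * Z r - (Z1 r)\<^sup>2)"
      by (simp add: Z_def[symmetric] Z1_def[symmetric] Z2_def[symmetric] power2_eq_square)
    have "(\<integral>y. (2 * d * (G x + G y)) * exp (r * G y) * exp (r * G x) \<partial>M)
      = 2 * d * (Z r * (G x * exp (r * G x)) + Z1 r * exp (r * G x))" for x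
    proof -
      have "(2 * d * (G x + G y)) * exp (r * G y) * exp (r * G x) =
         exp (r * G y) * (2 * d * (G x * exp (r * G x))) + G y * exp (r * G y) * (2 * d * exp (r * G x))" for y
        by (simp add: algebra_simps)
      then have "(\<integral>y. (2 * d * (G x + G y)) * exp (r * G y) * exp (r * G x) \<partial>M)
         = Z r * (2 * d * (G x * exp (r * G x))) + Z1 r * (2 * d * exp (r * G x))"
        by (simp only:) (simp add: Z_def Z1_def)
      then show ?thesis by (simp add: algebra_simps)
    qed
    then show "(\<integral>x. \<integral>y. (2 * d * (G x + G y)) * exp (r * G y) * exp (r * G x) \<partial>M \<partial>M)
       = 2 * (2 * d * Z1 r * Z r)"
      by (simp add: Z_def[symmetric] Z1_def[symmetric])
  qed
  have pairG: "bounded_measurable (M \<Otimes>\<^sub>M M) (\<lambda>p. G (fst p))" "bounded_measurable (M \<Otimes>\<^sub>M M) (\<lambda>p. G (snd p))"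
    by (auto intro: bm_compose[OF G])
  have V0: "0 \<le> Z2 r * Z r - (Z1 r)\<^sup>2" for r
  proof -
    have "0 \<le> (\<integral>x. \<integral>y. (G x - G y)\<^sup>2 * exp (r * G y) * exp (r * G x) \<partial>M \<partial>M)"
      by (intro Bochner_Integration.integral_nonneg) simp
    then show ?thesis unfolding tilted by simp
  qed
  have V: "Z2 r * Z r - (Z1 r)\<^sup>2 \<le> 2 * d * Z1 r * Z r" for r
  proof -
    have "(\<integral>x. \<integral>y. (G x - G y)\<^sup>2 * exp (r * G y) * exp (r * G x) \<partial>M \<partial>M)
       \<le> (\<integral>x. \<integral>y. (2 * d * (G x + G y)) * exp (r * G y) * exp (r * G x) \<partial>M \<partial>M)"
      by (intro bm_integral_mono bm_integral M bm_intros pairG G mult_right_mono self) auto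
    then show ?thesis unfolding tilted by simp
  qed
  define \<rho> where "\<rho> r = Z1 r / Z r" for r
  define v where "v r = (Z2 r * Z r - (Z1 r)\<^sup>2) / (Z r)\<^sup>2" for r
  have v: "0 \<le> v r" "v r \<le> 2 * d * \<rho> r" for r
  proof -
    show "0 \<le> v r" using V0 by (simp add: v_def)
    show "v r \<le> 2 * d * \<rho> r"
      using divide_right_mono[OF V[of r], of "(Z r)\<^sup>2"] Zpos[of r]
      by (simp add: v_def \<rho>_def power2_eq_square)
  qed
  have d\<rho>: "(\<rho> has_real_derivative v r) (at r)" for r
    using DERIV_divide[OF dZ1 dZ, of r] Zpos[of r] unfolding \<rho>_def v_def by (simp add: power2_eq_square)
  define S where "S r = r * \<rho> r - ln (Z r) - d * r\<^sup>2 * \<rho> r" for r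
  have "S s \<le> S 0"
  proof (rule DERIV_nonpos_imp_nonincreasing[OF s])
    fix r assume r: "0 \<le> r" "r \<le> s"
    have dln: "((\<lambda>s. ln (Z s)) has_real_derivative \<rho> r) (at r)"
      using dZ Zpos[of r] by (auto intro!: derivative_eq_intros simp: \<rho>_def)
    have sq: "((\<lambda>s. d * s\<^sup>2) has_real_derivative d * (2 * r)) (at r)"
      by (auto intro!: derivative_eq_intros)
    have "(S has_real_derivative
        1 * \<rho> r + v r * r - \<rho> r - (d * (2 * r) * \<rho> r + v r * (d * r\<^sup>2))) (at r)"
      unfolding S_def by (intro DERIV_diff DERIV_mult DERIV_ident dln d\<rho> sq)
    then have "(S has_real_derivative r * v r - d * (2 * r) * \<rho> r - d * r\<^sup>2 * v r) (at r)"
      by (simp add: algebra_simps)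
    moreover have "r * v r \<le> r * (2 * d * \<rho> r)" using r v by (intro mult_left_mono) auto
    moreover have "0 \<le> d * r\<^sup>2 * v r" using d v(1) by simp
    ultimately show "\<exists>y. (S has_real_derivative y) (at r) \<and> y \<le> 0"
      by (intro exI[of _ "r * v r - d * (2 * r) * \<rho> r - d * r\<^sup>2 * v r"]) (auto simp: algebra_simps)
  qed
  also have "S 0 = 0" by (simp add: S_def Z_def prob_space)
  finally have "Z s * (s * \<rho> s - ln (Z s)) \<le> Z s * (d * s\<^sup>2 * \<rho> s)"
    using Zpos[of s] by (intro mult_left_mono) (auto simp: S_def)
  then have "s * Z1 s - Z s * ln (Z s) \<le> s\<^sup>2 * d * Z1 s"
    using Zpos[of s] by (simp add: \<rho>_def algebra_simps)
  moreover have "ent M (\<lambda>x. exp (s * G x)) = s * Z1 s - Z s * ln (Z s)"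
    unfolding ent_exp Z_def Z1_def by (simp add: mult_ac)
  ultimately show ?thesis by (simp add: Z1_def)
qed

section \<open>A Bernstein inequality for functions of bounded interaction\<close>

text \<open>
  The one-coordinate bound and subadditivity bound the normalised entropy by \<open>s\<^sup>2 * Q\<close> times the
  derivative of \<open>ln (Z s)\<close>.  Herbst's argument with \<open>w = Q ln Z\<close> then gives an inequality that is
  linear in \<open>ln (Z \<theta>)\<close> itself.
\<close>

lemma mgf_self_bounded:
  assumes \<mu>: "prob_space \<mu>" and I: "finite I" and g: "bounded_measurable (iid_measure I \<mu>) g"
    and g0: "\<And>x. x \<in> space (iid_measure I \<mu>) \<Longrightarrow> 0 \<le> g x"
    and q: "\<And>k. k \<in> I \<Longrightarrow> 0 \<le> q k" "(\<Sum>k\<in>I. q k) \<le> Q"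
    and self: "\<And>k x y y'. k \<in> I \<Longrightarrow> x \<in> space (iid_measure I \<mu>) \<Longrightarrow> y \<in> space \<mu> \<Longrightarrow> y' \<in> space \<mu> \<Longrightarrow>
      (g (x(k := y)) - g (x(k := y')))\<^sup>2 \<le> 2 * q k * (g (x(k := y)) + g (x(k := y')))"
    and \<theta>: "0 < \<theta>" "Q * \<theta> < 1"
  shows "ln (\<integral>x. exp (\<theta> * g x) \<partial>iid_measure I \<mu>) \<le> \<theta> * (\<integral>x. g x \<partial>iid_measure I \<mu>) / (1 - Q * \<theta>)"
proof -
  let ?P = "iid_measure I \<mu>"
  have P: "prob_space ?P" by (rule prob_space_iid[OF \<mu>])
  define Z where "Z s = (\<integral>x. exp (s * g x) \<partial>?P)" for s
  define Z1 where "Z1 s = (\<integral>x. g x * exp (s * g x) \<partial>?P)" for s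
  have Zpos: "Z s > 0" for s
    unfolding Z_def by (intro mgf_pos P bm_intros g)
  have dZ: "(Z has_real_derivative Z1 s) (at s)" for s
    using has_derivative_tilted_integral[OF P g bm_const[of ?P 1]] unfolding Z_def Z1_def by simp
  have dlnZ: "((\<lambda>s. ln (Z s)) has_real_derivative Z1 s / Z s) (at s)" for s
    using dZ Zpos by (auto intro!: derivative_eq_intros)
  have Z10: "0 \<le> Z1 s" for s
    unfolding Z1_def using g0 by (intro integral_nonneg_AE AE_I2) simp
  have ent: "ent ?P (\<lambda>x. exp (s * g x)) \<le> s\<^sup>2 * Z s * (Q * (Z1 s / Z s))" if s: "0 < s" for s
  proof -
    have sg: "bounded_measurable ?P (\<lambda>x. s * g x)" "bounded_measurable ?P (\<lambda>x. g x * exp (s * g x))"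
      by (intro bm_intros g)+
    have "ent ?P (\<lambda>x. exp (s * g x)) \<le> (\<Sum>k\<in>I. \<integral>x. ent \<mu> (\<lambda>y. exp (s * g (x(k := y)))) \<partial>?P)"
      by (rule entropy_subadditive[OF \<mu> I sg(1)])
    also have "\<dots> \<le> (\<Sum>k\<in>I. s\<^sup>2 * q k * Z1 s)"
    proof (rule sum_mono)
      fix k assume k: "k \<in> I"
      have "(\<integral>x. ent \<mu> (\<lambda>y. exp (s * g (x(k := y)))) \<partial>?P)
        \<le> (\<integral>x. s\<^sup>2 * q k * (\<integral>y. g (x(k := y)) * exp (s * g (x(k := y))) \<partial>\<mu>) \<partial>?P)"
      proof (intro bm_integral_mono P bm_ent_section[OF \<mu> k sg(1)] bm_intros bm_section_mean[OF \<mu> sg(2) k])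
        fix x assume x: "x \<in> space ?P"
        show "ent \<mu> (\<lambda>y. exp (s * g (x(k := y))))
           \<le> s\<^sup>2 * q k * (\<integral>y. g (x(k := y)) * exp (s * g (x(k := y))) \<partial>\<mu>)"
          using s k x by (intro ent_exp_self_bounded \<mu> bm_section[OF g] q self) auto
      qed
      also have "\<dots> = s\<^sup>2 * q k * Z1 s"
        unfolding Z1_def by (subst integral_resample[OF \<mu> I k sg(2)]) simp
      finally show "(\<integral>x. ent \<mu> (\<lambda>y. exp (s * g (x(k := y)))) \<partial>?P) \<le> s\<^sup>2 * q k * Z1 s" .
    qed
    also have "\<dots> = s\<^sup>2 * Z1 s * (\<Sum>k\<in>I. q k)"
      by (simp add: sum_distrib_left[symmetric] sum_distrib_right[symmetric])
    also have "\<dots> \<le> s\<^sup>2 * Z1 s * Q" using Z10 q(2) by (intro mult_left_mono) auto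
    also have "\<dots> = s\<^sup>2 * Z s * (Q * (Z1 s / Z s))" using Zpos[of s] by simp
    finally show ?thesis .
  qed
  have "ln (Z \<theta>) \<le> \<theta> * ((\<integral>x. g x \<partial>?P) + Q * ln (Z \<theta>))"
    unfolding Z_def
  proof (rule herbst[OF P g \<theta>(1)], fold Z_def)
    show "((\<lambda>s. Q * ln (Z s)) has_real_derivative Q * (Z1 s / Z s)) (at s)" for s
      by (intro DERIV_cmult dlnZ)
    have "isCont (\<lambda>s. Q * ln (Z s)) 0"
      using dlnZ[of 0] by (intro continuous_intros DERIV_isCont)
    moreover have "ln (Z 0) = 0" using prob_space.prob_space[OF P] by (simp add: Z_def)
    ultimately have "((\<lambda>s. Q * ln (Z s)) \<longlongrightarrow> 0) (at 0)" by (simp add: isCont_def)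
    then show "((\<lambda>s. Q * ln (Z s)) \<longlongrightarrow> 0) (at_right 0)"
      by (rule filterlim_mono[OF _ order_refl at_le]) simp
  qed (rule ent)
  then show ?thesis
    using \<theta> unfolding Z_def[symmetric] by (simp add: pos_le_divide_eq algebra_simps)
qed

text \<open>
  The infimum over \<open>c > 0\<close> of \<open>c * p + s / c\<close> is \<open>2\<surd>(p s)\<close>.  This turns bounds by weighted means, which can
  be summed, into a bound of Cauchy-Schwarz type.
\<close>

lemma square_le_of_weighted_bounds:
  fixes d p s :: real
  assumes "\<And>c. 0 < c \<Longrightarrow> \<bar>d\<bar> \<le> c * p + s / c" "0 \<le> p" "0 \<le> s"
  shows "d\<^sup>2 \<le> 4 * p * s"
proof (cases "d = 0")
  case False
  show ?thesis
  proof (cases "p = 0")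
    case True
    have "\<bar>d\<bar> \<le> s / ((s + 1) / \<bar>d\<bar>)"
      using assms(1)[of "(s + 1) / \<bar>d\<bar>"] True False assms(3) by simp
    then show ?thesis using False assms(3) by (simp add: field_simps)
  next
    case p: False
    have "\<bar>d\<bar> \<le> \<bar>d\<bar> / (2 * p) * p + s / (\<bar>d\<bar> / (2 * p))"
      using p False assms by (intro assms(1)) auto
    then have "\<bar>d\<bar> * \<bar>d\<bar> \<le> 4 * p * s" using p False by (simp add: field_simps)
    then show ?thesis by (simp add: power2_eq_square)
  qed
qed (use assms in simp)

text \<open>
  With centred \<open>u\<close> and \<open>v\<close> the difference of the variances is the mean of \<open>(u - v) * (u + v)\<close>, and the
  product is split by the arithmetic-geometric mean inequality with weight \<open>c\<close>.
\<close>

lemma var_difference_le: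
  assumes M: "prob_space M" and h: "bounded_measurable M h1" "bounded_measurable M h2" and c: "0 < c"
  shows "\<bar>var M h1 - var M h2\<bar> \<le> c / 2 * var M (\<lambda>x. h1 x - h2 x) + (var M h1 + var M h2) / c"
proof -
  interpret prob_space M by fact
  define u where "u x = h1 x - (\<integral>x. h1 x \<partial>M)" for x
  define v where "v x = h2 x - (\<integral>x. h2 x \<partial>M)" for x
  have uv: "bounded_measurable M u" "bounded_measurable M v"
    unfolding u_def v_def by (intro bm_intros h)+
  have var: "var M h1 = (\<integral>x. (u x)\<^sup>2 \<partial>M)" "var M h2 = (\<integral>x. (v x)\<^sup>2 \<partial>M)"
    "var M (\<lambda>x. h1 x - h2 x) = (\<integral>x. (u x - v x)\<^sup>2 \<partial>M)"
    using h M by (simp_all add: var_eq_centered bm_intros bm_integrable u_def v_def algebra_simps)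
  have [simp]: "integrable M (\<lambda>x. (u x)\<^sup>2)" "integrable M (\<lambda>x. (v x)\<^sup>2)" "integrable M (\<lambda>x. (u x - v x)\<^sup>2)"
    by (intro bm_integrable M bm_intros uv)+
  have pt: "\<bar>a\<^sup>2 - b\<^sup>2\<bar> \<le> c / 2 * (a - b)\<^sup>2 + (a\<^sup>2 + b\<^sup>2) / c" for a b :: real
  proof -
    have "0 \<le> (c * \<bar>a - b\<bar> - \<bar>a + b\<bar>)\<^sup>2 / (2 * c)" using c by simp
    also have "\<dots> = c / 2 * (a - b)\<^sup>2 + (a + b)\<^sup>2 / (2 * c) - \<bar>a - b\<bar> * \<bar>a + b\<bar>"
      using c by (simp add: power2_diff power_mult_distrib field_simps) (simp add: power2_eq_square)
    finally have "\<bar>a - b\<bar> * \<bar>a + b\<bar> \<le> c / 2 * (a - b)\<^sup>2 + (a + b)\<^sup>2 / (2 * c)" by simp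
    moreover have "\<bar>a\<^sup>2 - b\<^sup>2\<bar> = \<bar>a - b\<bar> * \<bar>a + b\<bar>"
      by (simp add: abs_mult[symmetric] power2_eq_square algebra_simps)
    moreover have "(a + b)\<^sup>2 / (2 * c) \<le> (2 * (a\<^sup>2 + b\<^sup>2)) / (2 * c)"
      using c sum_squares_bound[of a b] by (intro divide_right_mono) (auto simp: power2_sum)
    moreover have "(2 * (a\<^sup>2 + b\<^sup>2)) / (2 * c) = (a\<^sup>2 + b\<^sup>2) / c"
      by (rule mult_divide_mult_cancel_left) simp
    ultimately show ?thesis by linarith
  qed
  have "\<bar>var M h1 - var M h2\<bar> = \<bar>\<integral>x. (u x)\<^sup>2 - (v x)\<^sup>2 \<partial>M\<bar>" by (simp add: var)
  also have "\<dots> \<le> (\<integral>x. \<bar>(u x)\<^sup>2 - (v x)\<^sup>2\<bar> \<partial>M)" by (rule integral_abs_bound)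
  also have "\<dots> \<le> (\<integral>x. c / 2 * (u x - v x)\<^sup>2 + ((u x)\<^sup>2 + (v x)\<^sup>2) / c \<partial>M)"
    by (intro integral_mono pt) auto
  also have "\<dots> = c / 2 * var M (\<lambda>x. h1 x - h2 x) + (var M h1 + var M h2) / c"
    by (simp add: var)
  finally show ?thesis .
qed

definition sum_cond_var :: "'a measure \<Rightarrow> 'i set \<Rightarrow> (('i \<Rightarrow> 'a) \<Rightarrow> real) \<Rightarrow> ('i \<Rightarrow> 'a) \<Rightarrow> real" where
  "sum_cond_var \<mu> I f x = (\<Sum>k\<in>I. var \<mu> (\<lambda>y. f (x(k := y))))"

lemma bm_sum_cond_var:
  "prob_space \<mu> \<Longrightarrow> bounded_measurable (iid_measure I \<mu>) f
    \<Longrightarrow> bounded_measurable (iid_measure I \<mu>) (sum_cond_var \<mu> I f)"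
  unfolding sum_cond_var_def by (intro bm_intros bm_var_section)

lemma sum_cond_var_nonneg:
  "prob_space \<mu> \<Longrightarrow> bounded_measurable (iid_measure I \<mu>) f \<Longrightarrow> x \<in> space (iid_measure I \<mu>)
    \<Longrightarrow> 0 \<le> sum_cond_var \<mu> I f x"
  unfolding sum_cond_var_def by (intro sum_nonneg var_nonneg bm_section)

text \<open>
  The conditional variance in coordinate \<open>k\<close> does not depend on that coordinate, so it cancels on the
  left.  In the other coordinates the difference of the variances is bounded with a common weight
  \<open>c\<close>, which is optimised after summation.
\<close>

lemma sum_cond_var_self_bounded:
  assumes \<mu>: "prob_space \<mu>" and I: "finite I" and f: "bounded_measurable (iid_measure I \<mu>) f"
    and k: "k \<in> I" and x: "x \<in> space (iid_measure I \<mu>)" and y: "y \<in> space \<mu>" "y' \<in> space \<mu>"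
    and q: "(\<Sum>l\<in>I - {k}. var \<mu> (\<lambda>z. f (x(k := y, l := z)) - f (x(k := y', l := z)))) \<le> q"
  shows "(sum_cond_var \<mu> I f (x(k := y)) - sum_cond_var \<mu> I f (x(k := y')))\<^sup>2
       \<le> 2 * q * (sum_cond_var \<mu> I f (x(k := y)) + sum_cond_var \<mu> I f (x(k := y')))"
proof -
  define V where "V l y = var \<mu> (\<lambda>z. f (x(k := y, l := z)))" for l y
  define D where "D l = var \<mu> (\<lambda>z. f (x(k := y, l := z)) - f (x(k := y', l := z)))" for l
  have sp: "x(k := y) \<in> space (iid_measure I \<mu>)" "x(k := y') \<in> space (iid_measure I \<mu>)"
    using x y k by (auto intro: space_update)
  have g: "sum_cond_var \<mu> I f (x(k := y)) = (\<Sum>l\<in>I - {k}. V l y) + V k y" for y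
    using I k by (simp add: sum_cond_var_def V_def sum.remove[of I k] add.commute)
  have same: "V k y = V k y'" by (simp add: V_def)
  have nn: "0 \<le> V l y" "0 \<le> V l y'" if "l \<in> I" for l
    unfolding V_def using that by (auto intro!: var_nonneg \<mu> bm_section[OF f] sp)
  have Dnn: "0 \<le> D l" if "l \<in> I" for l
    unfolding D_def using that by (intro var_nonneg \<mu> bm_diff bm_section[OF f] sp)
  define d where "d = (\<Sum>l\<in>I - {k}. V l y - V l y')"
  define s where "s = (\<Sum>l\<in>I - {k}. V l y + V l y')"
  have q0: "0 \<le> q" using order_trans[OF sum_nonneg q] Dnn by (auto simp: D_def)
  have s0: "0 \<le> s" unfolding s_def by (intro sum_nonneg add_nonneg_nonneg nn) auto
  have "d\<^sup>2 \<le> 4 * (q / 2) * s"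
  proof (rule square_le_of_weighted_bounds)
    fix c :: real assume c: "0 < c"
    have "\<bar>d\<bar> \<le> (\<Sum>l\<in>I - {k}. \<bar>V l y - V l y'\<bar>)" unfolding d_def by (rule sum_abs)
    also have "\<dots> \<le> (\<Sum>l\<in>I - {k}. c / 2 * D l + (V l y + V l y') / c)"
      unfolding V_def D_def
      by (intro sum_mono var_difference_le \<mu> c bm_section[OF f] sp) auto
    also have "\<dots> = c / 2 * (\<Sum>l\<in>I - {k}. D l) + s / c"
      by (simp add: sum.distrib s_def sum_distrib_left sum_divide_distrib[symmetric] add_divide_distrib)
    also have "\<dots> \<le> c / 2 * q + s / c"
      using q c by (intro add_right_mono mult_left_mono) (auto simp: D_def)
    finally show "\<bar>d\<bar> \<le> c * (q / 2) + s / c" by simp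
  qed (use q0 s0 in auto)
  also have "\<dots> \<le> 2 * q * (s + (V k y + V k y'))"
    using q0 nn[OF k] by (simp add: distrib_left)
  finally show ?thesis
    unfolding g d_def s_def by (simp add: same sum_subtractf sum.distrib algebra_simps)
qed

text \<open>
  The conditional variance in coordinate \<open>k\<close> is constant in that coordinate, so it may be moved
  inside the mean over it; resampling then restores the unconditional integral.
\<close>

lemma entropy_le_cond_var:
  assumes \<mu>: "prob_space \<mu>" and I: "finite I" and f: "bounded_measurable (iid_measure I \<mu>) f"
    and b: "0 \<le> b" "\<And>k x y y'. k \<in> I \<Longrightarrow> x \<in> space (iid_measure I \<mu>) \<Longrightarrow> y \<in> space \<mu> \<Longrightarrow> y' \<in> space \<mu> \<Longrightarrow>
      f (x(k := y)) - f (x(k := y')) \<le> b"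
    and \<beta>: "0 \<le> \<beta>" "b * \<beta> < 3"
  shows "ent (iid_measure I \<mu>) (\<lambda>x. exp (\<beta> * f x)) \<le> \<beta>\<^sup>2 / 2 / (1 - b * \<beta> / 3)\<^sup>2 *
     (\<integral>x. sum_cond_var \<mu> I f x * exp (\<beta> * f x) \<partial>iid_measure I \<mu>)"
proof -
  let ?P = "iid_measure I \<mu>"
  have P: "prob_space ?P" by (rule prob_space_iid[OF \<mu>])
  define c where "c = \<beta>\<^sup>2 / 2 / (1 - b * \<beta> / 3)\<^sup>2"
  define v where "v k x = var \<mu> (\<lambda>y. f (x(k := y)))" for k x
  have bf: "bounded_measurable ?P (\<lambda>x. \<beta> * f x)" and be: "bounded_measurable ?P (\<lambda>x. exp (\<beta> * f x))"
    by (intro bm_intros f)+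
  have bv: "bounded_measurable ?P (v k)" if "k \<in> I" for k
    unfolding v_def by (rule bm_var_section[OF \<mu> that f])
  have "ent ?P (\<lambda>x. exp (\<beta> * f x)) \<le> (\<Sum>k\<in>I. \<integral>x. ent \<mu> (\<lambda>y. exp (\<beta> * f (x(k := y)))) \<partial>?P)"
    by (rule entropy_subadditive[OF \<mu> I bf])
  also have "\<dots> \<le> (\<Sum>k\<in>I. c * (\<integral>x. v k x * exp (\<beta> * f x) \<partial>?P))"
  proof (rule sum_mono)
    fix k assume k: "k \<in> I"
    have "(\<integral>x. ent \<mu> (\<lambda>y. exp (\<beta> * f (x(k := y)))) \<partial>?P)
       \<le> (\<integral>x. c * (v k x * (\<integral>y. exp (\<beta> * f (x(k := y))) \<partial>\<mu>)) \<partial>?P)"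
    proof (intro bm_integral_mono P bm_ent_section[OF \<mu> k bf] bm_intros bv k bm_section_mean[OF \<mu> be k])
      fix x assume x: "x \<in> space ?P"
      note h = bm_section[OF f k x]
      have "ent \<mu> (\<lambda>y. exp (\<beta> * f (x(k := y))))
        \<le> var \<mu> (\<lambda>y. \<beta> * f (x(k := y))) / 2 / (1 - b * \<beta> / 3)\<^sup>2 * (\<integral>y. exp (\<beta> * f (x(k := y))) \<partial>\<mu>)"
      proof (rule ent_exp_le_var[OF \<mu>])
        fix y assume y: "y \<in> space \<mu>"
        have "f (x(k := y)) - b \<le> (\<integral>y'. f (x(k := y')) \<partial>\<mu>)"
        proof -
          have "(\<integral>y'. f (x(k := y)) - b \<partial>\<mu>) \<le> (\<integral>y'. f (x(k := y')) \<partial>\<mu>)"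
            using b(2)[OF k x y] by (intro bm_integral_mono \<mu> bm_const h) (simp add: algebra_simps)
          then show ?thesis using prob_space.prob_space[OF \<mu>] by simp
        qed
        then have "\<beta> * (f (x(k := y)) - b) \<le> \<beta> * (\<integral>y'. f (x(k := y')) \<partial>\<mu>)"
          using \<beta> by (intro mult_left_mono) auto
        then show "\<beta> * f (x(k := y)) - (\<integral>y. \<beta> * f (x(k := y)) \<partial>\<mu>) \<le> b * \<beta>"
          by (simp add: algebra_simps)
      qed (use b \<beta> in \<open>auto intro!: bm_intros h\<close>)
      moreover have "var \<mu> (\<lambda>y. \<beta> * f (x(k := y))) = \<beta>\<^sup>2 * v k x"
        by (simp add: v_def phi_entropy_def power_mult_distrib right_diff_distrib)
      ultimately show "ent \<mu> (\<lambda>y. exp (\<beta> * f (x(k := y)))) \<le> c * (v k x * (\<integral>y. exp (\<beta> * f (x(k := y))) \<partial>\<mu>))"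
        by (simp add: c_def)
    qed
    also have "\<dots> = c * (\<integral>x. v k x * exp (\<beta> * f x) \<partial>?P)"
      by (subst integral_resample[OF \<mu> I k bm_mult[OF bv[OF k] be]]) (simp add: v_def)
    finally show "(\<integral>x. ent \<mu> (\<lambda>y. exp (\<beta> * f (x(k := y)))) \<partial>?P) \<le> c * (\<integral>x. v k x * exp (\<beta> * f x) \<partial>?P)" .
  qed
  also have "\<dots> = c * (\<integral>x. sum_cond_var \<mu> I f x * exp (\<beta> * f x) \<partial>?P)"
  proof -
    have "(\<integral>x. (\<Sum>k\<in>I. v k x * exp (\<beta> * f x)) \<partial>?P) = (\<Sum>k\<in>I. \<integral>x. v k x * exp (\<beta> * f x) \<partial>?P)"
      by (intro Bochner_Integration.integral_sum bm_integrable P bm_mult bv be)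
    then show ?thesis
      by (simp add: sum_cond_var_def v_def sum_distrib_right sum_distrib_left)
  qed
  finally show ?thesis unfolding c_def .
qed

text \<open>
  With \<open>E\<close> the entropy of \<open>e\<^bsup>sf\<^esup>\<close>, Donsker-Varadhan and the self-bounding property give a bound
  \<open>E \<le> e * (E + Z * \<theta> * v / (1 - e))\<close> with \<open>e < 1\<close>, which is solved for \<open>E\<close>.  The result
  is exactly \<open>s\<^sup>2 Z\<close> times the derivative of \<open>v * s / (2 * (1 - c * s))\<close>, as Herbst's argument requires.
\<close>

lemma log_mgf_bounded_interaction:
  assumes \<mu>: "prob_space \<mu>" and I: "finite I" and f: "bounded_measurable (iid_measure I \<mu>) f"
    and b: "0 \<le> b" "\<And>k x y y'. k \<in> I \<Longrightarrow> x \<in> space (iid_measure I \<mu>) \<Longrightarrow> y \<in> space \<mu> \<Longrightarrow> y' \<in> space \<mu> \<Longrightarrow>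
      f (x(k := y)) - f (x(k := y')) \<le> b"
    and q: "\<And>k x y y'. k \<in> I \<Longrightarrow> x \<in> space (iid_measure I \<mu>) \<Longrightarrow> y \<in> space \<mu> \<Longrightarrow> y' \<in> space \<mu> \<Longrightarrow>
      (\<Sum>l\<in>I - {k}. var \<mu> (\<lambda>z. f (x(k := y, l := z)) - f (x(k := y', l := z)))) \<le> q k"
    and Q: "\<And>k. k \<in> I \<Longrightarrow> 0 \<le> q k" "(\<Sum>k\<in>I. q k) \<le> a\<^sup>2 / 2" "0 < a"
    and v: "(\<integral>x. sum_cond_var \<mu> I f x \<partial>iid_measure I \<mu>) \<le> v"
    and c: "c = b / 3 + a / 2" and \<beta>: "0 < \<beta>" "c * \<beta> < 1"
  shows "ln (\<integral>x. exp (\<beta> * f x) \<partial>iid_measure I \<mu>)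
     \<le> \<beta> * (\<integral>x. f x \<partial>iid_measure I \<mu>) + \<beta>\<^sup>2 * v / (2 * (1 - c * \<beta>))"
proof -
  let ?P = "iid_measure I \<mu>"
  let ?g = "sum_cond_var \<mu> I f"
  have P: "prob_space ?P" by (rule prob_space_iid[OF \<mu>])
  have g: "bounded_measurable ?P ?g" by (rule bm_sum_cond_var[OF \<mu> f])
  have cpos: "0 < c" using c b Q by simp
  have "ln (\<integral>x. exp (\<beta> * f x) \<partial>?P) \<le> \<beta> * ((\<integral>x. f x \<partial>?P) + v * \<beta> / (2 * (1 - c * \<beta>)))"
  proof (rule herbst[OF P f \<beta>(1), where w' = "\<lambda>s. v / (2 * (1 - c * s)\<^sup>2)"])
    have small: "c * s < 1" if "s \<le> \<beta>" for s
      using mult_left_mono[OF that, of c] cpos \<beta> by linarith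
    show "((\<lambda>s. v * s / (2 * (1 - c * s))) has_real_derivative v / (2 * (1 - c * s)\<^sup>2)) (at s)"
      if "0 < s" "s \<le> \<beta>" for s
    proof -
      have "((\<lambda>s. v * s / (2 * (1 - c * s))) has_real_derivative
          (v * (2 * (1 - c * s)) - v * s * (2 * - c)) / (2 * (1 - c * s) * (2 * (1 - c * s)))) (at s)"
        using small[OF that(2)] by (auto intro!: derivative_eq_intros)
      also have "v * (2 * (1 - c * s)) - v * s * (2 * - c) = 2 * v" by (simp add: algebra_simps)
      also have "2 * v / (2 * (1 - c * s) * (2 * (1 - c * s))) = v / (2 * (1 - c * s)\<^sup>2)"
      proof -
        have "2 * v / (2 * r * (2 * r)) = v / (2 * r\<^sup>2)" for r :: real
          by (simp add: power2_eq_square)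
        then show ?thesis .
      qed
      finally show ?thesis .
    qed
    have "isCont (\<lambda>s. v * s / (2 * (1 - c * s))) 0" by (intro continuous_intros) auto
    then have "((\<lambda>s. v * s / (2 * (1 - c * s))) \<longlongrightarrow> 0) (at 0)" by (simp add: isCont_def)
    then show "((\<lambda>s. v * s / (2 * (1 - c * s))) \<longlongrightarrow> 0) (at_right 0)"
      by (rule filterlim_mono[OF _ order_refl at_le]) simp
    fix s assume s: "0 < s" "s \<le> \<beta>"
    define Z where "Z = (\<integral>x. exp (s * f x) \<partial>?P)"
    define E where "E = ent ?P (\<lambda>x. exp (s * f x))"
    define u where "u = 1 - b * s / 3"
    have Z: "0 < Z" unfolding Z_def by (intro mgf_pos P bm_intros f)
    have cs: "1 - c * s = u - a * s / 2" by (simp add: c u_def algebra_simps)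
    have gap: "0 < u - a * s / 2" using small[OF s(2)] cs by linarith
    moreover have "0 < a * s" using Q(3) s(1) by simp
    ultimately have u: "0 < u" by linarith
    \<comment> \<open>The value that balances the two losses: \<open>s\<^sup>2 / (2 u\<^sup>2) / \<theta>\<close> and \<open>a\<^sup>2 / 2 * \<theta>\<close> both equal \<open>e\<close>.\<close>
    define \<theta> where "\<theta> = s / (a * u)"
    define e where "e = a * s / (2 * u)"
    have \<theta>: "0 < \<theta>" using s Q(3) u by (simp add: \<theta>_def)
    have e: "0 < e" "e < 1" using s Q(3) u gap by (simp_all add: e_def field_simps)
    have Q\<theta>: "a\<^sup>2 / 2 * \<theta> = e"
      using Q(3) u by (simp add: \<theta>_def e_def field_simps power2_eq_square)
    have psi: "s\<^sup>2 / 2 / u\<^sup>2 = e * \<theta>"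
      using Q(3) u by (simp add: \<theta>_def e_def field_simps power2_eq_square)
    have "ln (\<integral>x. exp (\<theta> * ?g x) \<partial>?P) \<le> \<theta> * (\<integral>x. ?g x \<partial>?P) / (1 - a\<^sup>2 / 2 * \<theta>)"
    proof (rule mgf_self_bounded[OF \<mu> I g _ Q(1,2)])
      show "(?g (x(k := y)) - ?g (x(k := y')))\<^sup>2 \<le> 2 * q k * (?g (x(k := y)) + ?g (x(k := y')))"
        if "k \<in> I" "x \<in> space ?P" "y \<in> space \<mu>" "y' \<in> space \<mu>" for k x y y'
        using that by (intro sum_cond_var_self_bounded \<mu> I f q)
    qed (use \<theta> e Q\<theta> sum_cond_var_nonneg[OF \<mu> f] in auto)
    also have "\<dots> \<le> \<theta> * v / (1 - e)"
      unfolding Q\<theta> using v \<theta> e by (intro divide_right_mono mult_left_mono) auto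
    finally have ln: "ln (\<integral>x. exp (\<theta> * ?g x) \<partial>?P) \<le> \<theta> * v / (1 - e)" .
    have "E \<le> s\<^sup>2 / 2 / u\<^sup>2 * (\<integral>x. ?g x * exp (s * f x) \<partial>?P)"
      unfolding E_def u_def using s u by (intro entropy_le_cond_var \<mu> I f b) (auto simp: u_def)
    also have "\<dots> = e * (\<integral>x. \<theta> * ?g x * exp (s * f x) \<partial>?P)"
      unfolding psi by (simp add: mult.assoc)
    also have "\<dots> \<le> e * (E + Z * ln (\<integral>x. exp (\<theta> * ?g x) \<partial>?P))"
      unfolding E_def Z_def using e
      by (intro mult_left_mono donsker_varadhan P bm_intros f g) auto
    also have "\<dots> \<le> e * (E + Z * (\<theta> * v / (1 - e)))"
      using e Z ln by (intro mult_left_mono add_left_mono) auto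
    finally have "E * (1 - e) \<le> Z * (e * \<theta> * v) / (1 - e)"
      by (simp add: algebra_simps)
    then have "E \<le> Z * (e * \<theta> * v) / (1 - e) / (1 - e)"
      using e by (simp add: pos_le_divide_eq)
    also have "\<dots> = s\<^sup>2 * Z * (v / (2 * (u * (1 - e))\<^sup>2))"
      unfolding psi[symmetric] using e u by (simp add: field_simps power2_eq_square)
    also have "u * (1 - e) = 1 - c * s"
      unfolding cs using u by (simp add: e_def field_simps)
    finally show "ent ?P (\<lambda>x. exp (s * f x)) \<le> s\<^sup>2 * (\<integral>x. exp (s * f x) \<partial>?P) * (v / (2 * (1 - c * s)\<^sup>2))"
      unfolding E_def Z_def .
  qed
  then show ?thesis by (simp add: algebra_simps power2_eq_square)
qed

lemma tail_of_sub_gamma: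
  assumes M: "prob_space M" and f: "bounded_measurable M f" and v: "0 < v" and c: "0 \<le> c" and t: "0 < t"
    and mgf: "\<And>\<beta>. 0 < \<beta> \<Longrightarrow> c * \<beta> < 1 \<Longrightarrow>
      ln (\<integral>x. exp (\<beta> * f x) \<partial>M) \<le> \<beta> * (\<integral>x. f x \<partial>M) + \<beta>\<^sup>2 * v / (2 * (1 - c * \<beta>))"
  shows "measure M {x\<in>space M. f x - (\<integral>x. f x \<partial>M) > t} \<le> exp (- t\<^sup>2 / (2 * v + 2 * c * t))"
proof -
  interpret prob_space M by fact
  define m where "m = (\<integral>x. f x \<partial>M)"
  define d where "d = v + c * t"
  have d: "0 < d" using v c t by (simp add: d_def add_pos_nonneg)
  \<comment> \<open>Chosen so that \<open>1 - c * \<beta> = v / d\<close>, which is positive.\<close>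
  define \<beta> where "\<beta> = t / d"
  have \<beta>: "0 < \<beta>" using t d by (simp add: \<beta>_def)
  have one: "1 - c * \<beta> = v / d" using d by (simp add: \<beta>_def d_def field_simps)
  have small: "c * \<beta> < 1" using one divide_pos_pos[OF v d] by linarith
  note [measurable] = bm_measurable[OF f]
  have b: "bounded_measurable M (\<lambda>x. exp (\<beta> * f x))" by (intro bm_intros f)
  define A where "A = {x\<in>space M. f x - m > t}"
  have A[measurable]: "A \<in> sets M" unfolding A_def by measurable
  have iA: "integrable M (indicator A :: _ \<Rightarrow> real)"
    by (intro bm_integrable M bmI[of _ _ 1]) (auto split: split_indicator)
  have "measure M A = (\<integral>x. indicator A x \<partial>M)" by simp
  also have "\<dots> \<le> (\<integral>x. exp (- \<beta> * (m + t)) * exp (\<beta> * f x) \<partial>M)"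
  proof (rule integral_mono)
    fix x
    show "indicator A x \<le> exp (- \<beta> * (m + t)) * exp (\<beta> * f x)"
    proof (cases "x \<in> A")
      case True
      then have "0 \<le> \<beta> * (f x - m - t)" using \<beta> by (simp add: A_def)
      then show ?thesis using True by (simp add: exp_add[symmetric] algebra_simps)
    qed simp
  qed (use bm_integrable[OF M b] iA in auto)
  also have "\<dots> = exp (- \<beta> * (m + t)) * exp (ln (\<integral>x. exp (\<beta> * f x) \<partial>M))"
    using mgf_pos[OF M bm_mult[OF bm_const f]] by simp
  also have "\<dots> \<le> exp (- \<beta> * (m + t)) * exp (\<beta> * m + \<beta>\<^sup>2 * v / (2 * (1 - c * \<beta>)))"
    using mgf[OF \<beta> small] by (simp add: m_def)
  also have "\<dots> = exp (- \<beta> * t + \<beta>\<^sup>2 * v / (2 * (1 - c * \<beta>)))"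
    by (simp add: exp_add[symmetric] algebra_simps)
  also have "- \<beta> * t + \<beta>\<^sup>2 * v / (2 * (1 - c * \<beta>)) = - t\<^sup>2 / (2 * d)"
    unfolding one using v d by (simp add: \<beta>_def field_simps power2_eq_square)
  also have "2 * d = 2 * v + 2 * c * t" by (simp add: d_def)
  finally show ?thesis unfolding A_def m_def .
qed

text \<open>
  The quantity \<open>q k\<close> measures how much the conditional variances of \<open>f\<close> can react to a change of
  coordinate \<open>k\<close>.  For a sum of functions of single coordinates a first difference in coordinate
  \<open>k\<close> does not depend on the other coordinates, so \<open>q = 0\<close> and \<open>a = 0\<close> are admissible and the bound is Bernstein's inequality for independent sums.
\<close>

theorem bernstein_bounded_interaction:
  assumes \<mu>: "prob_space \<mu>" and I: "finite I" and f: "bounded_measurable (iid_measure I \<mu>) f"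
    and b: "0 < b" "\<And>k x y y'. k \<in> I \<Longrightarrow> x \<in> space (iid_measure I \<mu>) \<Longrightarrow> y \<in> space \<mu> \<Longrightarrow> y' \<in> space \<mu> \<Longrightarrow>
      f (x(k := y)) - f (x(k := y')) \<le> b"
    and q: "\<And>k x y y'. k \<in> I \<Longrightarrow> x \<in> space (iid_measure I \<mu>) \<Longrightarrow> y \<in> space \<mu> \<Longrightarrow> y' \<in> space \<mu> \<Longrightarrow>
      (\<Sum>l\<in>I - {k}. var \<mu> (\<lambda>z. f (x(k := y, l := z)) - f (x(k := y', l := z)))) \<le> q k"
    and Q: "\<And>k. k \<in> I \<Longrightarrow> 0 \<le> q k" "(\<Sum>k\<in>I. q k) \<le> a\<^sup>2 / 2" "0 \<le> a"
    and v: "(\<integral>x. sum_cond_var \<mu> I f x \<partial>iid_measure I \<mu>) \<le> v" "0 \<le> v" and t: "0 < t"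
  shows "measure (iid_measure I \<mu>) {x\<in>space (iid_measure I \<mu>). f x - (\<integral>x. f x \<partial>iid_measure I \<mu>) > t}
     \<le> exp (- t\<^sup>2 / (2 * v + (2 * b / 3 + a) * t))"
proof -
  let ?P = "iid_measure I \<mu>"
  \<comment> \<open>The moment bound needs positive \<open>a\<close> and \<open>v\<close>: both are increased by \<open>\<epsilon>\<close>, which tends to \<open>0\<close>.\<close>
  let ?bd = "\<lambda>\<epsilon>. exp (- t\<^sup>2 / (2 * (v + \<epsilon>) + 2 * (b / 3 + (a + \<epsilon>) / 2) * t))"
  let ?pr = "measure ?P {x\<in>space ?P. f x - (\<integral>x. f x \<partial>?P) > t}"
  have P: "prob_space ?P" by (rule prob_space_iid[OF \<mu>])
  have pos: "0 < 2 * (v + 0) + 2 * (b / 3 + (a + 0) / 2) * t"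
  proof -
    have "0 < b / 3 + (a + 0) / 2" using b(1) Q(3) by simp
    then have "0 < 2 * (b / 3 + (a + 0) / 2) * t" using t by (metis mult_pos_pos zero_less_numeral)
    then show ?thesis by (rule add_nonneg_pos[rotated]) (use v(2) in simp)
  qed
  have "((\<lambda>\<epsilon>. ?bd \<epsilon>) \<longlongrightarrow> ?bd 0) (at_right 0)"
    using pos by (intro tendsto_intros) auto
  moreover have "eventually (\<lambda>\<epsilon>. ?pr \<le> ?bd \<epsilon>) (at_right 0)"
    unfolding eventually_at_right_field
  proof (intro exI[of _ 1] conjI allI impI)
    fix \<epsilon> :: real assume \<epsilon>: "0 < \<epsilon>" "\<epsilon> < 1"
    have "a\<^sup>2 / 2 \<le> (a + \<epsilon>)\<^sup>2 / 2" using Q(3) \<epsilon> by (intro divide_right_mono power_mono) auto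
    with Q(2) have Q': "(\<Sum>k\<in>I. q k) \<le> (a + \<epsilon>)\<^sup>2 / 2" by linarith
    show "?pr \<le> ?bd \<epsilon>"
    proof (rule tail_of_sub_gamma[OF P f _ _ t])
      fix \<beta> assume \<beta>: "0 < \<beta>" "(b / 3 + (a + \<epsilon>) / 2) * \<beta> < 1"
      show "ln (\<integral>x. exp (\<beta> * f x) \<partial>?P)
        \<le> \<beta> * (\<integral>x. f x \<partial>?P) + \<beta>\<^sup>2 * (v + \<epsilon>) / (2 * (1 - (b / 3 + (a + \<epsilon>) / 2) * \<beta>))"
        using Q(3) v \<epsilon> by (intro log_mgf_bounded_interaction[OF \<mu> I f less_imp_le[OF b(1)] b(2) q Q(1) Q' _ _ refl \<beta>]) auto
    qed (use v b Q(3) \<epsilon> in auto)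
  qed simp
  ultimately have "?pr \<le> ?bd 0"
    by (rule tendsto_lowerbound) simp
  then show ?thesis by (simp add: algebra_simps)
qed

section \<open>Kernels and their second differences\<close>

lemma diff_op_twice:
  "diff_op k y y' (diff_op l z z' f) x =
     (f (x(k := y, l := z)) - f (x(k := y, l := z'))) - (f (x(k := y', l := z)) - f (x(k := y', l := z')))"
  by (simp add: diff_op_def)

lemma sum_square_le_card:
  fixes f :: "'b \<Rightarrow> real"
  assumes "finite S"
  shows "(\<Sum>i\<in>S. f i)\<^sup>2 \<le> card S * (\<Sum>i\<in>S. (f i)\<^sup>2)"
  using sum_squared_le_sum_of_squares[of f S] assms by (simp add: mult.commute)

lemma bij_betw_transpose_comp:
  assumes e: "bij_betw e S W" and i: "i \<in> S" and k: "k \<in> W"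
  shows "bij_betw (Transposition.transpose (e i) k \<circ> e) S W"
  by (rule bij_betw_trans[OF e permutes_imp_bij[OF permutes_swap_id[OF bij_betw_apply[OF e i] k]]])

lemma ex_bij_betw_two_points:
  assumes "finite W" "card W = m" "2 \<le> m" "k \<in> W" "l \<in> W" "k \<noteq> l"
  obtains e where "bij_betw e {1..m} W" "e 1 = k" "e (2::nat) = l"
proof -
  obtain e0 where e0: "bij_betw e0 {1..m} W"
    using ex_bij_betw_nat_finite_1[OF assms(1)] assms(2) by auto
  have mem: "1 \<in> {1..m}" "2 \<in> {1..m}" using assms(3) by auto
  define e1 where "e1 = Transposition.transpose (e0 1) k \<circ> e0"
  have e1: "bij_betw e1 {1..m} W" "e1 1 = k"
    unfolding e1_def by (rule bij_betw_transpose_comp[OF e0 mem(1) assms(4)], simp)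
  define e2 where "e2 = Transposition.transpose (e1 2) l \<circ> e1"
  have "e1 2 \<noteq> k" using e1 mem by (metis bij_betw_imp_inj_on inj_onD numeral_eq_one_iff semiring_norm(85))
  then have "bij_betw e2 {1..m} W" "e2 1 = k" "e2 2 = l"
    unfolding e2_def using e1(2) assms(6)
    by (rule_tac bij_betw_transpose_comp[OF e1(1) mem(2) assms(5)], auto simp: transpose_def)
  then show ?thesis by (rule that)
qed

lemma ex_bij_betw_point:
  assumes "finite W" "card W = m" "1 \<le> m" "k \<in> W"
  obtains e where "bij_betw e {1..m} W" "e (1::nat) = k"
proof -
  obtain e0 where e0: "bij_betw e0 {1..m} W"
    using ex_bij_betw_nat_finite_1[OF assms(1)] assms(2) by auto
  have mem: "1 \<in> {1..m}" using assms(3) by auto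
  have "bij_betw (Transposition.transpose (e0 1) k \<circ> e0) {1..m} W"
    "(Transposition.transpose (e0 1) k \<circ> e0) 1 = k"
    by (rule bij_betw_transpose_comp[OF e0 mem assms(4)], simp)
  then show ?thesis by (rule that)
qed

definition pull :: "nat \<Rightarrow> (nat \<Rightarrow> nat) \<Rightarrow> (nat \<Rightarrow> 'a) \<Rightarrow> nat \<Rightarrow> 'a" where
  "pull m e x = (\<lambda>j\<in>{1..m}. x (e j))"

lemma pull_update:
  "inj_on e {1..m} \<Longrightarrow> i \<in> {1..m} \<Longrightarrow> pull m e (x(e i := y)) = (pull m e x)(i := y)"
  by (intro ext) (simp add: pull_def inj_on_eq_iff)

lemma pull_update_outside: "k \<notin> e ` {1..m} \<Longrightarrow> pull m e (x(k := y)) = pull m e x"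
  by (auto simp: pull_def fun_eq_iff)

lemma pull_space:
  "e ` {1..m} \<subseteq> {1..n} \<Longrightarrow> x \<in> space (power_measure n \<mu>) \<Longrightarrow> pull m e x \<in> space (power_measure m \<mu>)"
  by (auto simp: pull_def space_PiM PiE_def Pi_def image_subset_iff)

lemma measurable_pull:
  "e ` {1..m} \<subseteq> {1..n} \<Longrightarrow> pull m e \<in> measurable (power_measure n \<mu>) (power_measure m \<mu>)"
  unfolding pull_def[abs_def] by (intro measurable_restrict measurable_component_singleton) blast

lemma integral_pull:
  fixes h :: "_ \<Rightarrow> real"
  assumes "prob_space \<mu>" "inj_on e {1..m}" "e ` {1..m} \<subseteq> {1..n}" "h \<in> borel_measurable (power_measure m \<mu>)"
  shows "(\<integral>x. h (pull m e x) \<partial>power_measure n \<mu>) = (\<integral>w. h w \<partial>power_measure m \<mu>)"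
proof -
  have "distr (power_measure n \<mu>) (power_measure m \<mu>) (pull m e) = power_measure m \<mu>"
    unfolding pull_def[abs_def] using assms(1-3) by (intro distr_PiM_reindex) auto
  then show ?thesis
    using integral_distr[OF measurable_pull[OF assms(3)] assms(4)] by simp
qed

lemma sorted_list_bij_betw:
  assumes "finite W" "card W = m"
  shows "bij_betw (\<lambda>j. sorted_list_of_set W ! (j - 1)) {1..m} W"
proof -
  have "bij_betw (\<lambda>j. j - 1) {1..m} {..<m}"
    by (rule bij_betw_byWitness[where f' = Suc]) auto
  from bij_betw_trans[OF this bij_betw_nth[of "sorted_list_of_set W" "{..<m}" W]]
  show ?thesis using assms by (simp add: o_def)
qed

locale symmetric_bounded_kernel =
  fixes \<mu> :: "'a measure" and m :: nat and K :: "(nat \<Rightarrow> 'a) \<Rightarrow> real"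
  assumes prob: "prob_space \<mu>" and m: "1 \<le> m"
    and K_measurable: "K \<in> borel_measurable (power_measure m \<mu>)"
    and K_range: "x \<in> space (power_measure m \<mu>) \<Longrightarrow> K x \<in> {-1..1}"
    and K_symmetric: "symmetric_kernel m \<mu> K"
begin

lemma bm_K: "bounded_measurable (power_measure m \<mu>) K"
  using K_range by (intro bmI[of _ _ 1] K_measurable) (force simp: abs_le_iff)

lemma kernel_at_bij:
  assumes e: "bij_betw e {1..m} W" and W: "W \<subseteq> {1..n}" and x: "x \<in> space (power_measure n \<mu>)"
  shows "kernel_at m K x W = K (pull m e x)"
proof -
  let ?e0 = "\<lambda>j. sorted_list_of_set W ! (j - 1)"
  have fin: "finite W" using W finite_subset by blast
  have card: "card W = m" using bij_betw_same_card[OF e] by simp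
  have e0: "bij_betw ?e0 {1..m} W" by (rule sorted_list_bij_betw[OF fin card])
  \<comment> \<open>The permutation of the arguments that carries the increasing enumeration of \<open>W\<close> to \<open>e\<close>.\<close>
  define p where "p j = (if j \<in> {1..m} then inv_into {1..m} ?e0 (e j) else j)" for j
  have "bij_betw (inv_into {1..m} ?e0 \<circ> e) {1..m} {1..m}"
    by (rule bij_betw_trans[OF e bij_betw_inv_into[OF e0]])
  then have "bij_betw p {1..m} {1..m}"
    by (rule bij_betw_cong[THEN iffD1, rotated]) (simp add: p_def)
  then have p: "p permutes {1..m}"
    by (rule bij_imp_permutes) (auto simp: p_def)
  have p1: "p j \<in> {1..m}" if "j \<in> {1..m}" for j using permutes_in_image[OF p] that by blast
  have e0p: "?e0 (p j) = e j" if "j \<in> {1..m}" for j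
    using that bij_betw_inv_into_right[OF e0 bij_betw_apply[OF e that]] by (simp add: p_def)
  have sub: "?e0 ` {1..m} \<subseteq> {1..n}" using e0 W by (simp add: bij_betw_def)
  have "pull m ?e0 x \<circ> p = pull m e x"
  proof
    fix j show "(pull m ?e0 x \<circ> p) j = pull m e x j"
    proof (cases "j \<in> {1..m}")
      case True then show ?thesis using p1[OF True] e0p[OF True] by (simp add: pull_def)
    next
      case False
      then have "p j = j" unfolding p_def by (rule if_not_P)
      with False show ?thesis by (simp add: pull_def restrict_def del: atLeastAtMost_iff)
    qed
  qed
  moreover have "K (pull m ?e0 x \<circ> p) = K (pull m ?e0 x)"
    using K_symmetric p pull_space[OF sub x] unfolding symmetric_kernel_def by blast
  ultimately show ?thesis by (simp add: kernel_at_def pull_def)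
qed

lemma bm_kernel_at:
  assumes "W \<subseteq> {1..n}" "card W = m"
  shows "bounded_measurable (power_measure n \<mu>) (\<lambda>x. kernel_at m K x W)"
proof -
  have "finite W" using assms finite_subset by blast
  then have "bij_betw (\<lambda>j. sorted_list_of_set W ! (j - 1)) {1..m} W"
    using assms(2) by (rule sorted_list_bij_betw)
  then have "(\<lambda>j. sorted_list_of_set W ! (j - 1)) ` {1..m} \<subseteq> {1..n}"
    using assms(1) by (simp add: bij_betw_def)
  from bm_compose[OF bm_K measurable_pull[OF this]]
  show ?thesis unfolding kernel_at_def pull_def .
qed

lemma kernel_at_abs_le:
  assumes "W \<subseteq> {1..n}" "card W = m" "x \<in> space (power_measure n \<mu>)"
  shows "\<bar>kernel_at m K x W\<bar> \<le> 1"
proof -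
  have "finite W" using assms finite_subset by blast
  then have e: "bij_betw (\<lambda>j. sorted_list_of_set W ! (j - 1)) {1..m} W" (is "bij_betw ?e _ _")
    using assms(2) by (rule sorted_list_bij_betw)
  then have "?e ` {1..m} \<subseteq> {1..n}"
    using assms(1) by (simp add: bij_betw_def)
  from K_range[OF pull_space[OF this assms(3)]]
  show ?thesis using kernel_at_bij[OF e assms(1,3)] by (simp add: abs_le_iff)
qed

lemma kernel_at_update_outside:
  assumes "W \<subseteq> {1..n}" "card W = m" "k \<notin> W"
  shows "kernel_at m K (x(k := y)) W = kernel_at m K x W"
proof -
  have "finite W" using assms finite_subset by blast
  then have "bij_betw (\<lambda>j. sorted_list_of_set W ! (j - 1)) {1..m} W" (is "bij_betw ?e _ _")
    using assms(2) by (rule sorted_list_bij_betw)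
  then have "k \<notin> ?e ` {1..m}"
    using assms(3) by (simp add: bij_betw_def)
  from pull_update_outside[OF this, of x y] show ?thesis unfolding kernel_at_def pull_def by simp
qed

lemma expectation_kernel_at:
  assumes "W \<subseteq> {1..n}" "card W = m"
  shows "(\<integral>x. kernel_at m K x W \<partial>power_measure n \<mu>) = (\<integral>x. K x \<partial>power_measure m \<mu>)"
proof -
  have "finite W" using assms finite_subset by blast
  then have e: "bij_betw (\<lambda>j. sorted_list_of_set W ! (j - 1)) {1..m} W" (is "bij_betw ?e _ _")
    using assms(2) by (rule sorted_list_bij_betw)
  then have "inj_on ?e {1..m}" "?e ` {1..m} \<subseteq> {1..n}"
    using assms(1) by (simp_all add: bij_betw_def)
  from integral_pull[OF prob this K_measurable] show ?thesis unfolding kernel_at_def pull_def .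
qed

text \<open>
  The first-order Hoeffding projection of the kernel, not centred.
\<close>

definition first_projection :: "'a \<Rightarrow> real" where
  "first_projection y = (\<integral>x. K (x(1 := y)) \<partial>power_measure m \<mu>)"

lemma one_in: "1 \<in> {1..m}" using m by simp

lemma bm_first_projection: "bounded_measurable \<mu> first_projection"
  unfolding first_projection_def
  by (intro bm_integral prob_space_iid prob)
     (rule bm_compose[OF bm_K], rule measurable_fun_upd[where J = "{1..m}"], use m in auto)

lemma expectation_kernel_at_update:
  assumes "W \<subseteq> {1..n}" "card W = m" "k \<in> W" "y \<in> space \<mu>"
  shows "(\<integral>x. kernel_at m K (x(k := y)) W \<partial>power_measure n \<mu>) = first_projection y"
proof -
  have "finite W" using assms finite_subset by blast
  then obtain e where e: "bij_betw e {1..m} W" "e 1 = k"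
    using ex_bij_betw_point[of W m k] assms m by auto
  have inj: "inj_on e {1..m}" "e ` {1..m} \<subseteq> {1..n}" using e assms(1) by (simp_all add: bij_betw_def)
  have k: "k \<in> {1..n}" using assms by auto
  have "(\<integral>x. kernel_at m K (x(k := y)) W \<partial>power_measure n \<mu>)
     = (\<integral>x. K ((pull m e x)(1 := y)) \<partial>power_measure n \<mu>)"
  proof (rule Bochner_Integration.integral_cong)
    fix x assume x: "x \<in> space (power_measure n \<mu>)"
    show "kernel_at m K (x(k := y)) W = K ((pull m e x)(1 := y))"
      using kernel_at_bij[OF e(1) assms(1) space_update[OF x assms(4) k]] pull_update[OF inj(1) one_in, of x y] e(2)
      by simp
  qed simp
  also have "\<dots> = first_projection y"
    unfolding first_projection_def using assms(4) m
    by (intro integral_pull[OF prob inj] measurable_compose[OF _ K_measurable]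
         measurable_fun_upd[where J = "{1..m}"]) auto
  finally show ?thesis .
qed

text \<open>
  A symmetric kernel may be evaluated along any enumeration of \<open>W\<close>, in particular along one that
  starts with \<open>k\<close> and \<open>l\<close>.
\<close>

lemma diff_op_kernel_at:
  assumes W: "W \<subseteq> {1..n}" "card W = m" and kl: "k \<in> W" "l \<in> W" "k \<noteq> l"
  obtains e where "inj_on e {1..m}" "e ` {1..m} \<subseteq> {1..n}"
    "\<And>x y y' z z'. x \<in> space (power_measure n \<mu>) \<Longrightarrow> y \<in> space \<mu> \<Longrightarrow> y' \<in> space \<mu> \<Longrightarrow> z \<in> space \<mu> \<Longrightarrow> z' \<in> space \<mu> \<Longrightarrow>
       diff_op k y y' (diff_op l z z' (\<lambda>x. kernel_at m K x W)) x = diff_op 1 y y' (diff_op 2 z z' K) (pull m e x)"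
proof -
  have fin: "finite W" using W finite_subset by blast
  have "card {k, l} \<le> card W" using kl fin by (intro card_mono) auto
  then have m2: "2 \<le> m" using kl W by simp
  then obtain e where e: "bij_betw e {1..m} W" "e 1 = k" "e 2 = l"
    using ex_bij_betw_two_points[OF fin W(2) _ kl] by auto
  have inj: "inj_on e {1..m}" "e ` {1..m} \<subseteq> {1..n}" using e W(1) by (simp_all add: bij_betw_def)
  have kln: "k \<in> {1..n}" "l \<in> {1..n}" using kl W by auto
  have one: "kernel_at m K (x(k := y, l := z)) W = K ((pull m e x)(1 := y, 2 := z))"
    if "x \<in> space (power_measure n \<mu>)" "y \<in> space \<mu>" "z \<in> space \<mu>" for x y z
    using kernel_at_bij[OF e(1) W(1) space_update[OF space_update[OF that(1,2) kln(1)] that(3) kln(2)]]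
      pull_update[OF inj(1) one_in, of x y] pull_update[OF inj(1), of 2 "x(k := y)" z] e(2,3) m2
    by simp
  show ?thesis
    by (rule that[OF inj]) (simp add: diff_op_twice one)
qed

lemma bm_diff_op_K:
  assumes "2 \<le> m" "w \<in> measurable N (power_measure m \<mu>)" "y \<in> measurable N \<mu>" "y' \<in> measurable N \<mu>"
    "z \<in> measurable N \<mu>" "z' \<in> measurable N \<mu>"
  shows "bounded_measurable N (\<lambda>p. (diff_op 1 (y p) (y' p) (diff_op 2 (z p) (z' p) K) (w p))\<^sup>2)"
proof -
  have one: "bounded_measurable N (\<lambda>p. K ((w p)(1 := a p, 2 := b p)))"
    if "a \<in> measurable N \<mu>" "b \<in> measurable N \<mu>" for a b
    using assms(1,2) that
    by (intro bm_compose[OF bm_K] measurable_fun_upd[where J = "{1..m}" and I = "{1..m}"]) auto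
  then show ?thesis
    unfolding diff_op_twice by (intro bm_intros one assms)
qed


lemma diff_op_K_square_le:
  assumes "2 \<le> m" "w \<in> space (power_measure m \<mu>)" "y \<in> space \<mu>" "y' \<in> space \<mu>" "z \<in> space \<mu>" "z' \<in> space \<mu>"
  shows "(diff_op 1 y y' (diff_op 2 z z' K) w)\<^sup>2 \<le> 16"
proof -
  have "\<bar>K (w(1 := a, 2 := b))\<bar> \<le> 1" if "a \<in> space \<mu>" "b \<in> space \<mu>" for a b
  proof -
    have "w(1 := a, 2 := b) \<in> space (power_measure m \<mu>)"
      using assms(1,2) that by (intro space_update) auto
    from K_range[OF this] show ?thesis by (simp add: abs_le_iff)
  qed
  from this[of y z] this[of y z'] this[of y' z] this[of y' z'] assms
  have "\<bar>diff_op 1 y y' (diff_op 2 z z' K) w\<bar> \<le> 4"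
    unfolding diff_op_twice by linarith
  then have "\<bar>diff_op 1 y y' (diff_op 2 z z' K) w\<bar>\<^sup>2 \<le> 4\<^sup>2"
    by (intro power_mono) auto
  then show ?thesis by simp
qed

lemma double_integral_eq_pair:
  assumes "bounded_measurable (\<mu> \<Otimes>\<^sub>M \<mu>) (\<lambda>p. f (fst p) (snd p))"
  shows "(\<integral>(z, z'). f z z' \<partial>(\<mu> \<Otimes>\<^sub>M \<mu>)) = (\<integral>z. \<integral>z'. f z z' \<partial>\<mu> \<partial>\<mu>)"
proof -
  interpret prob_space \<mu> by (rule prob)
  interpret pair_prob_space \<mu> \<mu> ..
  have "integrable (\<mu> \<Otimes>\<^sub>M \<mu>) (\<lambda>(z, z'). f z z')"
    using bm_integrable[OF _ assms] by (simp add: case_prod_unfold prob_space_axioms)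
  from integral_fst[OF this] show ?thesis by simp
qed

text \<open>
  The inner mean in \<open>kernel_gamma\<close>, over the two copies of the second argument.
\<close>

definition sq_interaction :: "(nat \<Rightarrow> 'a) \<Rightarrow> 'a \<Rightarrow> 'a \<Rightarrow> real" where
  "sq_interaction w y y' = (\<integral>z. \<integral>z'. (diff_op 1 y y' (diff_op 2 z z' K) w)\<^sup>2 \<partial>\<mu> \<partial>\<mu>)"

lemma bm_sq_interaction:
  assumes "2 \<le> m" and w: "w \<in> measurable N (power_measure m \<mu>)" and y: "y \<in> measurable N \<mu>" "y' \<in> measurable N \<mu>"
  shows "bounded_measurable N (\<lambda>p. sq_interaction (w p) (y p) (y' p))"
  unfolding sq_interaction_def
  by (intro bm_integral prob bm_diff_op_K assms(1) measurable_compose[OF _ w] measurable_compose[OF _ y(1)]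
      measurable_compose[OF _ y(2)]) measurable

lemma sq_interaction_le_gamma:
  assumes m2: "2 \<le> m" and w: "w \<in> space (power_measure m \<mu>)" and y: "y \<in> space \<mu>" "y' \<in> space \<mu>"
  shows "sq_interaction w y y' \<le> kernel_gamma m \<mu> K"
proof -
  let ?h = "\<lambda>(x, y, y'). \<integral>(z, z'). (diff_op 1 y y' (diff_op 2 z z' K) x)\<^sup>2 \<partial>(\<mu> \<Otimes>\<^sub>M \<mu>)"
  let ?S = "space (power_measure m \<mu>) \<times> space \<mu> \<times> space \<mu>"
  have eq: "?h (x, y, y') = sq_interaction x y y'"
    if "x \<in> space (power_measure m \<mu>)" "y \<in> space \<mu>" "y' \<in> space \<mu>" for x y y'
    unfolding prod.case sq_interaction_def using that m2
    by (intro double_integral_eq_pair bm_diff_op_K) auto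
  interpret prob_space \<mu> by (rule prob)
  have bd: "sq_interaction x y y' \<le> 16"
    if "x \<in> space (power_measure m \<mu>)" "y \<in> space \<mu>" "y' \<in> space \<mu>" for x y y'
  proof -
    have "sq_interaction x y y' \<le> (\<integral>z. \<integral>z'. 16 \<partial>\<mu> \<partial>\<mu>)"
      unfolding sq_interaction_def using that m2
      by (intro bm_integral_mono bm_integral prob bm_diff_op_K diff_op_K_square_le bm_const) auto
    then show ?thesis by (simp add: prob_space)
  qed
  have "bdd_above (?h ` ?S)"
    by (rule bdd_aboveI2[where M = 16]) (use eq bd in force)
  then have "?h (w, y, y') \<le> (SUP p\<in>?S. ?h p)"
    by (intro cSUP_upper) (use w y in auto)
  then show ?thesis
    using m2 eq[OF w y] by (simp add: kernel_gamma_def)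
qed

lemma gamma_nonneg: "0 \<le> kernel_gamma m \<mu> K"
proof (cases "m < 2")
  case False
  interpret \<mu>: prob_space \<mu> by (rule prob)
  interpret Pm: prob_space "power_measure m \<mu>" by (rule prob_space_iid[OF prob])
  obtain w where w: "w \<in> space (power_measure m \<mu>)" using Pm.not_empty by blast
  obtain y where y: "y \<in> space \<mu>" using \<mu>.not_empty by blast
  have "0 \<le> sq_interaction w y y" unfolding sq_interaction_def by (intro Bochner_Integration.integral_nonneg) simp
  also have "\<dots> \<le> kernel_gamma m \<mu> K" using sq_interaction_le_gamma[OF _ w y y] False by simp
  finally show ?thesis .
qed (simp add: kernel_gamma_def)

lemma beta_nonneg: "0 \<le> kernel_beta m \<mu> K"
  unfolding kernel_beta_def by (auto intro!: Bochner_Integration.integral_nonneg simp: case_prod_unfold)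

text \<open>
  A second difference ignores the two coordinates that it overwrites.  This allows them to be
  resampled in the integral defining \<open>kernel_beta\<close>.
\<close>

lemma diff_op_K_update: "diff_op 1 y y' (diff_op 2 z z' K) (w(1 := a)) = diff_op 1 y y' (diff_op 2 z z' K) w"
  "diff_op 1 y y' (diff_op 2 z z' K) (w(2 := a)) = diff_op 1 y y' (diff_op 2 z z' K) w"
proof -
  have "w(1 := a, 1 := c, 2 := d) = w(1 := c, 2 := d)" "w(2 := a, 1 := c, 2 := d) = w(1 := c, 2 := d)" for c d
    by (auto simp: fun_eq_iff)
  then show "diff_op 1 y y' (diff_op 2 z z' K) (w(1 := a)) = diff_op 1 y y' (diff_op 2 z z' K) w"
  "diff_op 1 y y' (diff_op 2 z z' K) (w(2 := a)) = diff_op 1 y y' (diff_op 2 z z' K) w"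
    unfolding diff_op_twice by simp_all
qed

lemma sq_interaction_update: "sq_interaction (w(1 := a)) = sq_interaction w"
  by (intro ext) (simp only: sq_interaction_def diff_op_K_update)

text \<open>
  Resampling coordinates 1 and 2 of \<open>w\<close> turns the values \<open>w 1\<close> and \<open>w 2\<close> of the definition into
  independent integration variables.
\<close>

lemma beta_eq:
  assumes m2: "2 \<le> m"
  shows "kernel_beta m \<mu> K = (\<integral>y. \<integral>y'. \<integral>w. sq_interaction w y y' \<partial>power_measure m \<mu> \<partial>\<mu> \<partial>\<mu>)"
proof -
  let ?P = "power_measure m \<mu>"
  let ?d = "\<lambda>w y y' z z'. (diff_op 1 y y' (diff_op 2 z z' K) w)\<^sup>2"
  interpret \<mu>: prob_space \<mu> by (rule prob)
  have P: "prob_space ?P" by (rule prob_space_iid[OF prob])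
  interpret Pm: prob_space ?P by fact
  interpret mm: pair_prob_space \<mu> \<mu> ..
  interpret pm: pair_prob_space ?P "\<mu> \<Otimes>\<^sub>M \<mu>" ..
  have in12: "1 \<in> {1..m}" "2 \<in> {1..m}" using m2 by auto
  have c1: "(\<lambda>w. w 1) \<in> measurable ?P \<mu>" and c2: "(\<lambda>w. w 2) \<in> measurable ?P \<mu>"
    using in12 by (auto intro: measurable_component_singleton)
  have c1': "(\<lambda>p. f p 1) \<in> measurable N \<mu>" and c2': "(\<lambda>p. f p 2) \<in> measurable N \<mu>"
    if "f \<in> measurable N ?P" for f and N :: "'b measure"
    using measurable_compose[OF that c1] measurable_compose[OF that c2] by auto
  have ff: "(\<lambda>p. fst (fst p)) \<in> measurable ((?P \<Otimes>\<^sub>M \<mu>) \<Otimes>\<^sub>M \<mu>) ?P" by measurable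
  have "kernel_beta m \<mu> K = (\<integral>(w, p). ?d w (w 1) (fst p) (w 2) (snd p) \<partial>(?P \<Otimes>\<^sub>M (\<mu> \<Otimes>\<^sub>M \<mu>)))"
    using m2 by (simp add: kernel_beta_def case_prod_unfold)
  also have "\<dots> = (\<integral>w. \<integral>p. ?d w (w 1) (fst p) (w 2) (snd p) \<partial>(\<mu> \<Otimes>\<^sub>M \<mu>) \<partial>?P)"
  proof (rule pm.integral_fst[symmetric])
    have "bounded_measurable (?P \<Otimes>\<^sub>M (\<mu> \<Otimes>\<^sub>M \<mu>)) 
       (\<lambda>q. ?d (fst q) (fst q 1) (fst (snd q)) (fst q 2) (snd (snd q)))"
      by (rule bm_diff_op_K[OF m2 measurable_fst c1'[OF measurable_fst] _ c2'[OF measurable_fst]])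
        measurable
    from bm_integrable[OF pm.prob_space_axioms this] show "integrable (?P \<Otimes>\<^sub>M (\<mu> \<Otimes>\<^sub>M \<mu>)) 
       (\<lambda>(w, p). ?d w (w 1) (fst p) (w 2) (snd p))"
      by (simp add: case_prod_unfold)
  qed
  also have "\<dots> = (\<integral>w. \<integral>y'. \<integral>z'. ?d w (w 1) y' (w 2) z' \<partial>\<mu> \<partial>\<mu> \<partial>?P)"
  proof (rule Bochner_Integration.integral_cong[OF refl])
    fix w assume w: "w \<in> space ?P"
    then have "w 1 \<in> space \<mu>" "w 2 \<in> space \<mu>" using in12 by (auto simp: space_PiM)
    then have "bounded_measurable (\<mu> \<Otimes>\<^sub>M \<mu>) (\<lambda>p. ?d w (w 1) (fst p) (w 2) (snd p))"
      using w by (intro bm_diff_op_K m2) auto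
    from double_integral_eq_pair[where f = "\<lambda>a b. ?d w (w 1) a (w 2) b", OF this]
    show "(\<integral>p. ?d w (w 1) (fst p) (w 2) (snd p) \<partial>(\<mu> \<Otimes>\<^sub>M \<mu>)) = (\<integral>y'. \<integral>z'. ?d w (w 1) y' (w 2) z' \<partial>\<mu> \<partial>\<mu>)"
      by (simp add: case_prod_unfold)
  qed
  also have "\<dots> = (\<integral>w. \<integral>z. \<integral>y'. \<integral>z'. ?d w (w 1) y' z z' \<partial>\<mu> \<partial>\<mu> \<partial>\<mu> \<partial>?P)"
  proof (subst integral_resample[OF prob _ in12(2)])
    show "bounded_measurable ?P (\<lambda>w. \<integral>y'. \<integral>z'. ?d w (w 1) y' (w 2) z' \<partial>\<mu> \<partial>\<mu>)"
      by (intro bm_integral prob, rule bm_diff_op_K[OF m2 ff c1'[OF ff] _ c2'[OF ff]]) measurable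
  qed (simp_all only: diff_op_K_update(2), simp_all)
  also have "\<dots> = (\<integral>w. \<integral>y'. sq_interaction w (w 1) y' \<partial>\<mu> \<partial>?P)"
  proof (rule Bochner_Integration.integral_cong[OF refl])
    fix w assume w: "w \<in> space ?P"
    then have "w 1 \<in> space \<mu>" using in12 by (auto simp: space_PiM)
    with w show "(\<integral>z. \<integral>y'. \<integral>z'. ?d w (w 1) y' z z' \<partial>\<mu> \<partial>\<mu> \<partial>\<mu>) = (\<integral>y'. sq_interaction w (w 1) y' \<partial>\<mu>)"
      unfolding sq_interaction_def
      by (intro bm_fubini prob bm_integral bm_diff_op_K m2) auto
  qed
  also have "\<dots> = (\<integral>w. \<integral>y. \<integral>y'. sq_interaction w y y' \<partial>\<mu> \<partial>\<mu> \<partial>?P)"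
  proof (subst integral_resample[OF prob _ in12(1)])
    show "bounded_measurable ?P (\<lambda>w. \<integral>y'. sq_interaction w (w 1) y' \<partial>\<mu>)"
      by (intro bm_integral prob, rule bm_sq_interaction[OF m2 measurable_fst c1'[OF measurable_fst]]) measurable
  qed (simp_all only: sq_interaction_update, simp_all)
  also have "\<dots> = (\<integral>y. \<integral>w. \<integral>y'. sq_interaction w y y' \<partial>\<mu> \<partial>?P \<partial>\<mu>)"
    by (intro bm_fubini P prob bm_integral bm_sq_interaction m2) measurable
  also have "\<dots> = (\<integral>y. \<integral>y'. \<integral>w. sq_interaction w y y' \<partial>?P \<partial>\<mu> \<partial>\<mu>)"
    by (intro Bochner_Integration.integral_cong refl bm_fubini P prob bm_sq_interaction m2) auto
  finally show ?thesis .
qed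

text \<open>
  The conditional expectation given the first coordinate is the first projection, evaluated at that
  coordinate.
\<close>

lemma sigma1_sq_eq: "kernel_sigma1_sq m \<mu> K = var \<mu> first_projection"
proof -
  let ?P = "power_measure m \<mu>"
  define F where "F = vimage_algebra (space ?P) (\<lambda>x. x 1) \<mu>"
  have P: "prob_space ?P" by (rule prob_space_iid[OF prob])
  interpret Pm: prob_space ?P by fact
  interpret \<mu>: prob_space \<mu> by (rule prob)
  have c1: "(\<lambda>w. w 1) \<in> measurable ?P \<mu>"
    using one_in by (intro measurable_component_singleton)
  have setsF: "sets F = {(\<lambda>x. x 1) -` B \<inter> space ?P |B. B \<in> sets \<mu>}"
    unfolding F_def by (rule sets_vimage_algebra2) (use measurable_space[OF c1] in blast)
  have sub: "subalgebra ?P F"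
    unfolding subalgebra_def setsF using measurable_sets[OF c1] by (auto simp: F_def)
  interpret finite_measure_subalgebra ?P F
    by unfold_locales (rule sub)
  have F1: "(\<lambda>x. x 1) \<in> measurable F \<mu>"
    unfolding F_def by (rule measurable_vimage_algebra1) (use measurable_space[OF c1] in auto)
  have bK1: "bounded_measurable ?P (\<lambda>x. first_projection (x 1))" by (rule bm_compose[OF bm_first_projection c1])
  have marg: "(\<integral>x. h (x 1) \<partial>?P) = (\<integral>y. h y \<partial>\<mu>)" if "bounded_measurable \<mu> h" for h
    using Pm.prob_space by (subst integral_resample[OF prob _ one_in bm_compose[OF that c1]]) simp_all
  have AE: "AE x in ?P. real_cond_exp ?P F K x = first_projection (x 1)"
  proof (rule real_cond_exp_charact)
    fix A assume "A \<in> sets F"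
    then obtain B where B: "B \<in> sets \<mu>" "A = (\<lambda>x. x 1) -` B \<inter> space ?P"
      unfolding setsF by blast
    have bB: "bounded_measurable \<mu> (indicator B)"
      using B(1) by (intro bmI[of _ _ 1]) (auto split: split_indicator)
    have set: "(LINT x:A|?P. h x) = (\<integral>x. indicator B (x 1) * h x \<partial>?P)" for h :: "_ \<Rightarrow> real"
      unfolding set_lebesgue_integral_def
      by (intro Bochner_Integration.integral_cong) (auto simp: B(2) split: split_indicator)
    have prodm: "(\<lambda>p. (fst p)(1 := snd p)) \<in> measurable (?P \<Otimes>\<^sub>M \<mu>) ?P"
      by (rule measurable_update[OF one_in])
    have "(LINT x:A|?P. K x) = (\<integral>x. \<integral>y. indicator B y * K (x(1 := y)) \<partial>\<mu> \<partial>?P)"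
      unfolding set
      by (subst integral_resample[OF prob _ one_in bm_mult[OF bm_compose[OF bB c1] bm_K]]) simp_all
    also have "\<dots> = (\<integral>y. \<integral>x. indicator B y * K (x(1 := y)) \<partial>?P \<partial>\<mu>)"
      by (intro bm_fubini P prob bm_mult bm_compose[OF bB] bm_compose[OF bm_K] prodm) simp
    also have "\<dots> = (\<integral>y. indicator B y * first_projection y \<partial>\<mu>)"
      by (simp add: first_projection_def)
    also have "\<dots> = (LINT x:A|?P. first_projection (x 1))"
      unfolding set by (rule marg[symmetric]) (intro bm_mult bB bm_first_projection)
    finally show "(LINT x:A|?P. K x) = (LINT x:A|?P. first_projection (x 1))" .
  next
    show "integrable ?P K" "integrable ?P (\<lambda>x. first_projection (x 1))" by (intro bm_integrable P bm_K bK1)+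
    show "(\<lambda>x. first_projection (x 1)) \<in> borel_measurable F"
      by (rule measurable_compose[OF F1 bm_measurable[OF bm_first_projection]])
  qed
  have [measurable]: "real_cond_exp ?P F K \<in> borel_measurable ?P" 
    using borel_measurable_cond_exp2 .
  have [measurable]: "(\<lambda>x. first_projection (x 1)) \<in> borel_measurable ?P" using bK1 by (rule bm_measurable)
  have mean: "Pm.expectation (real_cond_exp ?P F K) = (\<integral>y. first_projection y \<partial>\<mu>)"
    unfolding marg[OF bm_first_projection, symmetric] by (rule integral_cong_AE[OF _ _ AE]) measurable
  have "kernel_sigma1_sq m \<mu> K = Pm.expectation (\<lambda>x. (first_projection (x 1) - (\<integral>y. first_projection y \<partial>\<mu>))\<^sup>2)"
    unfolding kernel_sigma1_sq_def F_def[symmetric] mean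
  proof (rule integral_cong_AE)
    show "AE x in ?P. (real_cond_exp ?P F K x - (\<integral>y. first_projection y \<partial>\<mu>))\<^sup>2 = (first_projection (x 1) - (\<integral>y. first_projection y \<partial>\<mu>))\<^sup>2"
      using AE by eventually_elim simp
  qed measurable
  also have "\<dots> = (\<integral>x. (first_projection x - (\<integral>y. first_projection y \<partial>\<mu>))\<^sup>2 \<partial>\<mu>)"
    by (rule marg) (intro bm_intros bm_first_projection)
  finally show ?thesis by (simp add: var_eq_centered[OF prob bm_first_projection])
qed

end

section \<open>The incomplete U-statistic\<close>

locale design_statistic = symmetric_bounded_kernel \<mu> m K
  for \<mu> :: "'a measure" and m :: nat and K :: "(nat \<Rightarrow> 'a) \<Rightarrow> real" +
  fixes n M :: nat and W :: "nat \<Rightarrow> nat set"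
  assumes M: "1 \<le> M" and W: "i \<in> {1..M} \<Longrightarrow> W i \<subseteq> {1..n} \<and> card (W i) = m"
begin

abbreviation "\<Omega> \<equiv> power_measure n \<mu>"

abbreviation "U \<equiv> incomplete_U m K M W"

abbreviation "kernel_on i \<equiv> \<lambda>x. kernel_at m K x (W i)"

definition containing :: "nat \<Rightarrow> nat set" where
  "containing k = {i\<in>{1..M}. k \<in> W i}"

definition containing2 :: "nat \<Rightarrow> nat \<Rightarrow> nat set" where
  "containing2 k l = {i\<in>{1..M}. k \<in> W i \<and> l \<in> W i}"

lemma card_containing [simp]: "card (containing k) = design_R M W k" "card (containing2 k l) = design_R2 M W k l"
  by (simp_all add: containing_def containing2_def design_R_def design_R2_def)

lemma finite_containing [simp]: "finite (containing k)" "finite (containing2 k l)"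
  by (simp_all add: containing_def containing2_def)

lemma prob_\<Omega>: "prob_space \<Omega>" by (rule prob_space_iid[OF prob])

lemma W_sub: "i \<in> {1..M} \<Longrightarrow> W i \<subseteq> {1..n}" and W_card: "i \<in> {1..M} \<Longrightarrow> card (W i) = m"
  using W by blast+

lemma two_le_if_containing2:
  assumes "i \<in> containing2 k l" "k \<noteq> l"
  shows "2 \<le> m"
proof -
  have i: "i \<in> {1..M}" "{k, l} \<subseteq> W i" using assms(1) by (auto simp: containing2_def)
  have "finite (W i)" using W_sub[OF i(1)] finite_subset by blast
  from card_mono[OF this i(2)] show ?thesis using W_card[OF i(1)] assms(2) by simp
qed

lemma bm_U: "bounded_measurable \<Omega> U"
  unfolding incomplete_U_def[abs_def] using W by (intro bm_intros bm_kernel_at) auto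

lemma expectation_U: "(\<integral>x. U x \<partial>\<Omega>) = (\<integral>x. K x \<partial>power_measure m \<mu>)"
proof -
  have "(\<integral>x. U x \<partial>\<Omega>) = 1 / real M * (\<Sum>i=1..M. \<integral>x. kernel_at m K x (W i) \<partial>\<Omega>)"
    unfolding incomplete_U_def Bochner_Integration.integral_mult_right_zero
    by (subst Bochner_Integration.integral_sum)
       (rule bm_integrable[OF prob_\<Omega> bm_kernel_at[OF W_sub W_card]], assumption+, rule refl)
  also have "\<dots> = 1 / real M * (\<Sum>i=1..M. \<integral>x. K x \<partial>power_measure m \<mu>)"
    using W by (intro arg_cong2[where f = "(*)"] refl sum.cong expectation_kernel_at) auto
  also have "\<dots> = (\<integral>x. K x \<partial>power_measure m \<mu>)" using M by simp
  finally show ?thesis .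
qed

lemma diff_op_U:
  "diff_op k y y' U x = 1 / real M * (\<Sum>i\<in>containing k. diff_op k y y' (kernel_on i) x)"
proof -
  have "diff_op k y y' U x = 1 / real M * (\<Sum>i=1..M. diff_op k y y' (kernel_on i) x)"
    by (simp add: diff_op_def incomplete_U_def sum_subtractf right_diff_distrib[symmetric] diff_divide_distrib)
  also have "(\<Sum>i=1..M. diff_op k y y' (kernel_on i) x)
     = (\<Sum>i\<in>containing k. diff_op k y y' (kernel_on i) x)"
  proof (rule sum.mono_neutral_right)
    show "\<forall>i\<in>{1..M} - containing k. diff_op k y y' (kernel_on i) x = 0"
    proof
      fix i assume i: "i \<in> {1..M} - containing k"
      then have "k \<notin> W i" "i \<in> {1..M}" by (auto simp: containing_def)
      then show "diff_op k y y' (kernel_on i) x = 0"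
        unfolding diff_op_def by (simp add: kernel_at_update_outside[OF W_sub W_card])
    qed
  qed (auto simp: containing_def)
  finally show ?thesis .
qed

lemma diff_op_twice_U:
  assumes "k \<noteq> l"
  shows "diff_op k y y' (diff_op l z z' U) x
    = 1 / real M * (\<Sum>i\<in>containing2 k l. diff_op k y y' (diff_op l z z' (kernel_on i)) x)"
proof -
  have "diff_op k y y' (diff_op l z z' U) x
      = 1 / real M * (\<Sum>i\<in>containing l. diff_op k y y' (diff_op l z z' (kernel_on i)) x)"
    by (simp add: diff_op_def[of k] diff_op_U[of l] sum_subtractf right_diff_distrib[symmetric] diff_divide_distrib)
  also have "(\<Sum>i\<in>containing l. diff_op k y y' (diff_op l z z' (kernel_on i)) x)
      = (\<Sum>i\<in>containing2 k l. diff_op k y y' (diff_op l z z' (kernel_on i)) x)"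
  proof (rule sum.mono_neutral_right)
    show "\<forall>i\<in>containing l - containing2 k l. diff_op k y y' (diff_op l z z' (kernel_on i)) x = 0"
    proof
      fix i assume i: "i \<in> containing l - containing2 k l"
      then have k: "k \<notin> W i" "i \<in> {1..M}" by (auto simp: containing_def containing2_def)
      have tw: "x(k := a, l := b) = x(l := b, k := a)" for a b
        using assms by (rule fun_upd_twist)
      show "diff_op k y y' (diff_op l z z' (kernel_on i)) x = 0"
        unfolding diff_op_twice tw using k by (simp add: kernel_at_update_outside[OF W_sub W_card])
    qed
  qed (auto simp: containing_def containing2_def)
  finally show ?thesis .
qed

text \<open>
  The Cauchy-Schwarz inequality for the sum over the sets containing \<open>k\<close> and \<open>l\<close>; the number of
  these sets enters once here and once more when the terms are bounded, which produces \<open>R\<^sub>k\<^sub>l\<^sup>2\<close>.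
\<close>

lemma diff_op_twice_U_square_le:
  assumes "k \<noteq> l"
  shows "(diff_op k y y' (diff_op l z z' U) x)\<^sup>2
    \<le> design_R2 M W k l / (real M)\<^sup>2 *
       (\<Sum>i\<in>containing2 k l. (diff_op k y y' (diff_op l z z' (kernel_on i)) x)\<^sup>2)"
proof -
  have "(diff_op k y y' (diff_op l z z' U) x)\<^sup>2 = 1 / (real M)\<^sup>2 *
     (\<Sum>i\<in>containing2 k l. diff_op k y y' (diff_op l z z' (kernel_on i)) x)\<^sup>2"
    by (simp add: diff_op_twice_U[OF assms] power_divide)
  also have "\<dots> \<le> 1 / (real M)\<^sup>2 * (design_R2 M W k l *
       (\<Sum>i\<in>containing2 k l. (diff_op k y y' (diff_op l z z' (kernel_on i)) x)\<^sup>2))"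
    using sum_square_le_card[OF finite_containing(2), of _ k l] by (intro mult_left_mono) auto
  finally show ?thesis by simp
qed

lemma bm_update_twice:
  assumes "k \<in> {1..n}" "l \<in> {1..n}" "x \<in> measurable N \<Omega>" "y \<in> measurable N \<mu>" "z \<in> measurable N \<mu>"
    and f: "bounded_measurable \<Omega> f"
  shows "bounded_measurable N (\<lambda>p. f ((x p)(k := y p, l := z p)))"
  using assms
  by (intro bm_compose[OF f] measurable_fun_upd[where J = "{1..n}" and I = "{1..n}"]) auto

lemma bm_diff_op_twice:
  assumes "k \<in> {1..n}" "l \<in> {1..n}" "x \<in> measurable N \<Omega>" "y \<in> measurable N \<mu>" "y' \<in> measurable N \<mu>"
    "z \<in> measurable N \<mu>" "z' \<in> measurable N \<mu>" and f: "bounded_measurable \<Omega> f"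
  shows "bounded_measurable N (\<lambda>p. diff_op k (y p) (y' p) (diff_op l (z p) (z' p) f) (x p))"
  unfolding diff_op_twice by (intro bm_diff bm_update_twice assms)

lemma var_second_difference:
  assumes kl: "k \<in> {1..n}" "l \<in> {1..n}" and x: "x \<in> space \<Omega>" and y: "y \<in> space \<mu>" "y' \<in> space \<mu>"
  shows "var \<mu> (\<lambda>z. U (x(k := y, l := z)) - U (x(k := y', l := z)))
     = 1 / 2 * (\<integral>z. \<integral>z'. (diff_op k y y' (diff_op l z z' U) x)\<^sup>2 \<partial>\<mu> \<partial>\<mu>)"
proof -
  have "bounded_measurable \<mu> (\<lambda>z. U (x(k := y, l := z)) - U (x(k := y', l := z)))"
    using kl x y by (intro bm_diff bm_update_twice bm_U) auto
  note * = var_eq_double_integral[OF prob this]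
  show ?thesis unfolding * diff_op_twice
    by (intro arg_cong2[where f = "(*)"] refl Bochner_Integration.integral_cong) (simp add: algebra_simps)
qed

text \<open>
  The bound is kept as a sum over the sets \<open>W i\<close>, each with its own enumeration \<open>e i\<close>, because it is
  used in two ways: pointwise with the supremum \<open>\<gamma>\<close>, and integrated over \<open>x\<close> with the mean \<open>\<beta>\<close>.
\<close>

lemma var_second_difference_le:
  assumes kl: "k \<in> {1..n}" "l \<in> {1..n}" "k \<noteq> l"
  shows "\<exists>e. (\<forall>i\<in>containing2 k l. inj_on (e i) {1..m} \<and> e i ` {1..m} \<subseteq> {1..n}) \<and>
    (\<forall>x\<in>space \<Omega>. \<forall>y\<in>space \<mu>. \<forall>y'\<in>space \<mu>.
      var \<mu> (\<lambda>z. U (x(k := y, l := z)) - U (x(k := y', l := z)))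
       \<le> 1 / 2 * (design_R2 M W k l / (real M)\<^sup>2 * (\<Sum>i\<in>containing2 k l. sq_interaction (pull m (e i) x) y y')))"
proof -
  have "\<exists>e. inj_on e {1..m} \<and> e ` {1..m} \<subseteq> {1..n} \<and>
    (\<forall>x\<in>space \<Omega>. \<forall>y\<in>space \<mu>. \<forall>y'\<in>space \<mu>. \<forall>z\<in>space \<mu>. \<forall>z'\<in>space \<mu>.
       diff_op k y y' (diff_op l z z' (kernel_on i)) x = diff_op 1 y y' (diff_op 2 z z' K) (pull m e x))"
    if "i \<in> containing2 k l" for i
  proof -
    have "i \<in> {1..M}" "k \<in> W i" "l \<in> W i" using that by (auto simp: containing2_def)
    with W[of i] kl(3) show ?thesis
      using diff_op_kernel_at[of "W i" n k l] by metis
  qed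
  then obtain e where e: "\<And>i. i \<in> containing2 k l \<Longrightarrow> inj_on (e i) {1..m} \<and> e i ` {1..m} \<subseteq> {1..n}"
    "\<And>i x y y' z z'. \<lbrakk>i \<in> containing2 k l; x\<in>space \<Omega>; y\<in>space \<mu>; y'\<in>space \<mu>; z\<in>space \<mu>; z'\<in>space \<mu>\<rbrakk> \<Longrightarrow>
       diff_op k y y' (diff_op l z z' (kernel_on i)) x = diff_op 1 y y' (diff_op 2 z z' K) (pull m (e i) x)"
    by metis
  show ?thesis
  proof (intro exI[of _ e] conjI ballI)
    fix i assume "i \<in> containing2 k l"
    then show "inj_on (e i) {1..m}" "e i ` {1..m} \<subseteq> {1..n}" using e(1) by auto
  next
    fix x y y' assume x: "x \<in> space \<Omega>" and y: "y \<in> space \<mu>" "y' \<in> space \<mu>"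
    let ?D = "\<lambda>i z z'. diff_op 1 y y' (diff_op 2 z z' K) (pull m (e i) x)"
    let ?S = "containing2 k l" and ?c = "design_R2 M W k l / (real M)\<^sup>2"
    have sp: "pull m (e i) x \<in> space (power_measure m \<mu>)" if "i \<in> ?S" for i
      using e(1)[OF that] x by (intro pull_space) auto
    have bD: "bounded_measurable (\<mu> \<Otimes>\<^sub>M \<mu>) (\<lambda>p. (?D i (fst p) (snd p))\<^sup>2)" if "i \<in> ?S" for i
      using sp[OF that] two_le_if_containing2[OF that kl(3)] y by (intro bm_diff_op_K) auto
    have bD1: "bounded_measurable \<mu> (\<lambda>z'. (?D i z z')\<^sup>2)" if "i \<in> ?S" "z \<in> space \<mu>" for i z
      using bm_pair_section[OF bD[OF that(1)] that(2)] .
    have bD2: "bounded_measurable \<mu> (\<lambda>z. \<integral>z'. (?D i z z')\<^sup>2 \<partial>\<mu>)" if "i \<in> ?S" for i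
      by (rule bm_integral[OF prob bD[OF that]])
    have sum_int: "(\<integral>z'. (\<Sum>i\<in>?S. (?D i z z')\<^sup>2) \<partial>\<mu>) = (\<Sum>i\<in>?S. \<integral>z'. (?D i z z')\<^sup>2 \<partial>\<mu>)"
      if "z \<in> space \<mu>" for z
      using that by (intro Bochner_Integration.integral_sum bm_integrable prob bD1)
    have "(\<integral>z. \<integral>z'. (diff_op k y y' (diff_op l z z' U) x)\<^sup>2 \<partial>\<mu> \<partial>\<mu>)
       \<le> (\<integral>z. \<integral>z'. ?c * (\<Sum>i\<in>?S. (?D i z z')\<^sup>2) \<partial>\<mu> \<partial>\<mu>)"
    proof (intro bm_integral_mono bm_integral prob)
      show "bounded_measurable (\<mu> \<Otimes>\<^sub>M \<mu>) (\<lambda>p. (diff_op k y y' (diff_op l (fst p) (snd p) U) x)\<^sup>2)"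
        using kl x y by (intro bm_power bm_diff_op_twice bm_U) auto
      show "bounded_measurable (\<mu> \<Otimes>\<^sub>M \<mu>) (\<lambda>p. ?c * (\<Sum>i\<in>?S. (?D i (fst p) (snd p))\<^sup>2))"
        by (intro bm_mult bm_const bm_sum bD)
      fix z assume z: "z \<in> space \<mu>"
      show "bounded_measurable \<mu> (\<lambda>z'. (diff_op k y y' (diff_op l z z' U) x)\<^sup>2)"
        using kl x y z by (intro bm_power bm_diff_op_twice bm_U) auto
      show "bounded_measurable \<mu> (\<lambda>z'. ?c * (\<Sum>i\<in>?S. (?D i z z')\<^sup>2))"
        using z by (intro bm_mult bm_const bm_sum bD1)
      fix z' assume z': "z' \<in> space \<mu>"
      have "(\<Sum>i\<in>?S. (diff_op k y y' (diff_op l z z' (kernel_on i)) x)\<^sup>2) = (\<Sum>i\<in>?S. (?D i z z')\<^sup>2)"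
        by (intro sum.cong refl arg_cong[where f = "\<lambda>a. a\<^sup>2"] e(2) x y z z')
      then show "(diff_op k y y' (diff_op l z z' U) x)\<^sup>2 \<le> ?c * (\<Sum>i\<in>?S. (?D i z z')\<^sup>2)"
        using diff_op_twice_U_square_le[OF kl(3), of y y' z z' x] by simp
    qed
    also have "\<dots> = (\<integral>z. ?c * (\<Sum>i\<in>?S. \<integral>z'. (?D i z z')\<^sup>2 \<partial>\<mu>) \<partial>\<mu>)"
      by (rule Bochner_Integration.integral_cong[OF refl])
         (simp only: Bochner_Integration.integral_mult_right_zero sum_int)
    also have "\<dots> = ?c * (\<Sum>i\<in>?S. sq_interaction (pull m (e i) x) y y')"
      unfolding sq_interaction_def Bochner_Integration.integral_mult_right_zero
      by (subst Bochner_Integration.integral_sum) (rule bm_integrable[OF prob bD2], assumption, rule refl)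
    finally show "var \<mu> (\<lambda>z. U (x(k := y, l := z)) - U (x(k := y', l := z)))
       \<le> 1 / 2 * (?c * (\<Sum>i\<in>?S. sq_interaction (pull m (e i) x) y y'))"
      unfolding var_second_difference[OF kl(1,2) x y] by simp
  qed
qed


lemma R_le_C: "k \<in> {1..n} \<Longrightarrow> real (design_R M W k) / real M \<le> design_C n M W"
  unfolding design_C_def by (rule Max_ge) auto

lemma C_pos: "0 < design_C n M W"
proof -
  have one: "1 \<in> {1..M}" using M by simp
  have "W 1 \<noteq> {}" using W_card[OF one] m by auto
  then obtain k where k: "k \<in> W 1" by auto
  then have "1 \<in> containing k" using one by (auto simp: containing_def)
  then have "0 < card (containing k)" by (metis card_gt_0_iff empty_iff finite_containing(1))
  then have "0 < real (design_R M W k) / real M" using M by simp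
  also have "\<dots> \<le> design_C n M W" using k W_sub[OF one] by (intro R_le_C) auto
  finally show ?thesis .
qed

lemma U_difference_le:
  assumes k: "k \<in> {1..n}" and x: "x \<in> space \<Omega>" and y: "y \<in> space \<mu>" "y' \<in> space \<mu>"
  shows "U (x(k := y)) - U (x(k := y')) \<le> 2 * design_C n M W"
proof -
  have "diff_op k y y' (kernel_on i) x \<le> 2" if "i \<in> containing k" for i
  proof -
    have i: "i \<in> {1..M}" using that by (auto simp: containing_def)
    show ?thesis
      using kernel_at_abs_le[OF W_sub[OF i] W_card[OF i] space_update[OF x y(1) k]]
        kernel_at_abs_le[OF W_sub[OF i] W_card[OF i] space_update[OF x y(2) k]]
      unfolding diff_op_def by linarith
  qed
  then have "(\<Sum>i\<in>containing k. diff_op k y y' (kernel_on i) x) \<le> design_R M W k * 2"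
    using sum_bounded_above[of "containing k" _ "2::real"] by simp
  then have "diff_op k y y' U x \<le> 1 / real M * (design_R M W k * 2)"
    unfolding diff_op_U by (intro mult_left_mono) auto
  also have "\<dots> = 2 * (real (design_R M W k) / real M)" by simp
  also have "\<dots> \<le> 2 * design_C n M W" using R_le_C[OF k] by simp
  finally show ?thesis by (simp add: diff_op_def)
qed

lemma interaction_le:
  assumes k: "k \<in> {1..n}" and x: "x \<in> space \<Omega>" and y: "y \<in> space \<mu>" "y' \<in> space \<mu>"
  shows "(\<Sum>l\<in>{1..n} - {k}. var \<mu> (\<lambda>z. U (x(k := y, l := z)) - U (x(k := y', l := z))))
    \<le> kernel_gamma m \<mu> K / 2 * (\<Sum>l\<in>{1..n} - {k}. (real (design_R2 M W k l))\<^sup>2 / (real M)\<^sup>2)"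
  unfolding sum_distrib_left
proof (rule sum_mono)
  fix l assume "l \<in> {1..n} - {k}"
  then have l: "l \<in> {1..n}" "k \<noteq> l" by auto
  obtain e where e': "\<forall>i\<in>containing2 k l. inj_on (e i) {1..m} \<and> e i ` {1..m} \<subseteq> {1..n}"
    "\<forall>x\<in>space \<Omega>. \<forall>y\<in>space \<mu>. \<forall>y'\<in>space \<mu>.
      var \<mu> (\<lambda>z. U (x(k := y, l := z)) - U (x(k := y', l := z)))
       \<le> 1 / 2 * (design_R2 M W k l / (real M)\<^sup>2 * (\<Sum>i\<in>containing2 k l. sq_interaction (pull m (e i) x) y y'))"
    using var_second_difference_le[OF k l] by blast
  note e = bspec[OF e'(1)] bspec[OF bspec[OF bspec[OF e'(2)]]]
  have "(\<Sum>i\<in>containing2 k l. sq_interaction (pull m (e i) x) y y') \<le> (\<Sum>i\<in>containing2 k l. kernel_gamma m \<mu> K)"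
  proof (rule sum_mono)
    fix i assume i: "i \<in> containing2 k l"
    show "sq_interaction (pull m (e i) x) y y' \<le> kernel_gamma m \<mu> K"
      using e(1)[OF i] x y by (intro sq_interaction_le_gamma two_le_if_containing2[OF i l(2)] pull_space) auto
  qed
  then have "(\<Sum>i\<in>containing2 k l. sq_interaction (pull m (e i) x) y y') \<le> design_R2 M W k l * kernel_gamma m \<mu> K"
    by simp
  then have "1 / 2 * (design_R2 M W k l / (real M)\<^sup>2 * (\<Sum>i\<in>containing2 k l. sq_interaction (pull m (e i) x) y y'))
     \<le> 1 / 2 * (design_R2 M W k l / (real M)\<^sup>2 * (design_R2 M W k l * kernel_gamma m \<mu> K))"
    by (intro mult_left_mono) auto
  also have "\<dots> = kernel_gamma m \<mu> K / 2 * ((real (design_R2 M W k l))\<^sup>2 / (real M)\<^sup>2)"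
    by (simp add: power2_eq_square)
  finally show "var \<mu> (\<lambda>z. U (x(k := y, l := z)) - U (x(k := y', l := z)))
     \<le> kernel_gamma m \<mu> K / 2 * ((real (design_R2 M W k l))\<^sup>2 / (real M)\<^sup>2)"
    using e(2)[OF x y] by linarith
qed

text \<open>
  For \<open>m < 2\<close> the second difference is not an operation on \<open>\<X>\<^sup>m\<close>; the value \<open>0\<close> follows the
  convention for \<open>kernel_beta\<close>.
\<close>

definition mean_sq_interaction :: "'a \<Rightarrow> 'a \<Rightarrow> real" where
  "mean_sq_interaction y y' = (if m < 2 then 0 else \<integral>w. sq_interaction w y y' \<partial>power_measure m \<mu>)"

lemma bm_mean_sq_interaction: "bounded_measurable (\<mu> \<Otimes>\<^sub>M \<mu>) (\<lambda>p. mean_sq_interaction (fst p) (snd p))"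
proof (cases "m < 2")
  case False
  have "bounded_measurable (\<mu> \<Otimes>\<^sub>M \<mu>) (\<lambda>p. \<integral>w. sq_interaction w (fst p) (snd p) \<partial>power_measure m \<mu>)"
    using False by (intro bm_integral prob_space_iid prob bm_sq_interaction) auto
  then show ?thesis using False by (simp add: mean_sq_interaction_def)
qed (simp add: mean_sq_interaction_def bm_const)

lemma beta_eq_mean_sq_interaction: "kernel_beta m \<mu> K = (\<integral>y. \<integral>y'. mean_sq_interaction y y' \<partial>\<mu> \<partial>\<mu>)"
proof (cases "m < 2")
  case True then show ?thesis by (simp add: kernel_beta_def mean_sq_interaction_def)
next
  case False then show ?thesis using beta_eq by (simp add: mean_sq_interaction_def)
qed

text \<open>
  Freeze the two values \<open>y\<close> and \<open>y'\<close> of coordinate \<open>k\<close> and regard \<open>V\<close> as a function of the other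
  coordinates.  The square of its mean yields the term with the first projections, and its variance
  is bounded by the Efron-Stein inequality, whose terms are second differences of \<open>U\<close>.
\<close>

lemma mean_square_difference_le:
  assumes k: "k \<in> {1..n}" and y: "y \<in> space \<mu>" "y' \<in> space \<mu>"
  shows "(\<integral>x. (U (x(k := y)) - U (x(k := y')))\<^sup>2 \<partial>\<Omega>)
    \<le> (real (design_R M W k))\<^sup>2 / (real M)\<^sup>2 * (first_projection y - first_projection y')\<^sup>2
      + mean_sq_interaction y y' / 2 * (\<Sum>l\<in>{1..n} - {k}. (real (design_R2 M W k l))\<^sup>2 / (real M)\<^sup>2)"
proof -
  define V where "V x = U (x(k := y)) - U (x(k := y'))" for x
  interpret \<Omega>: prob_space \<Omega> by (rule prob_\<Omega>)
  interpret \<mu>: prob_space \<mu> by (rule prob)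
  have upd: "bounded_measurable \<Omega> (\<lambda>x. f (x(k := a)))" if "bounded_measurable \<Omega> f" "a \<in> space \<mu>" for f a
    using k that(2) by (intro bm_compose[OF that(1)] measurable_fun_upd[where J = "{1..n}"]) auto
  have bV: "bounded_measurable \<Omega> V"
    unfolding V_def using y by (intro bm_diff upd bm_U)
  have mean: "(\<integral>x. V x \<partial>\<Omega>) = real (design_R M W k) / real M * (first_projection y - first_projection y')"
  proof -
    have bk: "bounded_measurable \<Omega> (\<lambda>x. diff_op k y y' (kernel_on i) x)" 
      "(\<integral>x. diff_op k y y' (kernel_on i) x \<partial>\<Omega>) = first_projection y - first_projection y'" if "i \<in> containing k" for i
    proof -
      have i: "i \<in> {1..M}" "k \<in> W i" using that by (auto simp: containing_def)
      note b = upd[OF bm_kernel_at[OF W_sub[OF i(1)] W_card[OF i(1)]]]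
      show "bounded_measurable \<Omega> (\<lambda>x. diff_op k y y' (kernel_on i) x)"
        unfolding diff_op_def using y by (intro bm_diff b)
      show "(\<integral>x. diff_op k y y' (kernel_on i) x \<partial>\<Omega>) = first_projection y - first_projection y'"
        unfolding diff_op_def
        by (subst Bochner_Integration.integral_diff[OF bm_integrable[OF prob_\<Omega> b[OF y(1)]] bm_integrable[OF prob_\<Omega> b[OF y(2)]]])
          (simp only: expectation_kernel_at_update[OF W_sub[OF i(1)] W_card[OF i(1)] i(2)] y)
    qed
    have "(\<integral>x. V x \<partial>\<Omega>) = (\<integral>x. 1 / real M * (\<Sum>i\<in>containing k. diff_op k y y' (kernel_on i) x) \<partial>\<Omega>)"
      unfolding diff_op_U[symmetric] by (simp add: V_def diff_op_def)
    also have "\<dots> = 1 / real M * (\<Sum>i\<in>containing k. \<integral>x. diff_op k y y' (kernel_on i) x \<partial>\<Omega>)"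
      unfolding Bochner_Integration.integral_mult_right_zero
      by (subst Bochner_Integration.integral_sum) (rule bm_integrable[OF prob_\<Omega> bk(1)], assumption, rule refl)
    also have "(\<Sum>i\<in>containing k. \<integral>x. diff_op k y y' (kernel_on i) x \<partial>\<Omega>)
        = real (design_R M W k) * (first_projection y - first_projection y')"
      using bk(2) by simp
    finally show ?thesis by simp
  qed
  have coord: "(\<integral>x. var \<mu> (\<lambda>z. V (x(l := z))) \<partial>\<Omega>)
      \<le> mean_sq_interaction y y' / 2 * ((real (design_R2 M W k l))\<^sup>2 / (real M)\<^sup>2)" if l: "l \<in> {1..n}" "k \<noteq> l" for l
  proof -
    obtain e where e': "\<forall>i\<in>containing2 k l. inj_on (e i) {1..m} \<and> e i ` {1..m} \<subseteq> {1..n}"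
      "\<forall>x\<in>space \<Omega>. \<forall>y\<in>space \<mu>. \<forall>y'\<in>space \<mu>.
        var \<mu> (\<lambda>z. U (x(k := y, l := z)) - U (x(k := y', l := z)))
         \<le> 1 / 2 * (design_R2 M W k l / (real M)\<^sup>2 * (\<Sum>i\<in>containing2 k l. sq_interaction (pull m (e i) x) y y'))"
      using var_second_difference_le[OF k l] by blast
  note e = bspec[OF e'(1)] bspec[OF bspec[OF bspec[OF e'(2)]]]
    have tw: "x(l := z, k := a) = x(k := a, l := z)" for x :: "nat \<Rightarrow> 'a" and z a
      using l(2) by (intro fun_upd_twist) auto
    have bdd: "bounded_measurable \<Omega> (\<lambda>x. sq_interaction (pull m (e i) x) y y')"
      "(\<integral>x. sq_interaction (pull m (e i) x) y y' \<partial>\<Omega>) = mean_sq_interaction y y'" if i: "i \<in> containing2 k l" for i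
    proof -
      have sub: "inj_on (e i) {1..m}" "e i ` {1..m} \<subseteq> {1..n}" using e(1)[OF i] by auto
      have m2: "2 \<le> m" by (rule two_le_if_containing2[OF i l(2)])
      show "bounded_measurable \<Omega> (\<lambda>x. sq_interaction (pull m (e i) x) y y')"
        using y by (intro bm_sq_interaction m2 measurable_pull sub) auto
      have "bounded_measurable (power_measure m \<mu>) (\<lambda>w. sq_interaction w y y')"
        using y by (intro bm_sq_interaction m2) auto
      from integral_pull[OF prob sub bm_measurable[OF this]]
      show "(\<integral>x. sq_interaction (pull m (e i) x) y y' \<partial>\<Omega>) = mean_sq_interaction y y'"
        using m2 by (simp add: mean_sq_interaction_def)
    qed
    have "(\<integral>x. var \<mu> (\<lambda>z. V (x(l := z))) \<partial>\<Omega>)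
       \<le> (\<integral>x. 1 / 2 * (design_R2 M W k l / (real M)\<^sup>2 * (\<Sum>i\<in>containing2 k l. sq_interaction (pull m (e i) x) y y')) \<partial>\<Omega>)"
    proof (intro bm_integral_mono prob_\<Omega> bm_var_section[OF prob l(1) bV] bm_mult bm_const bm_sum bdd(1))
      show "var \<mu> (\<lambda>z. V (x(l := z))) 
        \<le> 1 / 2 * (design_R2 M W k l / (real M)\<^sup>2 * (\<Sum>i\<in>containing2 k l. sq_interaction (pull m (e i) x) y y'))"
        if "x \<in> space \<Omega>" for x
        unfolding V_def tw by (rule e(2)[OF that y])
    qed
    also have "\<dots> = 1 / 2 * (design_R2 M W k l / (real M)\<^sup>2 * (\<Sum>i\<in>containing2 k l. \<integral>x. sq_interaction (pull m (e i) x) y y' \<partial>\<Omega>))"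
      unfolding Bochner_Integration.integral_mult_right_zero
      by (subst Bochner_Integration.integral_sum) (rule bm_integrable[OF prob_\<Omega> bdd(1)], assumption, rule refl)
    also have "(\<Sum>i\<in>containing2 k l. \<integral>x. sq_interaction (pull m (e i) x) y y' \<partial>\<Omega>) = design_R2 M W k l * mean_sq_interaction y y'"
      using bdd(2) by simp
    also have "1 / 2 * (design_R2 M W k l / (real M)\<^sup>2 * (design_R2 M W k l * mean_sq_interaction y y'))
        = mean_sq_interaction y y' / 2 * ((real (design_R2 M W k l))\<^sup>2 / (real M)\<^sup>2)"
      by (simp add: power2_eq_square)
    finally show ?thesis .
  qed
  have same: "(\<integral>x. var \<mu> (\<lambda>z. V (x(k := z))) \<partial>\<Omega>) = 0"
    using \<mu>.prob_space by (simp add: V_def phi_entropy_def)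
  have "(\<integral>x. (V x)\<^sup>2 \<partial>\<Omega>) = (\<integral>x. V x \<partial>\<Omega>)\<^sup>2 + var \<Omega> V"
    by (simp add: phi_entropy_def)
  also have "var \<Omega> V \<le> (\<Sum>l\<in>{1..n}. \<integral>x. var \<mu> (\<lambda>z. V (x(l := z))) \<partial>\<Omega>)"
    by (rule efron_stein[OF prob finite_atLeastAtMost bV])
  also have "\<dots> = (\<Sum>l\<in>{1..n} - {k}. \<integral>x. var \<mu> (\<lambda>z. V (x(l := z))) \<partial>\<Omega>)"
    by (subst sum.remove[OF finite_atLeastAtMost k]) (simp only: same add_0)
  also have "\<dots> \<le> (\<Sum>l\<in>{1..n} - {k}. mean_sq_interaction y y' / 2 * ((real (design_R2 M W k l))\<^sup>2 / (real M)\<^sup>2))"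
    by (intro sum_mono coord) auto
  finally have "(\<integral>x. (V x)\<^sup>2 \<partial>\<Omega>) \<le> (real (design_R M W k) / real M * (first_projection y - first_projection y'))\<^sup>2
     + (\<Sum>l\<in>{1..n} - {k}. mean_sq_interaction y y' / 2 * ((real (design_R2 M W k l))\<^sup>2 / (real M)\<^sup>2))"
    by (simp only: mean)
  then show ?thesis
    by (simp only: V_def sum_distrib_left power_mult_distrib power_divide)
qed

text \<open>
  Writing the conditional variance as half the mean squared difference of two copies, the previous
  bound is integrated over both copies; the first projections then contribute twice their variance.
\<close>

lemma mean_cond_var_le:
  assumes k: "k \<in> {1..n}"
  shows "(\<integral>x. var \<mu> (\<lambda>y. U (x(k := y))) \<partial>\<Omega>)
    \<le> (real (design_R M W k))\<^sup>2 / (real M)\<^sup>2 * kernel_sigma1_sq m \<mu> K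
      + kernel_beta m \<mu> K / 4 * (\<Sum>l\<in>{1..n} - {k}. (real (design_R2 M W k l))\<^sup>2 / (real M)\<^sup>2)"
proof -
  let ?r = "(real (design_R M W k))\<^sup>2 / (real M)\<^sup>2"
  let ?s = "\<Sum>l\<in>{1..n} - {k}. (real (design_R2 M W k l))\<^sup>2 / (real M)\<^sup>2"
  let ?D = "\<lambda>x y y'. (U (x(k := y)) - U (x(k := y')))\<^sup>2"
  have bD: "bounded_measurable N (\<lambda>p. ?D (x p) (y p) (y' p))"
    if "x \<in> measurable N \<Omega>" "y \<in> measurable N \<mu>" "y' \<in> measurable N \<mu>" for N :: "'b measure" and x y y'
    using that k by (intro bm_power bm_diff bm_compose[OF bm_U] measurable_fun_upd[where J = "{1..n}"]) auto
  have "(\<integral>x. var \<mu> (\<lambda>y. U (x(k := y))) \<partial>\<Omega>) = (\<integral>x. 1 / 2 * (\<integral>y. \<integral>y'. ?D x y y' \<partial>\<mu> \<partial>\<mu>) \<partial>\<Omega>)"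
    by (rule Bochner_Integration.integral_cong[OF refl])
       (rule var_eq_double_integral[OF prob bm_section[OF bm_U k]])
  also have "\<dots> = 1 / 2 * (\<integral>y. \<integral>x. \<integral>y'. ?D x y y' \<partial>\<mu> \<partial>\<Omega> \<partial>\<mu>)"
    unfolding Bochner_Integration.integral_mult_right_zero
    by (intro arg_cong2[where f = "(*)"] refl bm_fubini prob_\<Omega> prob bm_integral bD) measurable
  finally have L: "(\<integral>x. var \<mu> (\<lambda>y. U (x(k := y))) \<partial>\<Omega>) = 1 / 2 * (\<integral>y. \<integral>x. \<integral>y'. ?D x y y' \<partial>\<mu> \<partial>\<Omega> \<partial>\<mu>)" .
  have "(\<integral>y. \<integral>x. \<integral>y'. ?D x y y' \<partial>\<mu> \<partial>\<Omega> \<partial>\<mu>) = (\<integral>y. \<integral>y'. \<integral>x. ?D x y y' \<partial>\<Omega> \<partial>\<mu> \<partial>\<mu>)"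
    by (intro Bochner_Integration.integral_cong refl bm_fubini prob_\<Omega> prob bD) measurable
  also have "\<dots> \<le> (\<integral>y. \<integral>y'. ?r * (first_projection y - first_projection y')\<^sup>2 + mean_sq_interaction y y' / 2 * ?s \<partial>\<mu> \<partial>\<mu>)"
  proof -
    have 1: "bounded_measurable (\<mu> \<Otimes>\<^sub>M \<mu>) (\<lambda>p. \<integral>x. ?D x (fst p) (snd p) \<partial>\<Omega>)"
      by (intro bm_integral prob_\<Omega> bD) measurable
    have 2: "bounded_measurable (\<mu> \<Otimes>\<^sub>M \<mu>) (\<lambda>p. ?r * (first_projection (fst p) - first_projection (snd p))\<^sup>2 + mean_sq_interaction (fst p) (snd p) / 2 * ?s)"
      by (intro bm_add bm_mult bm_const bm_power bm_diff bm_divide bm_mean_sq_interaction bm_compose[OF bm_first_projection]) auto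
    show ?thesis
      by (intro bm_integral_mono bm_integral prob 1 2 mean_square_difference_le k
           bm_pair_section[OF 1] bm_pair_section[OF 2])
  qed
  also have "\<dots> = ?r * (2 * var \<mu> first_projection) + kernel_beta m \<mu> K / 2 * ?s"
  proof -
    have b1: "bounded_measurable (\<mu> \<Otimes>\<^sub>M \<mu>) (\<lambda>p. (first_projection (fst p) - first_projection (snd p))\<^sup>2)"
      by (intro bm_power bm_diff bm_compose[OF bm_first_projection]) auto
    note s1 = bm_integrable[OF prob bm_pair_section[OF b1]] bm_integrable[OF prob bm_integral[OF prob b1]]
    note s2 = bm_integrable[OF prob bm_pair_section[OF bm_mean_sq_interaction]] bm_integrable[OF prob bm_integral[OF prob bm_mean_sq_interaction]]
    have "(\<integral>y'. ?r * (first_projection y - first_projection y')\<^sup>2 + mean_sq_interaction y y' / 2 * ?s \<partial>\<mu>)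
      = ?r * (\<integral>y'. (first_projection y - first_projection y')\<^sup>2 \<partial>\<mu>) + (\<integral>y'. mean_sq_interaction y y' \<partial>\<mu>) / 2 * ?s" if "y \<in> space \<mu>" for y
      using s1(1)[OF that] s2(1)[OF that] by (subst Bochner_Integration.integral_add) auto
    then have "(\<integral>y. \<integral>y'. ?r * (first_projection y - first_projection y')\<^sup>2 + mean_sq_interaction y y' / 2 * ?s \<partial>\<mu> \<partial>\<mu>)
      = (\<integral>y. ?r * (\<integral>y'. (first_projection y - first_projection y')\<^sup>2 \<partial>\<mu>) + (\<integral>y'. mean_sq_interaction y y' \<partial>\<mu>) / 2 * ?s \<partial>\<mu>)"
      by (intro Bochner_Integration.integral_cong refl)
    also have "\<dots> = ?r * (\<integral>y. \<integral>y'. (first_projection y - first_projection y')\<^sup>2 \<partial>\<mu> \<partial>\<mu>) + (\<integral>y. \<integral>y'. mean_sq_interaction y y' \<partial>\<mu> \<partial>\<mu>) / 2 * ?s"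
      using s1(2) s2(2) by (subst Bochner_Integration.integral_add) auto
    finally show ?thesis
      by (simp add: var_eq_double_integral[OF prob bm_first_projection] beta_eq_mean_sq_interaction)
  qed
  finally have "1 / 2 * (\<integral>y. \<integral>x. \<integral>y'. ?D x y y' \<partial>\<mu> \<partial>\<Omega> \<partial>\<mu>)
     \<le> 1 / 2 * (?r * (2 * var \<mu> first_projection) + kernel_beta m \<mu> K / 2 * ?s)"
    by (rule mult_left_mono) simp
  also have "\<dots> = ?r * var \<mu> first_projection + kernel_beta m \<mu> K / 4 * ?s"
    by (simp add: algebra_simps)
  finally show ?thesis unfolding L sigma1_sq_eq .
qed

lemma mean_sum_cond_var_le:
  "(\<integral>x. sum_cond_var \<mu> {1..n} U x \<partial>\<Omega>)
     \<le> design_A n M W * kernel_sigma1_sq m \<mu> K + design_B n M W * kernel_beta m \<mu> K / 4"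
proof -
  have "(\<integral>x. sum_cond_var \<mu> {1..n} U x \<partial>\<Omega>) = (\<Sum>k=1..n. \<integral>x. var \<mu> (\<lambda>y. U (x(k := y))) \<partial>\<Omega>)"
    unfolding sum_cond_var_def
    by (intro Bochner_Integration.integral_sum bm_integrable prob_\<Omega> bm_var_section prob bm_U)
  also have "\<dots> \<le> (\<Sum>k=1..n. (real (design_R M W k))\<^sup>2 / (real M)\<^sup>2 * kernel_sigma1_sq m \<mu> K
      + kernel_beta m \<mu> K / 4 * (\<Sum>l\<in>{1..n} - {k}. (real (design_R2 M W k l))\<^sup>2 / (real M)\<^sup>2))"
    by (intro sum_mono mean_cond_var_le)
  also have "\<dots> = design_A n M W * kernel_sigma1_sq m \<mu> K + design_B n M W * kernel_beta m \<mu> K / 4"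
    unfolding design_A_def design_B_def sum.distrib sum_distrib_left[symmetric] sum_distrib_right[symmetric]
    by simp
  finally show ?thesis .
qed

lemma A_nonneg: "0 \<le> design_A n M W" and B_nonneg: "0 \<le> design_B n M W"
  by (auto simp: design_A_def design_B_def intro!: sum_nonneg)

lemma sigma1_sq_nonneg: "0 \<le> kernel_sigma1_sq m \<mu> K"
  unfolding sigma1_sq_eq by (rule var_nonneg[OF prob bm_first_projection])

theorem U_tail:
  assumes t: "0 < t"
  shows "measure \<Omega> {x\<in>space \<Omega>. U x - (\<integral>x. U x \<partial>\<Omega>) > t}
    \<le> exp (- t\<^sup>2 / (2 * design_A n M W * kernel_sigma1_sq m \<mu> K + design_B n M W * kernel_beta m \<mu> K / 2
        + (sqrt (design_B n M W * kernel_gamma m \<mu> K) + 4 * design_C n M W / 3) * t))"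
proof -
  let ?A = "design_A n M W" and ?B = "design_B n M W" and ?C = "design_C n M W"
  let ?\<gamma> = "kernel_gamma m \<mu> K" and ?v = "design_A n M W * kernel_sigma1_sq m \<mu> K + design_B n M W * kernel_beta m \<mu> K / 4"
  have "measure \<Omega> {x\<in>space \<Omega>. U x - (\<integral>x. U x \<partial>\<Omega>) > t}
    \<le> exp (- t\<^sup>2 / (2 * ?v + (2 * (2 * ?C) / 3 + sqrt (?B * ?\<gamma>)) * t))"
  proof (rule bernstein_bounded_interaction[OF prob finite_atLeastAtMost bm_U _ U_difference_le interaction_le])
    show "(\<Sum>k=1..n. ?\<gamma> / 2 * (\<Sum>l\<in>{1..n} - {k}. (real (design_R2 M W k l))\<^sup>2 / (real M)\<^sup>2))
       \<le> (sqrt (?B * ?\<gamma>))\<^sup>2 / 2"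
      unfolding sum_distrib_left[symmetric] using B_nonneg gamma_nonneg by (simp add: design_B_def)
    show "0 \<le> ?v"
      using A_nonneg B_nonneg sigma1_sq_nonneg beta_nonneg by simp
    show "0 \<le> ?\<gamma> / 2 * (\<Sum>l\<in>{1..n} - {k}. (real (design_R2 M W k l))\<^sup>2 / (real M)\<^sup>2)" for k
      using gamma_nonneg by (intro mult_nonneg_nonneg sum_nonneg) auto
  qed (use C_pos mean_sum_cond_var_le B_nonneg gamma_nonneg t in auto)
  also have "2 * ?v + (2 * (2 * ?C) / 3 + sqrt (?B * ?\<gamma>)) * t
    = 2 * ?A * kernel_sigma1_sq m \<mu> K + ?B * kernel_beta m \<mu> K / 2 + (sqrt (?B * ?\<gamma>) + 4 * ?C / 3) * t"
    by (simp add: algebra_simps)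
  finally show ?thesis .
qed

end

section \<open>Tail bound and confidence bound\<close>

text \<open>
  With this \<open>t\<close> the difference \<open>t\<^sup>2 - L * (V + s * t)\<close> equals \<open>s * L * \<surd>(V L)\<close>.
\<close>

lemma sub_gamma_quantile:
  fixes V s L :: real
  assumes "0 \<le> V" "0 < s" "1 \<le> L"
  defines "t \<equiv> sqrt (V * L) + s * L"
  shows "0 < t" "L \<le> t\<^sup>2 / (V + s * t)"
proof -
  have sL: "0 < s * L" using assms by simp
  have r: "0 \<le> sqrt (V * L)" "(sqrt (V * L))\<^sup>2 = V * L" using assms by simp_all
  show t: "0 < t" unfolding t_def using sL r(1) by linarith
  have "t\<^sup>2 - L * (V + s * t) = s * L * sqrt (V * L)"
    unfolding t_def using r(2) by (simp add: power2_eq_square algebra_simps)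
  then have "L * (V + s * t) \<le> t\<^sup>2" using sL r(1) by (smt (verit) mult_nonneg_nonneg)
  moreover have "0 < V + s * t" using assms t by (intro add_nonneg_pos mult_pos_pos) auto
  ultimately show "L \<le> t\<^sup>2 / (V + s * t)" by (simp add: pos_le_divide_eq)
qed

theorem theorem3p3:
  fixes \<mu> :: "'a measure" and P :: "'w measure"
    and X :: "nat \<Rightarrow> 'w \<Rightarrow> 'a" and K :: "(nat \<Rightarrow> 'a) \<Rightarrow> real"
    and m n M :: nat and W :: "nat \<Rightarrow> nat set"
    and U :: "'w \<Rightarrow> real" and \<theta> A B C \<alpha> \<beta> \<gamma> \<sigma>1_sq :: real
  assumes "1 \<le> m" and "m < n"
    and "prob_space \<mu>"
    and "K \<in> borel_measurable (power_measure m \<mu>)"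
    and "\<And>x. x \<in> space (power_measure m \<mu>) \<Longrightarrow> K x \<in> {-1..1}"
    and "symmetric_kernel m \<mu> K"
    and "prob_space P"
    and "prob_space.indep_vars P (\<lambda>_. \<mu>) X {1..n}"
    and "\<And>k. k \<in> {1..n} \<Longrightarrow> distr P \<mu> (X k) = \<mu>"
    and "1 \<le> M"
    and "\<And>i. i \<in> {1..M} \<Longrightarrow> W i \<subseteq> {1..n} \<and> card (W i) = m"
  defines "U \<equiv> (\<lambda>\<omega>. incomplete_U m K M W (\<lambda>k. X k \<omega>))"
    and "\<theta> \<equiv> prob_space.expectation P (\<lambda>\<omega>. K (\<lambda>j\<in>{1..m}. X j \<omega>))"
    and "A \<equiv> design_A n M W" and "B \<equiv> design_B n M W" and "C \<equiv> design_C n M W"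
    and "\<alpha> \<equiv> kernel_alpha m \<mu> K" and "\<beta> \<equiv> kernel_beta m \<mu> K"
    and "\<gamma> \<equiv> kernel_gamma m \<mu> K" and "\<sigma>1_sq \<equiv> kernel_sigma1_sq m \<mu> K"
  shows "(\<forall>t>0. prob_space.prob P {\<omega> \<in> space P. U \<omega> - \<theta> > t}
            \<le> exp (- t\<^sup>2 / (2 * A * \<sigma>1_sq + B * \<beta> / 2 + (sqrt (B * \<gamma>) + 4 * C / 3) * t)))
       \<and> (\<forall>\<delta>. 0 < \<delta> \<and> \<delta> \<le> 1 / exp 1 \<longrightarrow>
            prob_space.prob P {\<omega> \<in> space P.
                U \<omega> - \<theta> \<le> sqrt (2 * A * \<sigma>1_sq * ln (1 / \<delta>))
                            + (\<alpha> * sqrt B + 4 * C / 3) * ln (1 / \<delta>)}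
            \<ge> 1 - \<delta>)"
proof -
  interpret stat: design_statistic \<mu> m K n M W
    by (intro design_statistic.intro symmetric_bounded_kernel.intro design_statistic_axioms.intro assms)
  interpret P: prob_space P by fact
  let ?\<Omega> = "power_measure n \<mu>"
  define Y where "Y \<omega> = (\<lambda>k\<in>{1..n}. X k \<omega>)" for \<omega>
  have X: "X k \<in> measurable P \<mu>" if "k \<in> {1..n}" for k
    using assms(8) that unfolding P.indep_vars_def2 by auto
  have Y: "Y \<in> measurable P ?\<Omega>"
    unfolding Y_def[abs_def] using X by (intro measurable_restrict)
  have ne: "{1..n} \<noteq> {}" using assms(1,2) by auto
  have "distr P ?\<Omega> Y = PiM {1..n} (\<lambda>k. distr P \<mu> (X k))"
    using P.indep_vars_iff_distr_eq_PiM'[where X = X and M' = "\<lambda>_. \<mu>", OF ne X] assms(8)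
    unfolding Y_def[abs_def] by blast
  also have "\<dots> = ?\<Omega>"
    using assms(9) by (intro PiM_cong) auto
  finally have distr: "distr P ?\<Omega> Y = ?\<Omega>" .
  have kern: "kernel_at m K (\<lambda>k. X k \<omega>) (W i) = kernel_at m K (Y \<omega>) (W i)" if i: "i \<in> {1..M}" for \<omega> i
  proof -
    have fin: "finite (W i)" using stat.W_sub[OF i] finite_subset by blast
    have "sorted_list_of_set (W i) ! (j - 1) \<in> {1..n}" if "j \<in> {1..m}" for j
      using bij_betw_apply[OF sorted_list_bij_betw[OF fin stat.W_card[OF i]] that] stat.W_sub[OF i] by blast
    then show ?thesis
      unfolding kernel_at_def Y_def by (intro arg_cong[where f = K] restrict_ext) simp
  qed
  have UY: "U \<omega> = incomplete_U m K M W (Y \<omega>)" for \<omega>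
    unfolding U_def incomplete_U_def using kern by simp
  have idm: "inj_on (\<lambda>j. j) {1..m}" "(\<lambda>j. j) ` {1..m} \<subseteq> {1..n}" using assms(2) by auto
  have \<theta>: "\<theta> = (\<integral>x. incomplete_U m K M W x \<partial>?\<Omega>)"
  proof -
    have "\<theta> = (\<integral>\<omega>. K (pull m (\<lambda>j. j) (Y \<omega>)) \<partial>P)"
      unfolding \<theta>_def pull_def Y_def using assms(2)
      by (intro Bochner_Integration.integral_cong refl arg_cong[where f = K] restrict_ext) auto
    also have "\<dots> = (\<integral>x. K (pull m (\<lambda>j. j) x) \<partial>distr P ?\<Omega> Y)"
      by (rule integral_distr[symmetric, OF Y]) (rule measurable_compose[OF measurable_pull[OF idm(2)] assms(4)])
    also have "\<dots> = (\<integral>x. K x \<partial>power_measure m \<mu>)"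
      unfolding distr by (rule integral_pull[OF assms(3) idm assms(4)])
    finally show ?thesis unfolding stat.expectation_U .
  qed
  have bU: "incomplete_U m K M W \<in> borel_measurable ?\<Omega>"
    by (rule bm_measurable[OF stat.bm_U])
  have U_meas [measurable]: "U \<in> borel_measurable P"
    using measurable_compose[OF Y bU] unfolding UY[abs_def] .
  define V where "V = 2 * A * \<sigma>1_sq + B * \<beta> / 2"
  define s where "s = sqrt (B * \<gamma>) + 4 * C / 3"
  have tail: "P.prob {\<omega>\<in>space P. U \<omega> - \<theta> > t} \<le> exp (- t\<^sup>2 / (V + s * t))" if t: "0 < t" for t
  proof -
    let ?S = "{x\<in>space ?\<Omega>. incomplete_U m K M W x - \<theta> > t}"
    have S: "?S \<in> sets ?\<Omega>" using bU by measurable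
    have "{\<omega>\<in>space P. U \<omega> - \<theta> > t} = Y -` ?S \<inter> space P"
      using measurable_space[OF Y] by (auto simp: UY)
    then have "P.prob {\<omega>\<in>space P. U \<omega> - \<theta> > t} = measure (distr P ?\<Omega> Y) ?S"
      using measure_distr[OF Y S] by simp
    also have "\<dots> \<le> exp (- t\<^sup>2 / (V + s * t))"
      using stat.U_tail[OF t] unfolding distr \<theta> V_def s_def A_def B_def C_def \<beta>_def \<gamma>_def \<sigma>1_sq_def .
    finally show ?thesis .
  qed
  have nn: "0 \<le> A" "0 \<le> B" "0 < C" "0 \<le> \<beta>" "0 \<le> \<gamma>" "0 \<le> \<sigma>1_sq"
    unfolding A_def B_def C_def \<beta>_def \<gamma>_def \<sigma>1_sq_def
    by (fact stat.A_nonneg stat.B_nonneg stat.C_pos stat.beta_nonneg stat.gamma_nonneg stat.sigma1_sq_nonneg)+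
  have "1 - \<delta> \<le> P.prob {\<omega>\<in>space P. U \<omega> - \<theta> \<le> sqrt (2 * A * \<sigma>1_sq * ln (1 / \<delta>)) + (\<alpha> * sqrt B + 4 * C / 3) * ln (1 / \<delta>)}"
    if \<delta>: "0 < \<delta>" "\<delta> \<le> 1 / exp 1" for \<delta>
  proof -
    define L where "L = ln (1 / \<delta>)"
    have "exp 1 \<le> 1 / \<delta>" using \<delta> by (simp add: field_simps)
    then have L1: "1 \<le> L" unfolding L_def using \<delta>(1) by (simp add: ln_ge_iff)
    have eL: "exp (- L) = \<delta>" using \<delta>(1) by (simp add: L_def ln_div)
    define t where "t = sqrt (V * L) + s * L"
    have V0: "0 \<le> V" and s0: "0 < s" using nn by (simp_all add: V_def s_def add_nonneg_pos)
    note t = sub_gamma_quantile[OF V0 s0 L1, folded t_def]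
    define r where "r = sqrt (2 * A * \<sigma>1_sq * L) + (\<alpha> * sqrt B + 4 * C / 3) * L"
    have "t \<le> r"
    proof -
      have "sqrt (V * L) \<le> sqrt (2 * A * \<sigma>1_sq * L) + sqrt (B * \<beta> / 2 * L)"
        unfolding V_def distrib_right using nn L1 by (intro sqrt_add_le_add_sqrt) auto
      \<comment> \<open>This is where \<open>\<delta> \<le> 1/e\<close> enters: \<open>L \<ge> 1\<close> gives \<open>\<surd>L \<le> L\<close>.\<close>
      also have "sqrt (B * \<beta> / 2 * L) \<le> sqrt (\<beta> / 2) * sqrt B * L"
      proof -
        have "sqrt L \<le> L" using L1 by (simp add: real_le_lsqrt self_le_power real_sqrt_le_iff' power2_eq_square)
        then have "sqrt (\<beta> / 2) * sqrt B * sqrt L \<le> sqrt (\<beta> / 2) * sqrt B * L"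
          using nn by (intro mult_left_mono) auto
        moreover have "sqrt (B * \<beta> / 2 * L) = sqrt (\<beta> / 2) * sqrt B * sqrt L"
          unfolding real_sqrt_mult[symmetric] by (simp add: mult_ac)
        ultimately show ?thesis by simp
      qed
      finally have "sqrt (V * L) \<le> sqrt (2 * A * \<sigma>1_sq * L) + sqrt (\<beta> / 2) * sqrt B * L" by simp
      moreover have "r = sqrt (2 * A * \<sigma>1_sq * L) + sqrt (\<beta> / 2) * sqrt B * L + s * L"
        by (simp add: r_def s_def \<alpha>_def kernel_alpha_def \<beta>_def[symmetric] \<gamma>_def[symmetric]
            real_sqrt_mult algebra_simps)
      ultimately show ?thesis by (simp add: t_def)
    qed
    have "P.prob {\<omega>\<in>space P. U \<omega> - \<theta> > t} \<le> exp (- t\<^sup>2 / (V + s * t))"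
      by (rule tail[OF t(1)])
    also have "\<dots> \<le> exp (- L)" using t(2) by simp
    also have "\<dots> = \<delta>" by (rule eL)
    finally have "1 - \<delta> \<le> 1 - P.prob {\<omega>\<in>space P. U \<omega> - \<theta> > t}" by simp
    also have "\<dots> = P.prob (space P - {\<omega>\<in>space P. U \<omega> - \<theta> > t})"
      by (rule P.prob_compl[symmetric]) measurable
    also have "\<dots> \<le> P.prob {\<omega>\<in>space P. U \<omega> - \<theta> \<le> r}"
      using \<open>t \<le> r\<close> by (intro P.finite_measure_mono) auto
    finally show ?thesis unfolding r_def L_def .
  qed
  with tail show ?thesis unfolding V_def s_def by blast
qed

end
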